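(* Let $(\Sigma,\mathcal M,\mathcal P)$ be a marked surface with non-empty boundary and non-empty set of punctures, not a once-punctured monogon, with an ideal triangulation $\tau$ such that each puncture belongs to a self-folded triangle and no triangle shares a side with two self-folded triangles, let $\widetilde\Sigma=(\Sigma^+\sqcup\Sigma^-)/(\Psi_P,P\in\mathcal P)$ be the associated surface and $\sigma:\widetilde\Sigma\to\widetilde\Sigma$ the order-two homeomorphism induced by exchanging $\Sigma^+$ and $\Sigma^-$. There is a homeomorphism $\widetilde\Sigma/\sigma\to\Sigma$ that induces an orbifold structure on $\Sigma$ on which every $P\in\mathcal P$ is an orbifold point of order $2$.
   Context: $\Sigma$ is a compact (the paper says "closed") connected oriented surface with non-empty boundary; $\mathcal M$ is a finite set of marked points on $\partial\Sigma$, at least one on each boundary component; $\mathcal P$ is a finite non-empty set of points (punctures) in the interior. Ideal triangulations are in the sense of Fomin–Shapiro–Thurston; a self-folded triangle consists of a loop based at a point $A$ enclosing exactly one puncture $P$ and of the folded side $i_P$ joining $A$ to $P$ inside the loop. With the assumptions on $\tau$, the endpoint of $i_P$ other than $P$ is in $\mathcal M$. $\Sigma^+$ is the surface obtained by cutting $\Sigma$ along all folded sides $i_P$, $P\in\mathcal P$. Each $i_P$ becomes a boundary segment $[P_1^+,P_2^+]$ of $\Sigma^+$ (oriented by the orientation of the boundary), which runs along $i_P$ from its marked point $A$ to $P$ and back; if several punctures are linked to the same marked point, the corresponding segments are consecutive on the boundary. Fix homeomorphisms $\varphi_P:[P_1^+,P_2^+]\to[0,1]$ respecting the orientation, such that folding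 each $[P_1^+,P_2^+]$ by $x\sim\varphi_P^{-1}(1-\varphi_P(x))$ recovers $\Sigma$ from $\Sigma^+$. $\Sigma^-$ is another copy of $\Sigma^+$ (with corresponding segments $[P_1^-,P_2^-]$), $S$ is the involution of $\Sigma^+\sqcup\Sigma^-$ exchanging the two copies, and $\Psi_P:[P_1^+,P_2^+]\to[P_1^-,P_2^-]$ is $\Psi_P(x)=S\big(\varphi_P^{-1}(1-\varphi_P(x))\big)$. $\widetilde\Sigma$ is obtained from $\Sigma^+\sqcup\Sigma^-$ by identifying $x$ with $\Psi_P(x)$ for all $P\in\mathcal P$ and $x\in[P_1^+,P_2^+]$. $S$ induces a homeomorphism $\sigma$ of $\widetilde\Sigma$ of order $2$. Orbifolds are in the sense of Thurston; the structure on $\Sigma$ is the one of the quotient of $\widetilde\Sigma$ by the group $\{1,\sigma\}$. *)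

theory Defs
  imports "HOL-Complex_Analysis.Complex_Analysis" "HOL-Algebra.Bij"
begin

section \<open>Identification spaces\<close>

text \<open>Quotient of a topological space by the equivalence relation generated by a relation
  on its points; the points of the quotient are the equivalence classes.\<close>

definition identification_class :: "'a topology \<Rightarrow> ('a \<times> 'a) set \<Rightarrow> 'a \<Rightarrow> 'a set" where
  "identification_class X r x = {y \<in> topspace X. equivclp (\<lambda>u v. (u, v) \<in> r) x y}"

definition quotient_space :: "'a topology \<Rightarrow> ('a \<times> 'a) set \<Rightarrow> 'a set topology" where
  "quotient_space X r = topology (\<lambda>W. W \<subseteq> identification_class X r ` topspace X \<and>
     openin X {x \<in> topspace X. identification_class X r x \<in> W})"

lemma openin_quotient_space:
  "openin (quotient_space X r) W \<longleftrightarrow> W \<subseteq> identification_class X r ` topspace X \<and>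
     openin X {x \<in> topspace X. identification_class X r x \<in> W}"
proof -
  let ?k = "identification_class X r"
  let ?L = "\<lambda>W. W \<subseteq> ?k ` topspace X \<and> openin X {x \<in> topspace X. ?k x \<in> W}"
  have "istopology ?L"
    unfolding istopology_def
  proof (intro conjI allI impI)
    fix S T assume S: "?L S" and T: "?L T"
    show "S \<inter> T \<subseteq> ?k ` topspace X" using S by blast
    have "{x \<in> topspace X. ?k x \<in> S \<inter> T}
        = {x \<in> topspace X. ?k x \<in> S} \<inter> {x \<in> topspace X. ?k x \<in> T}" by blast
    then show "openin X {x \<in> topspace X. ?k x \<in> S \<inter> T}" using S T by auto
  next
    fix K assume K: "\<forall>S\<in>K. ?L S"
    then show "\<Union>K \<subseteq> ?k ` topspace X" by blast
    have "{x \<in> topspace X. ?k x \<in> \<Union>K} = (\<Union>S\<in>K. {x \<in> topspace X. ?k x \<in> S})" by blast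
    then show "openin X {x \<in> topspace X. ?k x \<in> \<Union>K}" using K by auto
  qed
  then show ?thesis unfolding quotient_space_def by (simp add: topology_inverse')
qed

lemma quotient_map_identification_class:
  "quotient_map X (quotient_space X r) (identification_class X r)"
proof -
  have "topspace (quotient_space X r) = identification_class X r ` topspace X"
  proof
    show "topspace (quotient_space X r) \<subseteq> identification_class X r ` topspace X"
      using openin_quotient_space openin_topspace by blast
    have "{x \<in> topspace X. identification_class X r x \<in> identification_class X r ` topspace X}
        = topspace X" by blast
    then show "identification_class X r ` topspace X \<subseteq> topspace (quotient_space X r)"
      by (intro openin_subset) (simp add: openin_quotient_space)
  qed
  then show ?thesis
    unfolding quotient_map_def by (simp add: openin_quotient_space)
qed

definition orbit_relation :: "'a topology \<Rightarrow> ('a \<Rightarrow> 'a) set \<Rightarrow> ('a \<times> 'a) set" where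
  "orbit_relation X G = {(x, g x) |x g. x \<in> topspace X \<and> g \<in> G}"


section \<open>Oriented surfaces with boundary\<close>

definition upper_halfplane :: "complex set" where
  "upper_halfplane = {z. 0 \<le> Im z}"

definition surface_chart :: "'a topology \<Rightarrow> 'a set \<Rightarrow> ('a \<Rightarrow> complex) \<Rightarrow> bool" where
  "surface_chart X U f \<longleftrightarrow> openin X U \<and> openin (top_of_set upper_halfplane) (f ` U) \<and>
     homeomorphic_map (subtopology X U) (top_of_set (f ` U)) f"

definition surface :: "'a topology \<Rightarrow> bool" where
  "surface X \<longleftrightarrow> Hausdorff_space X \<and> second_countable X \<and>
     (\<forall>x\<in>topspace X. \<exists>U f. surface_chart X U f \<and> x \<in> U)"

definition surface_boundary :: "'a topology \<Rightarrow> 'a set" where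
  "surface_boundary X = {x. \<exists>U f. surface_chart X U f \<and> x \<in> U \<and> Im (f x) = 0}"

definition surface_interior :: "'a topology \<Rightarrow> 'a set" where
  "surface_interior X = topspace X - surface_boundary X"

text \<open>For a homeomorphism between open subsets of the half-plane: it has local degree 1 at every
  interior point. (The closed discs contained in a subset of the half-plane are centred at
  points with positive imaginary part, so boundary points play no role.)\<close>

definition orientation_preserving_on :: "complex set \<Rightarrow> (complex \<Rightarrow> complex) \<Rightarrow> bool" where
  "orientation_preserving_on W h \<longleftrightarrow>
     (\<forall>z r. 0 < r \<and> cball z r \<subseteq> W \<longrightarrow> winding_number (h \<circ> circlepath z r) (h z) = 1)"

text \<open>An orientation is given by an atlas with orientation preserving coordinate changes.\<close>

definition oriented_surface :: "'a topology \<Rightarrow> ('a set \<times> ('a \<Rightarrow> complex)) set \<Rightarrow> bool" where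
  "oriented_surface X A \<longleftrightarrow> surface X \<and>
     (\<forall>(U, f)\<in>A. surface_chart X U f) \<and> (\<Union>(U, f)\<in>A. U) = topspace X \<and>
     (\<forall>(U, f)\<in>A. \<forall>(V, g)\<in>A. orientation_preserving_on (f ` (U \<inter> V)) (g \<circ> inv_into U f))"


section \<open>Marked surfaces and ideal triangulations\<close>

definition marked_surface ::
  "'a topology \<Rightarrow> ('a set \<times> ('a \<Rightarrow> complex)) set \<Rightarrow> 'a set \<Rightarrow> 'a set \<Rightarrow> bool" where
  "marked_surface X A M P \<longleftrightarrow>
     oriented_surface X A \<and> compact_space X \<and> connected_space X \<and>
     surface_boundary X \<noteq> {} \<and>
     finite M \<and> M \<subseteq> surface_boundary X \<and>
     (\<forall>C\<in>connected_components_of (subtopology X (surface_boundary X)). C \<inter> M \<noteq> {}) \<and>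
     finite P \<and> P \<subseteq> surface_interior X"

definition once_punctured_monogon :: "'a topology \<Rightarrow> 'a set \<Rightarrow> 'a set \<Rightarrow> bool" where
  "once_punctured_monogon X M P \<longleftrightarrow>
     X homeomorphic_space top_of_set (cball (0::complex) 1) \<and> card M = 1 \<and> card P = 1"

definition disc_in :: "'a topology \<Rightarrow> (complex \<Rightarrow> 'a) \<Rightarrow> bool" where
  "disc_in X u \<longleftrightarrow> continuous_map (top_of_set (cball 0 1)) X u \<and> inj_on u (cball 0 1)"

definition cuts_out_unpunctured_monogon ::
  "'a topology \<Rightarrow> 'a set \<Rightarrow> 'a set \<Rightarrow> (real \<Rightarrow> 'a) \<Rightarrow> bool" where
  "cuts_out_unpunctured_monogon X M P \<gamma> \<longleftrightarrow>
     \<gamma> 0 = \<gamma> 1 \<and>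
     (\<exists>u. disc_in X u \<and> u ` sphere 0 1 = \<gamma> ` {0..1} \<and> u ` cball 0 1 \<inter> (M \<union> P) = {\<gamma> 0})"

text \<open>The digon has one side along the curve and the other one along the boundary of the surface.
  Its two vertices \<open>u 1\<close> and \<open>u (-1)\<close> may coincide, which happens when the boundary component
  carries a single marked point.\<close>

definition cuts_out_unpunctured_digon ::
  "'a topology \<Rightarrow> 'a set \<Rightarrow> 'a set \<Rightarrow> (real \<Rightarrow> 'a) \<Rightarrow> bool" where
  "cuts_out_unpunctured_digon X M P \<gamma> \<longleftrightarrow>
     (\<exists>u. continuous_map (top_of_set (cball 0 1)) X u \<and>
        inj_on u (cball 0 1 - {1, -1}) \<and>
        u ` {1, -1} \<inter> u ` (cball 0 1 - {1, -1}) = {} \<and>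
        u ` {z \<in> sphere 0 1. 0 \<le> Im z} = \<gamma> ` {0..1} \<and>
        u ` {z \<in> sphere 0 1. Im z \<le> 0} \<subseteq> surface_boundary X \<and>
        u ` cball 0 1 \<inter> (M \<union> P) = u ` {1, -1})"

definition ideal_arc :: "'a topology \<Rightarrow> 'a set \<Rightarrow> 'a set \<Rightarrow> (real \<Rightarrow> 'a) \<Rightarrow> bool" where
  "ideal_arc X M P \<gamma> \<longleftrightarrow>
     pathin X \<gamma> \<and> \<gamma> 0 \<in> M \<union> P \<and> \<gamma> 1 \<in> M \<union> P \<and>
     inj_on \<gamma> {0..<1} \<and> inj_on \<gamma> {0<..1} \<and>
     \<gamma> ` {0<..<1} \<inter> (M \<union> P \<union> surface_boundary X) = {} \<and>
     \<not> cuts_out_unpunctured_monogon X M P \<gamma> \<and> \<not> cuts_out_unpunctured_digon X M P \<gamma>"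

text \<open>Isotopy within the class of arcs, regardless of the direction in which they are traversed.\<close>

definition isotopic_arcs ::
  "'a topology \<Rightarrow> 'a set \<Rightarrow> 'a set \<Rightarrow> (real \<Rightarrow> 'a) \<Rightarrow> (real \<Rightarrow> 'a) \<Rightarrow> bool" where
  "isotopic_arcs X M P \<gamma> \<delta> \<longleftrightarrow>
     (\<exists>H. continuous_map (prod_topology (top_of_set {0..1::real}) (top_of_set {0..1::real})) X H \<and>
        (\<forall>t\<in>{0..1}. ideal_arc X M P (\<lambda>s. H (t, s))) \<and>
        (\<forall>s\<in>{0..1}. H (0, s) = \<gamma> s) \<and>
        ((\<forall>s\<in>{0..1}. H (1, s) = \<delta> s) \<or> (\<forall>s\<in>{0..1}. H (1, s) = \<delta> (1 - s))))"

definition compatible_arcs ::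
  "'a topology \<Rightarrow> 'a set \<Rightarrow> 'a set \<Rightarrow> (real \<Rightarrow> 'a) \<Rightarrow> (real \<Rightarrow> 'a) \<Rightarrow> bool" where
  "compatible_arcs X M P \<gamma> \<delta> \<longleftrightarrow>
     (\<exists>\<gamma>' \<delta>'. isotopic_arcs X M P \<gamma> \<gamma>' \<and> isotopic_arcs X M P \<delta> \<delta>' \<and>
        \<gamma>' ` {0<..<1} \<inter> \<delta>' ` {0<..<1} = {})"

text \<open>An ideal triangulation is a maximal set of pairwise compatible isotopy classes of arcs. It is
  given here by representatives whose interiors are pairwise disjoint.\<close>

definition ideal_triangulation ::
  "'a topology \<Rightarrow> 'a set \<Rightarrow> 'a set \<Rightarrow> (real \<Rightarrow> 'a) set \<Rightarrow> bool" where
  "ideal_triangulation X M P \<tau> \<longleftrightarrow>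
     (\<forall>\<gamma>\<in>\<tau>. ideal_arc X M P \<gamma>) \<and>
     (\<forall>\<gamma>\<in>\<tau>. \<forall>\<delta>\<in>\<tau>. \<gamma> \<noteq> \<delta> \<longrightarrow>
        \<not> isotopic_arcs X M P \<gamma> \<delta> \<and> \<gamma> ` {0<..<1} \<inter> \<delta> ` {0<..<1} = {}) \<and>
     (\<forall>\<gamma>. ideal_arc X M P \<gamma> \<and> (\<forall>\<delta>\<in>\<tau>. compatible_arcs X M P \<gamma> \<delta>) \<longrightarrow>
        (\<exists>\<delta>\<in>\<tau>. isotopic_arcs X M P \<gamma> \<delta>))"

text \<open>Triangles are represented by the open regions into which the arcs cut the surface.\<close>

definition triangles :: "'a topology \<Rightarrow> (real \<Rightarrow> 'a) set \<Rightarrow> 'a set set" where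
  "triangles X \<tau> =
     connected_components_of (subtopology X (topspace X - (\<Union>\<gamma>\<in>\<tau>. \<gamma> ` {0..1})))"

definition side_of :: "'a topology \<Rightarrow> (real \<Rightarrow> 'a) \<Rightarrow> 'a set \<Rightarrow> bool" where
  "side_of X \<gamma> T \<longleftrightarrow> \<gamma> ` {0..1} \<subseteq> X closure_of T"

definition share_side :: "'a topology \<Rightarrow> (real \<Rightarrow> 'a) set \<Rightarrow> 'a set \<Rightarrow> 'a set \<Rightarrow> bool" where
  "share_side X \<tau> T T' \<longleftrightarrow> T \<noteq> T' \<and> (\<exists>\<gamma>\<in>\<tau>. side_of X \<gamma> T \<and> side_of X \<gamma> T')"

text \<open>\<open>T\<close> is the self-folded triangle with loop \<open>l\<close>, enclosed puncture \<open>p\<close> and folded side \<open>e\<close>.\<close>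

definition self_folded_triangle ::
  "'a topology \<Rightarrow> 'a set \<Rightarrow> 'a set \<Rightarrow> (real \<Rightarrow> 'a) set \<Rightarrow>
   'a set \<Rightarrow> (real \<Rightarrow> 'a) \<Rightarrow> 'a \<Rightarrow> (real \<Rightarrow> 'a) \<Rightarrow> bool" where
  "self_folded_triangle X M P \<tau> T l p e \<longleftrightarrow>
     T \<in> triangles X \<tau> \<and> l \<in> \<tau> \<and> e \<in> \<tau> \<and> p \<in> P \<and> l 0 = l 1 \<and>
     {e 0, e 1} = {l 0, p} \<and>
     (\<exists>u. disc_in X u \<and> u ` sphere 0 1 = l ` {0..1} \<and> p \<in> u ` ball 0 1 \<and>
        u ` cball 0 1 \<inter> (M \<union> P) = {l 0, p} \<and>
        e ` {0<..<1} \<subseteq> u ` ball 0 1 \<and>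
        T = u ` ball 0 1 - e ` {0..1})"

definition is_self_folded ::
  "'a topology \<Rightarrow> 'a set \<Rightarrow> 'a set \<Rightarrow> (real \<Rightarrow> 'a) set \<Rightarrow> 'a set \<Rightarrow> bool" where
  "is_self_folded X M P \<tau> T \<longleftrightarrow> (\<exists>l p e. self_folded_triangle X M P \<tau> T l p e)"


section \<open>Cutting along the folded sides, and the double\<close>

text \<open>\<open>seg p\<close> is a boundary segment with parametrisation \<open>\<phi> p\<close> onto the unit interval.\<close>

definition flip :: "('a \<Rightarrow> 'b set) \<Rightarrow> ('a \<Rightarrow> 'b \<Rightarrow> real) \<Rightarrow> 'a \<Rightarrow> 'b \<Rightarrow> 'b" where
  "flip seg \<phi> p x = inv_into (seg p) (\<phi> p) (1 - \<phi> p x)"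

definition fold_relation :: "'a set \<Rightarrow> ('a \<Rightarrow> 'b set) \<Rightarrow> ('a \<Rightarrow> 'b \<Rightarrow> real) \<Rightarrow> ('b \<times> 'b) set" where
  "fold_relation P seg \<phi> = {(x, flip seg \<phi> p x) |p x. p \<in> P \<and> x \<in> seg p}"

text \<open>The boundary orientation is the direction of increasing real part in the oriented
  half-plane charts.\<close>

definition respects_boundary_orientation ::
  "'b topology \<Rightarrow> ('b set \<times> ('b \<Rightarrow> complex)) set \<Rightarrow> 'b set \<Rightarrow> ('b \<Rightarrow> real) \<Rightarrow> bool" where
  "respects_boundary_orientation Y B s \<phi> \<longleftrightarrow>
     (\<forall>(U, f)\<in>B. \<forall>x\<in>U \<inter> s. \<exists>N. openin Y N \<and> x \<in> N \<and> N \<subseteq> U \<and>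
        (\<forall>y\<in>N \<inter> s. \<forall>z\<in>N \<inter> s. \<phi> y < \<phi> z \<longrightarrow> Re (f y) < Re (f z)))"

text \<open>\<open>Y\<close> is the surface \<open>X\<close> cut along the arcs \<open>e p\<close>, for \<open>p\<close> in \<open>P\<close>, and \<open>q\<close> is the map gluing
  the cuts back: it identifies precisely the points exchanged by the foldings of the boundary
  segments. Going through \<open>seg p\<close>, the map \<open>q\<close> runs along \<open>e p\<close> from the other endpoint to \<open>p\<close>,
  reached at parameter 1/2, and back. Segments of punctures joined to the
  same marked point automatically share endpoints.\<close>

definition cut_surface ::
  "'a topology \<Rightarrow> ('a set \<times> ('a \<Rightarrow> complex)) set \<Rightarrow> 'a set \<Rightarrow> ('a \<Rightarrow> real \<Rightarrow> 'a) \<Rightarrow>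
   'b topology \<Rightarrow> ('b set \<times> ('b \<Rightarrow> complex)) set \<Rightarrow> ('b \<Rightarrow> 'a) \<Rightarrow>
   ('a \<Rightarrow> 'b set) \<Rightarrow> ('a \<Rightarrow> 'b \<Rightarrow> real) \<Rightarrow> bool" where
  "cut_surface X A P e Y B q seg \<phi> \<longleftrightarrow>
     oriented_surface Y B \<and> compact_space Y \<and>
     quotient_map Y X q \<and>
     (\<forall>(U, f)\<in>B. \<forall>(V, g)\<in>A.
        orientation_preserving_on (f ` {x \<in> U. q x \<in> V}) (g \<circ> q \<circ> inv_into U f)) \<and>
     (\<forall>p\<in>P. seg p \<subseteq> surface_boundary Y \<and>
        homeomorphic_map (subtopology Y (seg p)) (top_of_set {0..1}) (\<phi> p) \<and>
        respects_boundary_orientation Y B (seg p) (\<phi> p) \<and>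
        q ` seg p = e p ` {0..1} \<and>
        (\<forall>x\<in>seg p. \<phi> p x = 1/2 \<longrightarrow> q x = p)) \<and>
     (\<forall>x\<in>topspace Y. \<forall>y\<in>topspace Y.
        q x = q y \<longleftrightarrow> equivclp (\<lambda>u v. (u, v) \<in> fold_relation P seg \<phi>) x y)"

text \<open>Disjoint union of two copies of \<open>Y\<close>, tagged by \<open>True\<close> (the plus copy) and \<open>False\<close>
  (the minus copy).\<close>

definition two_copies :: "'b topology \<Rightarrow> (bool \<times> 'b) topology" where
  "two_copies Y = sum_topology (\<lambda>_. Y) UNIV"

definition swap_copies :: "bool \<times> 'b \<Rightarrow> bool \<times> 'b" where
  "swap_copies x = (\<not> fst x, snd x)"

definition gluing_map ::
  "('a \<Rightarrow> 'b set) \<Rightarrow> ('a \<Rightarrow> 'b \<Rightarrow> real) \<Rightarrow> 'a \<Rightarrow> bool \<times> 'b \<Rightarrow> bool \<times> 'b" where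
  "gluing_map seg \<phi> p x = swap_copies (fst x, flip seg \<phi> p (snd x))"

definition gluing_relation ::
  "'a set \<Rightarrow> ('a \<Rightarrow> 'b set) \<Rightarrow> ('a \<Rightarrow> 'b \<Rightarrow> real) \<Rightarrow> ((bool \<times> 'b) \<times> (bool \<times> 'b)) set" where
  "gluing_relation P seg \<phi> = {(x, gluing_map seg \<phi> p x) |p x. p \<in> P \<and> x \<in> {True} \<times> seg p}"

definition double_surface ::
  "'a set \<Rightarrow> 'b topology \<Rightarrow> ('a \<Rightarrow> 'b set) \<Rightarrow> ('a \<Rightarrow> 'b \<Rightarrow> real) \<Rightarrow> (bool \<times> 'b) set topology" where
  "double_surface P Y seg \<phi> = quotient_space (two_copies Y) (gluing_relation P seg \<phi>)"

text \<open>The map induced by \<open>swap_copies\<close> on identification classes.\<close>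

definition sheet_exchange :: "(bool \<times> 'b) set \<Rightarrow> (bool \<times> 'b) set" where
  "sheet_exchange c = swap_copies ` c"


section \<open>Two-dimensional orbifolds in the sense of Thurston\<close>

text \<open>Orbifolds are allowed to have a boundary, so charts are modelled on open subsets of the closed
  half-plane (which include, up to homeomorphism, all open subsets of the plane). The group of
  a chart is a finite group of homeomorphisms of its domain. The homeomorphism from
  the quotient of the domain by the group to an open subset of the underlying space is recorded by
  its composition with the projection.\<close>

record 'a orbifold_chart =
  chart_dom :: "complex set"
  chart_group :: "(complex \<Rightarrow> complex) set"
  chart_map :: "complex \<Rightarrow> 'a"

definition chart_image :: "'a orbifold_chart \<Rightarrow> 'a set" where
  "chart_image c = chart_map c ` chart_dom c"

definition orbifold_chart_on :: "'a topology \<Rightarrow> 'a orbifold_chart \<Rightarrow> bool" where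
  "orbifold_chart_on Z c \<longleftrightarrow>
     openin (top_of_set upper_halfplane) (chart_dom c) \<and>
     finite (chart_group c) \<and> subgroup (chart_group c) (BijGroup (chart_dom c)) \<and>
     (\<forall>\<gamma>\<in>chart_group c. continuous_on (chart_dom c) \<gamma>) \<and>
     openin Z (chart_image c) \<and>
     (\<forall>\<gamma>\<in>chart_group c. \<forall>z\<in>chart_dom c. chart_map c (\<gamma> z) = chart_map c z) \<and>
     homeomorphic_map
       (quotient_space (top_of_set (chart_dom c))
          (orbit_relation (top_of_set (chart_dom c)) (chart_group c)))
       (subtopology Z (chart_image c))
       (\<lambda>C. the_elem (chart_map c ` C))"

definition orbifold_chart_inclusion :: "'a orbifold_chart \<Rightarrow> 'a orbifold_chart \<Rightarrow> bool" where
  "orbifold_chart_inclusion c d \<longleftrightarrow>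
     (\<exists>F j. F \<in> hom (BijGroup (chart_dom c)\<lparr>carrier := chart_group c\<rparr>)
                    (BijGroup (chart_dom d)\<lparr>carrier := chart_group d\<rparr>) \<and>
        inj_on F (chart_group c) \<and>
        embedding_map (top_of_set (chart_dom c)) (top_of_set (chart_dom d)) j \<and>
        (\<forall>\<gamma>\<in>chart_group c. \<forall>z\<in>chart_dom c. j (\<gamma> z) = F \<gamma> (j z)) \<and>
        (\<forall>z\<in>chart_dom c. chart_map d (j z) = chart_map c z))"

definition orbifold_structure :: "'a topology \<Rightarrow> 'a orbifold_chart set \<Rightarrow> bool" where
  "orbifold_structure Z \<C> \<longleftrightarrow>
     Hausdorff_space Z \<and>
     (\<forall>c\<in>\<C>. orbifold_chart_on Z c) \<and>
     (\<Union>c\<in>\<C>. chart_image c) = topspace Z \<and>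
     (\<forall>c\<in>\<C>. \<forall>d\<in>\<C>. \<exists>b\<in>\<C>. chart_image b = chart_image c \<inter> chart_image d) \<and>
     (\<forall>c\<in>\<C>. \<forall>d\<in>\<C>. chart_image c \<subseteq> chart_image d \<longrightarrow> orbifold_chart_inclusion c d)"

text \<open>A cone point of order \<open>n\<close>: the local model is the open unit disc modulo the group of rotations
  of order \<open>n\<close>, the point being the image of the centre. (Reflections also have order 2, but give
  mirror points, not orbifold points of order 2.)\<close>

definition orbifold_point_of_order :: "'a orbifold_chart set \<Rightarrow> nat \<Rightarrow> 'a \<Rightarrow> bool" where
  "orbifold_point_of_order \<C> n x \<longleftrightarrow>
     (\<exists>c\<in>\<C>. \<exists>k.
        homeomorphic_map (top_of_set (chart_dom c)) (top_of_set (ball (0::complex) 1)) k \<and>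
        chart_group c =
          (\<lambda>j. restrict (\<lambda>z. inv_into (chart_dom c) k (cis (2 * pi * real j / real n) * k z))
                 (chart_dom c)) ` {..<n} \<and>
        chart_map c (inv_into (chart_dom c) k 0) = x)"

text \<open>Charts for the quotient of a surface \<open>X\<close> by a finite group \<open>G\<close> of homeomorphisms, where \<open>\<pi>\<close>
  maps \<open>X\<close> onto a model of the quotient: an open set \<open>V\<close>, disjoint from its translates by
  the elements not preserving it, is identified by \<open>\<psi>\<close> with an open subset of the half-plane, on
  which the stabilizer of \<open>V\<close> then acts.\<close>

definition quotient_orbifold_chart ::
  "'c topology \<Rightarrow> ('c \<Rightarrow> 'c) set \<Rightarrow> ('c \<Rightarrow> 'a) \<Rightarrow> 'a orbifold_chart \<Rightarrow> bool" where
  "quotient_orbifold_chart X G \<pi> c \<longleftrightarrow>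
     (\<exists>V \<psi>. openin X V \<and> (\<forall>g\<in>G. g ` V = V \<or> g ` V \<inter> V = {}) \<and>
        homeomorphic_map (top_of_set (chart_dom c)) (subtopology X V) \<psi> \<and>
        chart_group c =
          (\<lambda>g. restrict (\<lambda>z. inv_into (chart_dom c) \<psi> (g (\<psi> z))) (chart_dom c)) ` {g\<in>G. g ` V = V} \<and>
        (\<forall>z\<in>chart_dom c. chart_map c z = \<pi> (\<psi> z)))"

definition orbit_space :: "'c topology \<Rightarrow> ('c \<Rightarrow> 'c) set \<Rightarrow> 'c set topology" where
  "orbit_space X G = quotient_space X (orbit_relation X G)"

text \<open>\<open>\<C>\<close> is an orbifold structure on \<open>Z\<close> obtained by transporting, along the homeomorphism \<open>h\<close>, the
  structure of the quotient of \<open>X\<close> by \<open>G\<close>.\<close>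

definition induced_orbifold_structure ::
  "'c topology \<Rightarrow> ('c \<Rightarrow> 'c) set \<Rightarrow> ('c set \<Rightarrow> 'a) \<Rightarrow> 'a topology \<Rightarrow> 'a orbifold_chart set \<Rightarrow> bool" where
  "induced_orbifold_structure X G h Z \<C> \<longleftrightarrow>
     homeomorphic_map (orbit_space X G) Z h \<and>
     orbifold_structure Z \<C> \<and>
     (\<forall>c\<in>\<C>. quotient_orbifold_chart X G (\<lambda>x. h (identification_class X (orbit_relation X G) x)) c)"

end

theory Submission
  imports Defs
begin

text \<open>Points of the double lie over points of \<open>X\<close>, and the fibres of this projection are the orbits of
  the sheet exchange, which gives the homeomorphism. A function on the preimage of \<open>K\<close> in the cut
  surface that changes sign under the foldings is the same as a function on the part of the double
  over \<open>K\<close> that changes sign under the sheet exchange. If \<open>K\<close> carries such a function with square 1,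
  then the double is a trivial covering over \<open>K\<close>, so that charts of \<open>X\<close> serve as orbifold charts with
  trivial group; this happens locally away from the punctures. At a marked point the trivialisation
  over a punctured half-square exists since that set is simply connected, and it extends over the
  point because the fibre is countable and hence does not separate the cut surface locally. (A
  fixed point of the sheet exchange over a marked point is thereby excluded.) At a puncture with
  chart \<open>f\<close>, a square root \<open>k\<close> of \<open>f \<circ> q\<close> exists on a half-disc of the cut surface; it must change sign
  under the folding, since otherwise the identity on a disc would have a continuous square root. So
  \<open>k\<close> is a chart of the double in which the sheet exchange is the rotation by \<open>\<pi>\<close>.\<close>

section \<open>Identification spaces and the folded surface\<close>

text \<open>The cut surface is given only through \<open>q\<close>, \<open>seg\<close> and
  \<open>\<phi>\<close>, and its charts are adapted to none of them: a chart of \<open>Y\<close> at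
  a boundary point need not straighten the segment or the folding, so two half-discs cannot be glued
  by a formula to give a chart of the double. Every chart of the double is therefore pulled up from
  a chart of \<open>X\<close>, and the problem becomes a topological one about a double covering.
  Sheets are encoded by complex-valued functions so that trivialisations and square roots of a
  coordinate are instances of one notion, \<open>alternating\<close>, and can be multiplied with
  each other. What could go wrong at a marked point is that several segments are chained there: a
  sequence of flips might return to its starting point after an odd number of sheet changes. This is
  not checked on the sequence itself but excluded from outside, by what happens over the complement
  of the point.\<close>

lemma continuous_map_mult:
  fixes f g :: "'x \<Rightarrow> 'y :: real_normed_algebra"
  assumes "continuous_map T euclidean f" "continuous_map T euclidean g"
  shows "continuous_map T euclidean (\<lambda>x. f x * g x)"
  using assms by (auto simp: continuous_map_atin limitin_canonical_iff intro: tendsto_mult)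

lemma identification_class_eq_iff:
  assumes "x \<in> topspace T" "y \<in> topspace T"
  shows "identification_class T r x = identification_class T r y \<longleftrightarrow>
    equivclp (\<lambda>u v. (u, v) \<in> r) x y"
proof
  assume eq: "identification_class T r x = identification_class T r y"
  have "y \<in> identification_class T r y"
    using assms by (simp add: identification_class_def)
  then have "y \<in> identification_class T r x"
    unfolding eq .
  then show "equivclp (\<lambda>u v. (u, v) \<in> r) x y"
    unfolding identification_class_def by blast
next
  assume xy: "equivclp (\<lambda>u v. (u, v) \<in> r) x y"
  have "equivclp (\<lambda>u v. (u, v) \<in> r) x z \<longleftrightarrow> equivclp (\<lambda>u v. (u, v) \<in> r) y z" for z
    using equivclp_trans[OF xy, of z] equivclp_trans[OF equivclp_sym[OF xy], of z] by (rule iffI[rotated])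
  then show "identification_class T r x = identification_class T r y"
    unfolding identification_class_def by simp
qed

lemma equivclp_invariant:
  assumes "equivclp (\<lambda>u v. (u, v) \<in> r) x y" and "\<And>u v. (u, v) \<in> r \<Longrightarrow> g u = g v"
  shows "g x = g y"
  using assms by (induction rule: equivclp_induct) auto

text \<open>Maps out of quotients are written as the common value of \<open>g\<close> on a class,
  read off with \<open>the_elem\<close> as in \<open>orbifold_chart_on\<close>; invariance under the
  generating relation makes the image of the class a singleton.\<close>

lemma the_elem_identification_class:
  assumes "\<And>u v. (u, v) \<in> r \<Longrightarrow> g u = g v" and "x \<in> topspace T"
  shows "the_elem (g ` identification_class T r x) = g x"
proof -
  have "x \<in> identification_class T r x"
    using assms by (simp add: identification_class_def)
  moreover have "g y = g x" if "y \<in> identification_class T r x" for y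
  proof -
    have "equivclp (\<lambda>u v. (u, v) \<in> r) x y"
      using that unfolding identification_class_def by blast
    from equivclp_invariant[OF this assms(1)] show ?thesis by (rule sym)
  qed
  ultimately have "g ` identification_class T r x = {g x}"
    by blast
  then show ?thesis by simp
qed

lemma topspace_quotient_space:
  "topspace (quotient_space T r) = identification_class T r ` topspace T"
  using quotient_map_identification_class[of T r] quotient_imp_surjective_map by metis

lemma quotient_map_quotient_space:
  assumes "quotient_map T Z g" and "\<And>u v. (u, v) \<in> r \<Longrightarrow> g u = g v"
  shows "quotient_map (quotient_space T r) Z (\<lambda>C. the_elem (g ` C))"
proof -
  have "quotient_map T Z ((\<lambda>C. the_elem (g ` C)) \<circ> identification_class T r)"
    using assms(1)
    by (rule quotient_map_eq) (simp add: the_elem_identification_class[OF assms(2)])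
  then show ?thesis
    using quotient_map_compose_eq[OF quotient_map_identification_class] by blast
qed

text \<open>Serves both for the orbit space of the double and for the quotient of a chart domain by
  its group. Classes lie in fibres by \<open>r\<close>, which makes the map well defined; fibres lie
  in classes by \<open>fib\<close>, which makes it injective.\<close>

lemma homeomorphic_map_quotient_space:
  assumes "quotient_map T Z g" and r: "\<And>u v. (u, v) \<in> r \<Longrightarrow> g u = g v"
    and fib: "\<And>x y. x \<in> topspace T \<Longrightarrow> y \<in> topspace T \<Longrightarrow> g x = g y \<Longrightarrow> equivclp (\<lambda>u v. (u, v) \<in> r) x y"
  shows "homeomorphic_map (quotient_space T r) Z (\<lambda>C. the_elem (g ` C))"
proof -
  have "inj_on (\<lambda>C. the_elem (g ` C)) (topspace (quotient_space T r))"
  proof (rule inj_onI)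
    fix C D assume CD: "C \<in> topspace (quotient_space T r)" "D \<in> topspace (quotient_space T r)"
      and eq: "the_elem (g ` C) = the_elem (g ` D)"
    then obtain x y where x: "x \<in> topspace T" "C = identification_class T r x"
      and y: "y \<in> topspace T" "D = identification_class T r y"
      unfolding topspace_quotient_space by blast
    have "the_elem (g ` C) = g x" "the_elem (g ` D) = g y"
      using x y the_elem_identification_class[of r g] r by simp_all
    then have "equivclp (\<lambda>u v. (u, v) \<in> r) x y"
      using eq x y fib by simp
    then show "C = D" using x y identification_class_eq_iff[of x T y r] by simp
  qed
  then show ?thesis
    using quotient_map_quotient_space[OF assms(1) r] by (simp add: homeomorphic_map_def)
qed

text \<open>A connected subset of {1, -1} has at most one point. Signs are complex numbers of square
  1 so that quotients of square roots are covered too.\<close>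

lemma connected_sign_constant:
  assumes "connectedin T K" "continuous_map (subtopology T K) euclidean (u :: _ \<Rightarrow> complex)"
    "\<And>x. x \<in> K \<Longrightarrow> (u x)\<^sup>2 = 1"
  obtains (that0) c where "c\<^sup>2 = 1" "\<And>x. x \<in> K \<Longrightarrow> u x = c"
proof (cases "K = {}")
  case True
  then show ?thesis using that0[of 1] by auto
next
  case False
  then obtain x0 where x0: "x0 \<in> K" by auto
  have "connectedin (subtopology T K) K"
    using assms(1) by (simp add: connectedin_subtopology)
  then have "connectedin euclidean (u ` K)"
    using connectedin_continuous_map_image[OF assms(2)] by simp
  then have con: "connected (u ` K)" by simp
  have "u ` K \<subseteq> {1, -1}" using assms(3) by (auto simp: power2_eq_1_iff)
  then have "finite (u ` K)" by (meson finite.emptyI finite_insert finite_subset)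
  then obtain a where a: "u ` K = {a}"
    using con connected_finite_iff_sing[of "u ` K"] x0 by auto
  then have "u x = a" if "x \<in> K" for x
    using that by blast
  then show ?thesis using that0[of a] assms(3)[OF x0] x0 by simp
qed

text \<open>The topological part of the cut surface, on which the double and its projection are
  built; charts and marked points are added in \<open>folded_marked_surface\<close>.\<close>

locale folded_surface =
  fixes X :: "'a topology" and P :: "'a set" and Y :: "'b topology"
    and q :: "'b \<Rightarrow> 'a" and seg :: "'a \<Rightarrow> 'b set" and \<phi> :: "'a \<Rightarrow> 'b \<Rightarrow> real"
  assumes Hausdorff_X: "Hausdorff_space X"
    and compact_Y: "compact_space Y"
    and quotient_q: "quotient_map Y X q"
    and finite_P: "finite P"
    and seg_subset: "p \<in> P \<Longrightarrow> seg p \<subseteq> topspace Y"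
    and homeo_\<phi>: "p \<in> P \<Longrightarrow> homeomorphic_map (subtopology Y (seg p)) (top_of_set {0..1}) (\<phi> p)"
    and q_eq_iff: "x \<in> topspace Y \<Longrightarrow> y \<in> topspace Y \<Longrightarrow>
      q x = q y \<longleftrightarrow> equivclp (\<lambda>u v. (u, v) \<in> fold_relation P seg \<phi>) x y"
begin

section \<open>Foldings and the fibres of \<open>q\<close>\<close>

abbreviation pre :: "'a set \<Rightarrow> 'b set" where
  "pre K \<equiv> {y \<in> topspace Y. q y \<in> K}"

abbreviation fl :: "'a \<Rightarrow> 'b \<Rightarrow> 'b" where
  "fl \<equiv> flip seg \<phi>"

lemma q_in: "y \<in> topspace Y \<Longrightarrow> q y \<in> topspace X"
  using quotient_imp_surjective_map[OF quotient_q] by blast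

lemma q_surj: "x \<in> topspace X \<Longrightarrow> \<exists>y\<in>topspace Y. q y = x"
  unfolding quotient_imp_surjective_map[OF quotient_q, symmetric] by blast

lemma continuous_q: "continuous_map Y X q"
  using quotient_q quotient_imp_continuous_map by blast

lemma closed_q: "closed_map Y X q"
  using continuous_imp_closed_map_gen[OF compact_Y _ continuous_q] Hausdorff_X
    Hausdorff_imp_kc_space by blast

lemma bij_\<phi>: "p \<in> P \<Longrightarrow> bij_betw (\<phi> p) (seg p) {0..1}"
  using homeo_\<phi>[of p] seg_subset[of p]
  by (auto simp: homeomorphic_eq_everything_map bij_betw_def Int_absorb1)

lemma \<phi>_range: "p \<in> P \<Longrightarrow> y \<in> seg p \<Longrightarrow> 0 \<le> \<phi> p y \<and> \<phi> p y \<le> 1"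
  using bij_\<phi>[of p] by (auto simp: bij_betw_def)

lemma flip_in: "p \<in> P \<Longrightarrow> y \<in> seg p \<Longrightarrow> fl p y \<in> seg p"
  and \<phi>_flip: "p \<in> P \<Longrightarrow> y \<in> seg p \<Longrightarrow> \<phi> p (fl p y) = 1 - \<phi> p y"
proof -
  assume p: "p \<in> P" and y: "y \<in> seg p"
  have "1 - \<phi> p y \<in> \<phi> p ` seg p"
    using bij_\<phi>[OF p] \<phi>_range[OF p y] by (auto simp: bij_betw_def)
  then show "fl p y \<in> seg p" "\<phi> p (fl p y) = 1 - \<phi> p y"
    unfolding flip_def by (auto simp: inv_into_into f_inv_into_f)
qed

lemma flip_flip: "p \<in> P \<Longrightarrow> y \<in> seg p \<Longrightarrow> fl p (fl p y) = y"
  using bij_\<phi>[of p] flip_in \<phi>_flip unfolding bij_betw_def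
  by (auto intro!: inj_onD[of "\<phi> p" "seg p"])

lemma q_flip: "p \<in> P \<Longrightarrow> y \<in> seg p \<Longrightarrow> q (fl p y) = q y"
  using seg_subset flip_in
  by (subst q_eq_iff) (auto simp: fold_relation_def intro!: converse_r_into_equivclp)

lemma fold_relation_iff:
  "(u, v) \<in> fold_relation P seg \<phi> \<longleftrightarrow> (\<exists>p\<in>P. u \<in> seg p \<and> v = fl p u)"
  unfolding fold_relation_def by blast

text \<open>A fibre is exhausted by chains of flips. Because flips are involutions, a backward step
  of the relation is again a flip, so forward steps suffice.\<close>

lemma fibre_induct [consumes 3, case_names base flip]:
  assumes "x \<in> topspace Y" "y \<in> topspace Y" "q x = q y"
    and "R x"
    and "\<And>p z. p \<in> P \<Longrightarrow> z \<in> seg p \<Longrightarrow> q z = q x \<Longrightarrow> R z \<Longrightarrow> R (fl p z)"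
  shows "R y"
proof -
  have "equivclp (\<lambda>u v. (u, v) \<in> fold_relation P seg \<phi>) x y"
    using assms q_eq_iff by simp
  then have "R y \<and> q y = q x"
  proof (induction rule: equivclp_induct)
    case (step y z)
    then obtain p where p: "p \<in> P" "y \<in> seg p" "z = fl p y"
      unfolding fold_relation_iff using flip_flip flip_in by metis
    then show ?case using step assms(5) q_flip by auto
  qed (simp add: assms)
  then show ?thesis ..
qed

lemma continuous_\<phi>_inv:
  "p \<in> P \<Longrightarrow> continuous_map (top_of_set {0..1}) Y (inv_into (seg p) (\<phi> p))"
proof -
  assume p: "p \<in> P"
  obtain g where g: "homeomorphic_maps (subtopology Y (seg p)) (top_of_set {0..1}) (\<phi> p) g"
    using homeo_\<phi>[OF p] by (auto simp: homeomorphic_map_maps)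
  have "g t = inv_into (seg p) (\<phi> p) t" if "t \<in> {0..1}" for t
  proof -
    have "g t \<in> seg p" "\<phi> p (g t) = t"
      using g that seg_subset[OF p] unfolding homeomorphic_maps_def continuous_map_def by auto
    then show ?thesis
      using bij_\<phi>[OF p] inv_into_f_f unfolding bij_betw_def by metis
  qed
  then show "continuous_map (top_of_set {0..1}) Y (inv_into (seg p) (\<phi> p))"
    using g unfolding homeomorphic_maps_def continuous_map_in_subtopology
    by (elim conjE continuous_map_eq) auto
qed

lemma inv_\<phi>: "p \<in> P \<Longrightarrow> 0 \<le> t \<Longrightarrow> t \<le> 1 \<Longrightarrow> inv_into (seg p) (\<phi> p) t \<in> seg p"
  "p \<in> P \<Longrightarrow> 0 \<le> t \<Longrightarrow> t \<le> 1 \<Longrightarrow> \<phi> p (inv_into (seg p) (\<phi> p) t) = t"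
  "p \<in> P \<Longrightarrow> y \<in> seg p \<Longrightarrow> inv_into (seg p) (\<phi> p) (\<phi> p y) = y"
  using bij_\<phi>[of p]
  by (auto simp: bij_betw_def f_inv_into_f intro!: inv_into_into)

text \<open>Restricting a quotient map to the preimage of a set that is neither open nor closed can
  destroy the quotient property. Here \<open>q\<close> is closed, being continuous from a compact
  space to a Hausdorff space, and closedness survives the restriction to \<open>pre K\<close> for
  every \<open>K\<close>.\<close>

lemma quotient_map_pre:
  "quotient_map (subtopology Y (pre K)) (subtopology X K) q"
proof -
  have "closed_map (subtopology Y (pre K)) (subtopology X K) q"
    using closed_map_restriction[OF closed_q refl] .
  moreover have "continuous_map (subtopology Y (pre K)) (subtopology X K) q"
    using continuous_q by (auto simp: continuous_map_in_subtopology continuous_map_from_subtopology)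
  moreover have "q ` topspace (subtopology Y (pre K)) = topspace (subtopology X K)"
    using q_surj q_in by (fastforce simp: image_iff)
  ultimately show ?thesis
    by (simp add: continuous_closed_imp_quotient_map)
qed

text \<open>\<open>fibre_induct\<close> spreads invariance under single flips to whole
  fibres.\<close>

lemma descend:
  assumes g: "continuous_map (subtopology Y (pre K)) Z g"
    and inv: "\<And>p y. p \<in> P \<Longrightarrow> y \<in> seg p \<Longrightarrow> q y \<in> K \<Longrightarrow> g (fl p y) = g y"
  obtains g' where "continuous_map (subtopology X K) Z g'"
    "\<And>y. y \<in> topspace Y \<Longrightarrow> q y \<in> K \<Longrightarrow> g' (q y) = g y"
proof -
  have "g x = g y" if "x \<in> topspace Y" "y \<in> topspace Y" "q x = q y" "q x \<in> K" for x y
    using that(1-3)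
  proof (induction rule: fibre_induct)
    case (flip p z)
    then show ?case using inv[of p z] that by simp
  qed simp
  then show thesis
    using quotient_map_lift_exists[OF quotient_map_pre g] that
    by (smt (verit) IntE IntI mem_Collect_eq topspace_subtopology)
qed

text \<open>The tube lemma for the closed map \<open>q\<close>: a neighbourhood of a fibre is
  replaced by a preimage, which is stable under flips.\<close>

lemma fibre_neighbourhood:
  assumes "openin Y V" "x \<in> topspace X" "pre {x} \<subseteq> V"
  obtains W where "openin X W" "x \<in> W" "pre W \<subseteq> V"
proof -
  have "{y \<in> topspace Y. q y = x} \<subseteq> V" using assms by auto
  then show thesis
    using closed_q assms that unfolding closed_map_fibre_neighbourhood by blast
qed

text \<open>These are the traces on the plus copy of the functions on the double that change sign under the
  sheet exchange.\<close>

definition alternating :: "'a set \<Rightarrow> ('b \<Rightarrow> complex) \<Rightarrow> bool" where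
  "alternating K g \<longleftrightarrow> continuous_map (subtopology Y (pre K)) euclidean g \<and>
     (\<forall>p\<in>P. \<forall>y\<in>seg p. q y \<in> K \<longrightarrow> g (fl p y) = - g y)"

text \<open>Triviality of the double covering over \<open>K\<close>. The set is arbitrary, so that
  closed rectangles, punctured sets and open neighbourhoods can all be treated.\<close>

definition splits :: "'a set \<Rightarrow> bool" where
  "splits K \<longleftrightarrow> (\<exists>g. alternating K g \<and> (\<forall>y\<in>pre K. (g y)\<^sup>2 = 1))"

lemma alternating_mono: "alternating K g \<Longrightarrow> K' \<subseteq> K \<Longrightarrow> alternating K' g"
  unfolding alternating_def
  by (blast intro: continuous_map_from_subtopology_mono)

lemma splits_mono: "splits K \<Longrightarrow> K' \<subseteq> K \<Longrightarrow> splits K'"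
  unfolding splits_def using alternating_mono by (metis (mono_tags, lifting) mem_Collect_eq subsetD)

text \<open>Two sign changes cancel. The product of two trivialisations compares them; the product
  of a trivialisation with a square root is a single-valued root on \<open>K\<close>.\<close>

lemma alternating_mult_descend:
  assumes "alternating K g" "alternating K h"
  obtains u where "continuous_map (subtopology X K) euclidean u"
    "\<And>y. y \<in> topspace Y \<Longrightarrow> q y \<in> K \<Longrightarrow> u (q y) = g y * h y"
proof (rule descend[of K euclidean "\<lambda>y. g y * h y"])
  show "continuous_map (subtopology Y (pre K)) euclidean (\<lambda>y. g y * h y)"
    using assms unfolding alternating_def by (auto intro: continuous_map_mult)
qed (use assms that in \<open>auto simp: alternating_def\<close>)

text \<open>The quotient of two trivialisations is a sign, constant on the connected set
  \<open>K\<close>; as their values have square 1, it equals their product.\<close>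

lemma splits_sign:
  assumes g: "alternating K g" "\<forall>y\<in>pre K. (g y)\<^sup>2 = 1" and h: "alternating K h" "\<forall>y\<in>pre K. (h y)\<^sup>2 = 1"
    and K: "connectedin X K"
  obtains c where "c\<^sup>2 = 1" "\<And>y. y \<in> pre K \<Longrightarrow> h y = c * g y"
proof -
  obtain u where u: "continuous_map (subtopology X K) euclidean u"
      "\<And>y. y \<in> topspace Y \<Longrightarrow> q y \<in> K \<Longrightarrow> u (q y) = g y * h y"
    using alternating_mult_descend[OF g(1) h(1)] by blast
  have "(u x)\<^sup>2 = 1" if "x \<in> K" for x
  proof -
    obtain y where "y \<in> topspace Y" "q y = x"
        using q_surj[of x] subsetD[OF connectedin_subset_topspace[OF K] \<open>x \<in> K\<close>] by blast
    then show ?thesis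
      using u(2)[of y] g(2) h(2) \<open>x \<in> K\<close> by (auto simp: power_mult_distrib)
  qed
  then obtain c where c: "c\<^sup>2 = 1" "\<And>x. x \<in> K \<Longrightarrow> u x = c"
    using connected_sign_constant[OF K u(1)] by blast
  have "h y = c * g y" if "y \<in> pre K" for y
  proof -
    have "g y * h y = c" "g y * g y = 1"
      using that u(2) c(2) g(2) by (auto simp: power2_eq_square)
    then show ?thesis by (metis mult.assoc mult.commute mult_1)
  qed
  with c that show thesis by blast
qed

text \<open>Over the connected intersection the two trivialisations differ by one sign
  \<open>e\<close>, and multiplying the second by \<open>e\<close> makes them fit; closedness is for
  pasting. Over a disconnected intersection, as for two half-annuli around a puncture, two different
  signs could occur.\<close>

lemma splits_Un:
  assumes K1: "splits K1" and K2: "splits K2" and c: "connectedin X (K1 \<inter> K2)"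
    and cl: "closedin (subtopology X (K1 \<union> K2)) K1" "closedin (subtopology X (K1 \<union> K2)) K2"
  shows "splits (K1 \<union> K2)"
proof -
  obtain g where g: "alternating K1 g" "\<forall>y\<in>pre K1. (g y)\<^sup>2 = 1"
    using K1 unfolding splits_def by blast
  obtain h where h: "alternating K2 h" "\<forall>y\<in>pre K2. (h y)\<^sup>2 = 1"
    using K2 unfolding splits_def by blast
  have "alternating (K1 \<inter> K2) g" "alternating (K1 \<inter> K2) h"
    using g h alternating_mono by (meson Int_lower1 Int_lower2)+
  then obtain e where e: "e\<^sup>2 = 1" "\<And>y. y \<in> pre (K1 \<inter> K2) \<Longrightarrow> g y = e * h y"
    using splits_sign[of "K1 \<inter> K2" h g] g h c by auto
  define s where "s y = (if q y \<in> K1 then g y else e * h y)" for y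
  have s2: "s y = e * h y" if "y \<in> topspace Y" "q y \<in> K2" for y
    using e that unfolding s_def by auto
  have "continuous_map (subtopology Y (pre (K1 \<union> K2))) euclidean s"
  proof (rule pasting_lemma_closed[where I = "UNIV :: bool set" and T = "\<lambda>b. pre (if b then K1 else K2)" 
        and f = "\<lambda>b. if b then g else (\<lambda>y. e * h y)"])
    fix b :: bool
    have qc: "continuous_map (subtopology Y (pre (K1 \<union> K2))) (subtopology X (K1 \<union> K2)) q"
      using quotient_imp_continuous_map quotient_map_pre by blast
    have "closedin (subtopology X (K1 \<union> K2)) (if b then K1 else K2)" using cl by auto
    then have "closedin (subtopology Y (pre (K1 \<union> K2)))
       {y \<in> topspace (subtopology Y (pre (K1 \<union> K2))). q y \<in> (if b then K1 else K2)}"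
      using qc closedin_continuous_map_preimage by blast
    also have "{y \<in> topspace (subtopology Y (pre (K1 \<union> K2))). q y \<in> (if b then K1 else K2)}
       = pre (if b then K1 else K2)" by auto
    finally show "closedin (subtopology Y (pre (K1 \<union> K2))) (pre (if b then K1 else K2))" .
    have "pre (K1 \<union> K2) \<inter> pre (if b then K1 else K2) = pre (if b then K1 else K2)"
      by auto
    then show "continuous_map (subtopology (subtopology Y (pre (K1 \<union> K2))) (pre (if b then K1 else K2)))
        euclidean (if b then g else (\<lambda>y. e * h y))"
      using g(1) h(1) by (auto simp: subtopology_subtopology alternating_def intro: continuous_map_mult)
  qed (use s2 in \<open>auto simp: s_def e\<close>)
  moreover have "s (fl p y) = - s y" if "p \<in> P" "y \<in> seg p" "q y \<in> K1 \<union> K2" for p y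
    using that g(1) h(1) q_flip[OF that(1,2)] unfolding s_def alternating_def by auto
  moreover have "(s y)\<^sup>2 = 1" if "y \<in> pre (K1 \<union> K2)" for y
    using that g(2) h(2) e(1) unfolding s_def by (auto simp: power_mult_distrib)
  ultimately show ?thesis
    unfolding splits_def alternating_def by blast
qed

end

section \<open>Splitting over rectangles and punctured half-squares\<close>

text \<open>Two nested bisections. The outer one, over real parts, asks that all sufficiently thin
  strips of full height around \<open>x\<close> be good; the inner one, over imaginary parts, proves
  this with the thinness bound \<open>d\<close> built into the bisected property, so that merging
  two heights takes the smaller bound. Adjacent boxes meet in a convex set, as \<open>merge\<close>
  demands.\<close>

lemma rectangle_bisection:
  fixes S :: "complex set \<Rightarrow> bool"
  assumes mono: "\<And>K L. S K \<Longrightarrow> L \<subseteq> K \<Longrightarrow> S L"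
    and merge: "\<And>K L. S K \<Longrightarrow> S L \<Longrightarrow> closed K \<Longrightarrow> closed L \<Longrightarrow> connected (K \<inter> L) \<Longrightarrow>
      K \<union> L \<subseteq> cbox a b \<Longrightarrow> S (K \<union> L)"
    and local: "\<And>z. z \<in> cbox a b \<Longrightarrow> \<exists>e>0. S (ball z e \<inter> cbox a b)"
    and ab: "Re a \<le> Re b" "Im a \<le> Im b"
  shows "S (cbox a b)"
proof -
  \<comment> \<open>\<open>Bolzano\<close> also tests intervals that leave the box, hence the
    intersection with \<open>cbox a b\<close>.\<close>
  define R where "R s t u v = cbox (Complex s u) (Complex t v) \<inter> cbox a b" for s t u v
  have R_iff: "z \<in> R s t u v \<longleftrightarrow> s \<le> Re z \<and> Re z \<le> t \<and> u \<le> Im z \<and> Im z \<le> v \<and> z \<in> cbox a b" for z s t u v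
    by (auto simp: R_def in_cbox_complex_iff)
  have closed: "closed (R s t u v)" and convex: "convex (R s t u v)" for s t u v
    unfolding R_def by (auto intro: closed_Int convex_Int)
  have "S (R (Re a) (Re b) (Im a) (Im b))"
  proof (rule Bolzano[of "Re a" "Re b" "\<lambda>s t. S (R s t (Im a) (Im b))"])
    fix s t w assume S: "S (R s t (Im a) (Im b))" "S (R t w (Im a) (Im b))" and le: "s \<le> t" "t \<le> w"
    have eq: "R s w (Im a) (Im b) = R s t (Im a) (Im b) \<union> R t w (Im a) (Im b)"
      using le by (auto simp: R_iff)
    show "S (R s w (Im a) (Im b))"
      unfolding eq using S closed convex
      by (intro merge convex_connected convex_Int) (auto simp: R_def)
  next
    fix x assume x: "Re a \<le> x" "x \<le> Re b"
    have "\<exists>d>0. \<forall>s t. s \<le> x \<and> x \<le> t \<and> t - s < d \<longrightarrow> S (R s t (Im a) (Im b))"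
    proof (rule Bolzano[of "Im a" "Im b"
          "\<lambda>u v. \<exists>d>0. \<forall>s t. s \<le> x \<and> x \<le> t \<and> t - s < d \<longrightarrow> S (R s t u v)"])
      fix u v w
      assume "\<exists>d>0. \<forall>s t. s \<le> x \<and> x \<le> t \<and> t - s < d \<longrightarrow> S (R s t u v)"
        and "\<exists>d>0. \<forall>s t. s \<le> x \<and> x \<le> t \<and> t - s < d \<longrightarrow> S (R s t v w)"
        and le: "u \<le> v" "v \<le> w"
      then obtain d d' where d: "d > 0" "\<And>s t. s \<le> x \<Longrightarrow> x \<le> t \<Longrightarrow> t - s < d \<Longrightarrow> S (R s t u v)"
        and d': "d' > 0" "\<And>s t. s \<le> x \<Longrightarrow> x \<le> t \<Longrightarrow> t - s < d' \<Longrightarrow> S (R s t v w)"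
        by metis
      have "S (R s t u w)" if st: "s \<le> x" "x \<le> t" "t - s < min d d'" for s t
      proof -
        have eq: "R s t u w = R s t u v \<union> R s t v w"
          using le by (auto simp: R_iff)
        show ?thesis
          unfolding eq using st d(2) d'(2) closed convex
          by (intro merge convex_connected convex_Int) (auto simp: R_def)
      qed
      then show "\<exists>d>0. \<forall>s t. s \<le> x \<and> x \<le> t \<and> t - s < d \<longrightarrow> S (R s t u w)"
        using d(1) d'(1) by (intro exI[of _ "min d d'"]) auto
    next
      fix y assume y: "Im a \<le> y" "y \<le> Im b"
      then obtain e where e: "e > 0" "S (ball (Complex x y) e \<inter> cbox a b)"
        using local[of "Complex x y"] x by (auto simp: in_cbox_complex_iff)
      \<comment> \<open>Half of \<open>e\<close> in each direction, as the modulus is at most the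
        sum of the two coordinate distances.\<close>
      have "S (R s t u v)" if "u \<le> y" "y \<le> v" "v - u < e/2" "s \<le> x" "x \<le> t" "t - s < e/2" for u v s t
      proof (rule mono[OF e(2)])
        show "R s t u v \<subseteq> ball (Complex x y) e \<inter> cbox a b"
        proof
          fix z assume z: "z \<in> R s t u v"
          have "cmod (Complex x y - z) \<le> \<bar>x - Re z\<bar> + \<bar>y - Im z\<bar>"
            using cmod_le[of "Complex x y - z"] by simp
          also have "\<dots> < e" using z that by (auto simp: R_iff)
          finally show "z \<in> ball (Complex x y) e \<inter> cbox a b"
            using z by (simp add: R_def dist_norm)
        qed
      qed
      then show "\<exists>d>0. \<forall>u v. u \<le> y \<and> y \<le> v \<and> v - u < d \<longrightarrow>
          (\<exists>d>0. \<forall>s t. s \<le> x \<and> x \<le> t \<and> t - s < d \<longrightarrow> S (R s t u v))"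
        using e(1) by (intro exI[of _ "e/2"]) (auto intro!: exI[of _ "e/2"])
    qed (use ab in auto)
    then show "\<exists>d>0. \<forall>s t. s \<le> x \<and> x \<le> t \<and> t - s < d \<longrightarrow> S (R s t (Im a) (Im b))" .
  qed (use ab in auto)
  then show ?thesis
    by (rule mono) (auto simp: R_def in_cbox_complex_iff)
qed

section \<open>Charts and their inverses\<close>

lemma surface_chart_inverse:
  assumes "surface_chart T U f"
  shows "openin T U" "inj_on f U" "continuous_map (subtopology T U) euclidean f"
    "continuous_map (top_of_set (f ` U)) T (inv_into U f)" "U \<subseteq> topspace T"
    "continuous_map (top_of_set (f ` U)) (subtopology T U) (inv_into U f)"
proof -
  show U: "openin T U" using assms by (simp add: surface_chart_def)
  then show US: "U \<subseteq> topspace T" by (rule openin_subset)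
  have f: "homeomorphic_map (subtopology T U) (top_of_set (f ` U)) f"
    using assms by (simp add: surface_chart_def)
  then show inj: "inj_on f U"
    using US by (auto simp: homeomorphic_eq_everything_map Int_absorb1)
  show "continuous_map (subtopology T U) euclidean f"
    using f by (auto simp: homeomorphic_eq_everything_map continuous_map_in_subtopology)
  obtain g where g: "homeomorphic_maps (subtopology T U) (top_of_set (f ` U)) f g"
    using f by (auto simp: homeomorphic_map_maps)
  have "g t = inv_into U f t" if "t \<in> f ` U" for t
    using g that inj US by (auto simp: homeomorphic_maps_def Int_absorb1)
  then show "continuous_map (top_of_set (f ` U)) (subtopology T U) (inv_into U f)"
    using g unfolding homeomorphic_maps_def by (elim conjE continuous_map_eq) auto
  then show "continuous_map (top_of_set (f ` U)) T (inv_into U f)"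
    by (simp add: continuous_map_in_subtopology)
qed

lemma surface_boundary_subset: "surface_boundary T \<subseteq> topspace T"
proof
  fix x assume "x \<in> surface_boundary T"
  then obtain U f where "surface_chart T U f" "x \<in> U"
    unfolding surface_boundary_def by blast
  then show "x \<in> topspace T" using surface_chart_inverse(5) by blast
qed

lemma inv_into_image_eq:
  assumes "inj_on f U" "K \<subseteq> f ` U"
  shows "inv_into U f ` K = {x \<in> U. f x \<in> K}"
proof
  show "inv_into U f ` K \<subseteq> {x \<in> U. f x \<in> K}"
    using assms(2) by (auto simp: inv_into_into f_inv_into_f subset_iff)
  show "{x \<in> U. f x \<in> K} \<subseteq> inv_into U f ` K"
    using assms(1) by (auto intro!: image_eqI[of _ _ "f _"])
qed

lemma surface_chart_openin_preimage:
  assumes "surface_chart T U f" "openin (top_of_set (f ` U)) K"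
  shows "openin T {x \<in> U. f x \<in> K}"
proof -
  note c = surface_chart_inverse[OF assms(1)]
  have "continuous_map (subtopology T U) (top_of_set (f ` U)) f"
    using c(3,5) by (auto simp: continuous_map_in_subtopology)
  then have "openin (subtopology T U) {x \<in> topspace (subtopology T U). f x \<in> K}"
    using assms(2) openin_continuous_map_preimage by blast
  moreover have "{x \<in> topspace (subtopology T U). f x \<in> K} = {x \<in> U. f x \<in> K}"
    using c(5) by auto
  ultimately show ?thesis
    using c(1) openin_trans_full by metis
qed

lemma surface_chart_openin_image:
  assumes "surface_chart T U f" "openin T W" "W \<subseteq> U"
  shows "openin (top_of_set (f ` U)) (f ` W)" "openin (top_of_set upper_halfplane) (f ` W)"
proof -
  have "openin (subtopology T U) W"
    using assms by (simp add: openin_open_subtopology surface_chart_def)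
  moreover have "open_map (subtopology T U) (top_of_set (f ` U)) f"
    using assms(1) by (auto simp: surface_chart_def homeomorphic_eq_everything_map)
  ultimately show "openin (top_of_set (f ` U)) (f ` W)"
    by (simp add: open_map_def)
  then show "openin (top_of_set upper_halfplane) (f ` W)"
    using assms(1) openin_trans by (auto simp: surface_chart_def)
qed

section \<open>Trivialisation over chart sets\<close>

context folded_surface begin

text \<open>Trivialisations over an increasing sequence of connected sets agree once all are
  normalised to 1 at a common point \<open>y0\<close>, so they paste. By \<open>cov\<close>, every
  point of \<open>S\<close> has a neighbourhood whose trace on \<open>S\<close> lies in a single
  member of the sequence; this provides the open cover for pasting.\<close>

lemma splits_exhaustion:
  fixes K :: "nat \<Rightarrow> 'a set"
  assumes inc: "incseq K" and con: "\<And>n. connectedin X (K n)" and spl: "\<And>n. splits (K n)"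
    and cov: "\<And>x. x \<in> S \<Longrightarrow> \<exists>W n. openin X W \<and> x \<in> W \<and> W \<inter> S \<subseteq> K n"
    and sub: "\<And>n. K n \<subseteq> S" and ne: "\<And>n. K n \<noteq> {}"
  shows "splits S"
proof -
  obtain x0 where x0: "x0 \<in> K 0" using ne by blast
  then have "x0 \<in> topspace X" using con[of 0] connectedin_subset_topspace by blast
  then obtain y0 where y0: "y0 \<in> topspace Y" "q y0 = x0" using q_surj by blast
  have x0n: "x0 \<in> K n" for n using x0 inc by (meson incseq_def subsetD zero_le)
  have "\<exists>g. alternating (K n) g \<and> (\<forall>y\<in>pre (K n). (g y)\<^sup>2 = 1) \<and> g y0 = 1" for n
  proof -
    obtain g where g: "alternating (K n) g" "\<forall>y\<in>pre (K n). (g y)\<^sup>2 = 1"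
      using spl unfolding splits_def by blast
    have "(g y0)\<^sup>2 = 1" using g(2) y0 x0n by auto
    moreover have "g y0 * g y0 = 1" using calculation by (simp add: power2_eq_square)
    \<comment> \<open>Multiplying \<open>g\<close> by its own value at \<open>y0\<close>, which is a
      sign, normalises it.\<close>
    ultimately have "alternating (K n) (\<lambda>y. g y0 * g y) \<and> (\<forall>y\<in>pre (K n). (g y0 * g y)\<^sup>2 = 1) \<and> g y0 * g y0 = 1"
      using g unfolding alternating_def
      by (auto simp: power_mult_distrib intro!: continuous_map_mult)
    then show ?thesis by (intro exI[of _ "\<lambda>y. g y0 * g y"])
  qed
  then obtain g where alt: "\<And>n. alternating (K n) (g n)" and sq: "\<And>n. \<forall>y\<in>pre (K n). (g n y)\<^sup>2 = 1"
    and one: "\<And>n. g n y0 = 1" by metis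
  have le: "g n y = g m y" if "n \<le> m" "y \<in> pre (K n)" for n m y
  proof -
    have nm: "K n \<subseteq> K m" using inc that by (simp add: incseq_def)
    have m: "alternating (K n) (g m)" "\<forall>y\<in>pre (K n). (g m y)\<^sup>2 = 1"
      using alternating_mono[OF alt nm] sq[of m] nm by auto
    obtain c where c: "\<And>y. y \<in> pre (K n) \<Longrightarrow> g m y = c * g n y"
      using splits_sign[OF alt[of n] sq[of n] m con[of n]] by blast
    then have "c = 1" using c[of y0] y0 x0n one by auto
    then show ?thesis using c that by simp
  qed
  have eq: "g n y = g m y" if "y \<in> pre (K n)" "y \<in> pre (K m)" for n m y
    using le[OF _ that(1), of m] le[OF _ that(2), of n] nat_le_linear[of n m] by force
  \<comment> \<open>By \<open>eq\<close>, any index with \<open>q y\<close> in \<open>K n\<close>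
    gives the same value.\<close>
  define s where "s y = g (LEAST n. q y \<in> K n) y" for y
  have s: "s y = g n y" if "y \<in> topspace Y" "q y \<in> K n" for n y
    unfolding s_def using that LeastI[of "\<lambda>n. q y \<in> K n" n] by (intro eq) auto
  have KS: "\<exists>n. x \<in> K n" if "x \<in> S" for x using cov[OF that] that by blast
  have "continuous_map (subtopology Y (pre S)) euclidean s"
  proof (rule pasting_lemma[where I = "{(W, n). openin X W \<and> W \<inter> S \<subseteq> K n}"
        and T = "\<lambda>(W, n). pre W \<inter> pre S" and f = "\<lambda>(W, n). g n"])
    fix i assume i: "i \<in> {(W, n). openin X W \<and> W \<inter> S \<subseteq> K n}"
    then obtain W n where Wn: "i = (W, n)" "openin X W" "W \<inter> S \<subseteq> K n" by auto
    have "openin Y (pre W)"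
      using openin_continuous_map_preimage[OF continuous_q Wn(2)] .
    then show "openin (subtopology Y (pre S)) ((\<lambda>(W, n). pre W \<inter> pre S) i)"
      using Wn by (auto simp: openin_subtopology_Int)
    have "continuous_map (subtopology Y (pre (K n))) euclidean (g n)"
      using alt by (simp add: alternating_def)
    then have "continuous_map (subtopology Y (pre S \<inter> (pre W \<inter> pre S))) euclidean (g n)"
      by (rule continuous_map_from_subtopology_mono) (use Wn in auto)
    then show "continuous_map (subtopology (subtopology Y (pre S)) ((\<lambda>(W, n). pre W \<inter> pre S) i)) euclidean
        ((\<lambda>(W, n). g n) i)"
      using Wn by (simp add: subtopology_subtopology)
  next
    fix i j y
    assume "i \<in> {(W, n). openin X W \<and> W \<inter> S \<subseteq> K n}" "j \<in> {(W, n). openin X W \<and> W \<inter> S \<subseteq> K n}"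
      and "y \<in> topspace (subtopology Y (pre S)) \<inter> (\<lambda>(W, n). pre W \<inter> pre S) i \<inter> (\<lambda>(W, n). pre W \<inter> pre S) j"
    then show "(\<lambda>(W, n). g n) i y = (\<lambda>(W, n). g n) j y"
      by (auto intro!: eq)
  next
    fix y assume y: "y \<in> topspace (subtopology Y (pre S))"
    then obtain W n where "openin X W" "q y \<in> W" "W \<inter> S \<subseteq> K n"
      using cov[of "q y"] by auto
    then show "\<exists>j. j \<in> {(W, n). openin X W \<and> W \<inter> S \<subseteq> K n} \<and> y \<in> (\<lambda>(W, n). pre W \<inter> pre S) j \<and>
        s y = (\<lambda>(W, n). g n) j y"
      using y s[of y n] by (intro exI[of _ "(W, n)"]) auto
  qed
  moreover have "s (fl p y) = - s y" if "p \<in> P" "y \<in> seg p" "q y \<in> S" for p y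
  proof -
    obtain n where "q y \<in> K n" using KS[OF \<open>q y \<in> S\<close>] by blast
    moreover have "y \<in> topspace Y" "fl p y \<in> topspace Y"
      using that flip_in seg_subset by blast+
    moreover have "g n (fl p y) = - g n y"
      using calculation(1) alt[of n] that unfolding alternating_def by blast
    ultimately show ?thesis
      using s[of y n] s[of "fl p y" n] q_flip[OF that(1,2)] by simp
  qed
  moreover have "(s y)\<^sup>2 = 1" if yS: "y \<in> pre S" for y
  proof -
    obtain n where "q y \<in> K n" using KS[of "q y"] yS by blast
    then show ?thesis using s[of y n] sq[of n] yS by auto
  qed
  ultimately show ?thesis unfolding splits_def alternating_def by blast
qed

lemma splits_chart_Un:
  assumes chart: "surface_chart X U f" and sub: "K \<union> L \<subseteq> f ` U"
    and K: "splits {x \<in> U. f x \<in> K}" and L: "splits {x \<in> U. f x \<in> L}"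
    and cl: "closed K" "closed L" and con: "connected (K \<inter> L)"
  shows "splits {x \<in> U. f x \<in> K \<union> L}"
proof -
  note c = surface_chart_inverse[OF chart]
  have "connectedin X (inv_into U f ` (K \<inter> L))"
    using sub con by (intro connectedin_continuous_map_image[OF c(4)]) (auto simp: connectedin_subtopology)
  also have "inv_into U f ` (K \<inter> L) = {x \<in> U. f x \<in> K} \<inter> {x \<in> U. f x \<in> L}"
    using sub by (subst inv_into_image_eq[OF c(2)]) auto
  finally have 1: "connectedin X ({x \<in> U. f x \<in> K} \<inter> {x \<in> U. f x \<in> L})" .
  have 2: "closedin (subtopology X ({x \<in> U. f x \<in> K} \<union> {x \<in> U. f x \<in> L})) {x \<in> U. f x \<in> J}"
    if "J = K \<or> J = L" for J
  proof -
    have "continuous_map (subtopology X ({x \<in> U. f x \<in> K} \<union> {x \<in> U. f x \<in> L})) euclidean f"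
      by (rule continuous_map_from_subtopology_mono[OF c(3)]) auto
    moreover have "closedin euclidean J" using that cl by auto
    ultimately have "closedin (subtopology X ({x \<in> U. f x \<in> K} \<union> {x \<in> U. f x \<in> L}))
       {x \<in> topspace (subtopology X ({x \<in> U. f x \<in> K} \<union> {x \<in> U. f x \<in> L})). f x \<in> J}"
      by (rule closedin_continuous_map_preimage)
    also have "{x \<in> topspace (subtopology X ({x \<in> U. f x \<in> K} \<union> {x \<in> U. f x \<in> L})). f x \<in> J} = {x \<in> U. f x \<in> J}"
      using that c(5) by auto
    finally show ?thesis .
  qed
  have "{x \<in> U. f x \<in> K \<union> L} = {x \<in> U. f x \<in> K} \<union> {x \<in> U. f x \<in> L}" by auto
  then show ?thesis
    using splits_Un[OF K L 1 2 2] by simp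
qed

text \<open>A rectangle is simply connected, so a double covering that is locally trivial over it is
  trivial; bisection replaces the lifting of paths.\<close>

lemma splits_chart_rectangle:
  assumes chart: "surface_chart X U f" and sub: "cbox a b \<subseteq> f ` U"
    and loc: "\<And>x. x \<in> U \<Longrightarrow> f x \<in> cbox a b \<Longrightarrow> \<exists>W. openin X W \<and> x \<in> W \<and> splits W"
    and ab: "Re a \<le> Re b" "Im a \<le> Im b"
  shows "splits {x \<in> U. f x \<in> cbox a b}"
proof (rule rectangle_bisection[of "\<lambda>K. splits {x \<in> U. f x \<in> K}"])
  note c = surface_chart_inverse[OF chart]
  show "splits {x \<in> U. f x \<in> L}" if "splits {x \<in> U. f x \<in> K}" "L \<subseteq> K" for K L
    using that by (elim splits_mono) auto
  show "splits {x \<in> U. f x \<in> K \<union> L}"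
    if "splits {x \<in> U. f x \<in> K}" "splits {x \<in> U. f x \<in> L}"
      "closed K" "closed L" "connected (K \<inter> L)" "K \<union> L \<subseteq> cbox a b" for K L
    using splits_chart_Un[OF chart _ that(1,2,3,4,5)] that sub by blast
  fix z assume z: "z \<in> cbox a b"
  then obtain x where x: "x \<in> U" "f x = z" using sub by blast
  then obtain W where W: "openin X W" "x \<in> W" "splits W" using loc z by blast
  have "openin (top_of_set (f ` U)) (f ` (W \<inter> U))"
    using W c(1) by (intro surface_chart_openin_image[OF chart]) auto
  then obtain e where e: "e > 0" "ball z e \<inter> f ` U \<subseteq> f ` (W \<inter> U)"
    using x W unfolding openin_contains_ball by blast
  have "splits {x \<in> U. f x \<in> ball z e \<inter> cbox a b}"
  proof (rule splits_mono[OF W(3)])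
    show "{x \<in> U. f x \<in> ball z e \<inter> cbox a b} \<subseteq> W"
    proof
      fix x assume "x \<in> {x \<in> U. f x \<in> ball z e \<inter> cbox a b}"
      then have "x \<in> U" "f x \<in> f ` (W \<inter> U)" using e by auto
      then show "x \<in> W" using inj_on_image_mem_iff[OF c(2), of x "W \<inter> U"] by simp
    qed
  qed
  then show "\<exists>e>0. splits {x \<in> U. f x \<in> ball z e \<inter> cbox a b}" using e by blast
qed (use ab in auto)

text \<open>The removed point sits on the bottom side, so what remains is simply connected: it is
  exhausted by arches made of \<open>L n\<close>, \<open>T n\<close>, \<open>R n\<close> (left, top,
  right), whose successive overlaps are rectangles, while left and right stay apart.\<close>

lemma splits_punctured_half_square:
  assumes chart: "surface_chart X U f" and r: "0 < r"
    and sub: "cbox (Complex (x0 - r) 0) (Complex (x0 + r) r) \<subseteq> f ` U"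
    and loc: "\<And>x. x \<in> U \<Longrightarrow> f x \<in> cbox (Complex (x0 - r) 0) (Complex (x0 + r) r) \<Longrightarrow>
      f x \<noteq> of_real x0 \<Longrightarrow> \<exists>W. openin X W \<and> x \<in> W \<and> splits W"
  shows "splits {x \<in> U. f x \<in> cbox (Complex (x0 - r) 0) (Complex (x0 + r) r) - {of_real x0}}"
proof -
  note c = surface_chart_inverse[OF chart]
  define Q where "Q = cbox (Complex (x0 - r) 0) (Complex (x0 + r) r)"
  \<comment> \<open>The summand 2 keeps \<open>d n\<close> strictly between 0 and \<open>r\<close>
    from n = 0 on, so no part of an arch degenerates.\<close>
  define d where "d n = r / (real n + 2)" for n
  \<comment> \<open>On the half-plane this is the distance from \<open>x0\<close> in the maximum
    norm; the arch of index n is the part of \<open>Q\<close> with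
    \<open>d n \<le> \<mu> z\<close>.\<close>
  define \<mu> where "\<mu> z = max \<bar>Re z - x0\<bar> (Im z)" for z
  define L where "L n = cbox (Complex (x0 - r) 0) (Complex (x0 - d n) r)" for n
  define T where "T n = cbox (Complex (x0 - r) (d n)) (Complex (x0 + r) r)" for n
  define R where "R n = cbox (Complex (x0 + d n) 0) (Complex (x0 + r) r)" for n
  have d: "0 < d n" "d n < r" for n using r by (auto simp: d_def field_simps add_pos_nonneg)
  have union: "L n \<union> T n \<union> R n = {z \<in> Q. d n \<le> \<mu> z}" for n
    using d[of n] by (auto simp: L_def T_def R_def Q_def \<mu>_def in_cbox_complex_iff)
  have QU: "Q \<subseteq> f ` U" using sub by (simp add: Q_def)
  have \<mu>0: "\<mu> (of_real x0) = 0" by (simp add: \<mu>_def)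
  have rect: "splits {x \<in> U. f x \<in> cbox a b}"
    if ab: "cbox a b \<subseteq> {z \<in> Q. d n \<le> \<mu> z}" "Re a \<le> Re b" "Im a \<le> Im b" for a b n
  proof (rule splits_chart_rectangle[OF chart _ _ ab(2,3)])
    show "cbox a b \<subseteq> f ` U" using ab QU by blast
    show "\<exists>W. openin X W \<and> x \<in> W \<and> splits W" if "x \<in> U" "f x \<in> cbox a b" for x
    proof (rule loc)
      have "f x \<in> Q" "d n \<le> \<mu> (f x)" using that ab(1) by auto
      then show "f x \<in> cbox (Complex (x0 - r) 0) (Complex (x0 + r) r)" "f x \<noteq> of_real x0"
        using \<mu>0 d(1)[of n] by (auto simp: Q_def)
    qed (fact that)
  qed
  have LT: "connected (L n \<inter> T n)" "L n \<inter> T n \<noteq> {}" for n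
  proof -
    have "Complex (x0 - r) r \<in> L n \<inter> T n" using d[of n] by (auto simp: L_def T_def in_cbox_complex_iff)
    then show "L n \<inter> T n \<noteq> {}" by blast
  qed (auto simp: L_def T_def intro!: convex_connected convex_Int)
  have LTR: "connected ((L n \<union> T n) \<inter> R n)" "(L n \<union> T n) \<inter> R n \<noteq> {}" for n
  proof -
    have "Complex (x0 + r) r \<in> (L n \<union> T n) \<inter> R n" using d[of n] by (auto simp: R_def T_def in_cbox_complex_iff)
    then show "(L n \<union> T n) \<inter> R n \<noteq> {}" by blast
    have "(L n \<union> T n) \<inter> R n = T n \<inter> R n" using d[of n] by (auto simp: L_def R_def in_cbox_complex_iff)
    then show "connected ((L n \<union> T n) \<inter> R n)" by (auto simp: R_def T_def intro!: convex_connected convex_Int)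
  qed
  have con: "connected (L n \<union> T n \<union> R n)" for n
    using LT LTR by (intro connected_Un) (auto simp: L_def T_def R_def convex_connected)
  have cl: "closed (L n)" "closed (T n)" "closed (R n)" for n
    by (auto simp: L_def T_def R_def)
  have split_n: "splits {x \<in> U. f x \<in> L n \<union> T n \<union> R n}" for n
  proof -
    have "splits {x \<in> U. f x \<in> L n}" "splits {x \<in> U. f x \<in> T n}" "splits {x \<in> U. f x \<in> R n}"
      unfolding L_def T_def R_def using union[of n] d[of n] r
      by (auto intro!: rect[of _ _ n] simp: L_def T_def R_def)
    then show ?thesis
      using LT LTR cl union[of n] QU
      by (intro splits_chart_Un[OF chart]) auto
  qed
  have "splits {x \<in> U. f x \<in> Q - {of_real x0}}"
  proof (rule splits_exhaustion[of "\<lambda>n. {x \<in> U. f x \<in> L n \<union> T n \<union> R n}"])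
    show "incseq (\<lambda>n. {x \<in> U. f x \<in> L n \<union> T n \<union> R n})"
    proof -
      have "d m \<le> d n" if "n \<le> m" for n m
        using that r by (auto simp: d_def intro!: divide_left_mono)
      then show ?thesis unfolding union incseq_def by fastforce
    qed
    show "connectedin X {x \<in> U. f x \<in> L n \<union> T n \<union> R n}" for n
    proof -
      have "connectedin X (inv_into U f ` (L n \<union> T n \<union> R n))"
        using con[of n] QU union[of n]
        by (intro connectedin_continuous_map_image[OF c(4)]) (simp add: connectedin_subtopology, blast)
      also have "inv_into U f ` (L n \<union> T n \<union> R n) = {x \<in> U. f x \<in> L n \<union> T n \<union> R n}"
        using union[of n] QU by (intro inv_into_image_eq[OF c(2)]) auto
      finally show ?thesis .
    qed
    show "splits {x \<in> U. f x \<in> L n \<union> T n \<union> R n}" for n by (rule split_n)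
    show "{x \<in> U. f x \<in> L n \<union> T n \<union> R n} \<subseteq> {x \<in> U. f x \<in> Q - {of_real x0}}" for n
      unfolding union using \<mu>0 d(1)[of n] by auto
    show "{x \<in> U. f x \<in> L n \<union> T n \<union> R n} \<noteq> {}" for n
      using LT(2)[of n] QU union[of n] by blast
    fix x assume x: "x \<in> {x \<in> U. f x \<in> Q - {of_real x0}}"
    then have "\<mu> (f x) > 0"
      by (auto simp: \<mu>_def Q_def in_cbox_complex_iff complex_eq_iff less_max_iff_disj)
    moreover have "d \<longlonglongrightarrow> 0" unfolding d_def by real_asymp
    ultimately obtain n where n: "d n < \<mu> (f x)"
      using d order_tendstoD(2)[of d 0 sequentially "\<mu> (f x)"] eventually_sequentially by (meson le_refl)
    have "continuous_on UNIV \<mu>" unfolding \<mu>_def by (intro continuous_intros)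
    then have "open {z. d n < \<mu> z}" by (intro open_Collect_less continuous_intros)
    then have "openin X {x \<in> U. f x \<in> f ` U \<inter> {z. d n < \<mu> z}}"
      by (intro surface_chart_openin_preimage[OF chart] openin_open_Int)
    moreover have "{x \<in> U. f x \<in> f ` U \<inter> {z. d n < \<mu> z}} \<inter> {x \<in> U. f x \<in> Q - {of_real x0}}
       \<subseteq> {x \<in> U. f x \<in> L n \<union> T n \<union> R n}"
      unfolding union by auto
    ultimately show "\<exists>W n. openin X W \<and> x \<in> W \<and> W \<inter> {x \<in> U. f x \<in> Q - {of_real x0}}
       \<subseteq> {x \<in> U. f x \<in> L n \<union> T n \<union> R n}"
      using n x by (intro exI[of _ "{x \<in> U. f x \<in> f ` U \<inter> {z. d n < \<mu> z}}"] exI[of _ n]) auto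
  qed
  then show ?thesis unfolding Q_def .
qed

end

section \<open>Splitting away from the punctures\<close>

lemma continuous_map_two_valued:
  assumes "openin T A" "openin T B" "A \<inter> B = {}" "topspace T = A \<union> B" "a \<in> topspace Z" "b \<in> topspace Z"
  shows "continuous_map T Z (\<lambda>x. if x \<in> A then a else b)"
  unfolding continuous_map_def
proof (intro conjI allI impI)
  fix V assume "openin Z V"
  have "{x \<in> topspace T. (if x \<in> A then a else b) \<in> V} = (if a \<in> V then A else {}) \<union> (if b \<in> V then B else {})"
    using assms by auto
  then show "openin T {x \<in> topspace T. (if x \<in> A then a else b) \<in> V}"
    using assms by auto
qed (use assms in auto)

lemma surface_chart_restrict:
  assumes "surface_chart T U f" "openin T W" "W \<subseteq> U"
  shows "surface_chart T W f"
proof -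
  note c = surface_chart_inverse[OF assms(1)]
  have "homeomorphic_map (subtopology (subtopology T U) W) (subtopology (top_of_set (f ` U)) (f ` W)) f"
  proof (rule homeomorphic_map_subtopologies)
    show "homeomorphic_map (subtopology T U) (top_of_set (f ` U)) f"
      using assms(1) by (simp add: surface_chart_def)
  qed (use assms(3) c(5) in auto)
  moreover have "U \<inter> W = W" "f ` U \<inter> f ` W = f ` W" using assms(3) by auto
  ultimately have "homeomorphic_map (subtopology T W) (top_of_set (f ` W)) f"
    by (simp add: subtopology_subtopology)
  then show ?thesis
    using assms surface_chart_openin_image[OF assms] by (simp add: surface_chart_def)
qed

section \<open>Half-discs and countable sets\<close>

lemma half_disc_in_chart:
  assumes "surface_chart T U f" "y \<in> U"
  obtains r where "r > 0" "ball (f y) r \<inter> upper_halfplane \<subseteq> f ` U"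
  using assms unfolding surface_chart_def openin_contains_ball by blast

text \<open>Moving the centre up by r/2 yields a full disc even when \<open>c\<close> lies on the
  boundary line; it witnesses that a half-disc is neither collinear nor countable.\<close>

lemma half_disc_contains_ball:
  assumes "0 \<le> Im c" "0 < r"
  shows "ball (c + Complex 0 (r/2)) (r/2) \<subseteq> ball c r \<inter> upper_halfplane"
proof
  fix z assume z: "z \<in> ball (c + Complex 0 (r/2)) (r/2)"
  then have n: "cmod (c + Complex 0 (r/2) - z) < r/2" by (simp add: dist_norm)
  have "Im (c + Complex 0 (r/2) - z) < r/2"
    using order_trans[OF abs_ge_self abs_Im_le_cmod] n by (rule order.strict_trans1)
  then have "0 \<le> Im z" using assms by simp
  moreover have "cmod (c - z) \<le> cmod (c + Complex 0 (r/2) - z) + cmod (Complex 0 (r/2))"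
    using norm_triangle_ineq4[of "c + Complex 0 (r/2) - z" "Complex 0 (r/2)"] by (simp add: algebra_simps)
  then have "cmod (c - z) < r"
    using n assms(2) by (simp add: complex_norm)
  ultimately show "z \<in> ball c r \<inter> upper_halfplane"
    by (simp add: dist_norm upper_halfplane_def)
qed

lemma convex_upper_halfplane: "convex upper_halfplane"
  unfolding upper_halfplane_def by (rule convex_halfspace_Im_ge)

text \<open>A half-disc is convex and not collinear, and such a set stays connected when countably
  many points are removed. \<open>F\<close> will be the fibre over a marked point.\<close>

lemma surface_local_connected_diff_countable:
  assumes chart: "surface_chart T U f" "y \<in> U" and O: "openin T O'" "y \<in> O'" and F: "countable F"
  obtains N where "openin T N" "y \<in> N" "N \<subseteq> O'" "connectedin T (N - F)"
proof -
  have chart': "surface_chart T (U \<inter> O') f"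
    using surface_chart_restrict[OF chart(1)] O surface_chart_inverse(1)[OF chart(1)] by auto
  note c = surface_chart_inverse[OF chart']
  obtain r where r: "r > 0" "ball (f y) r \<inter> upper_halfplane \<subseteq> f ` (U \<inter> O')"
    using half_disc_in_chart[OF chart'] chart(2) O(2) by blast
  define D where "D = ball (f y) r \<inter> upper_halfplane"
  have "f ` (U \<inter> O') \<subseteq> upper_halfplane"
    using chart' openin_imp_subset unfolding surface_chart_def by blast
  then have fy: "f y \<in> upper_halfplane" using chart(2) O(2) by blast
  have ball: "ball (f y + Complex 0 (r/2)) (r/2) \<subseteq> D"
    unfolding D_def using half_disc_contains_ball r(1) fy by (simp add: upper_halfplane_def)
  have nc: "\<not> collinear D"
  proof
    assume "collinear D"
    then have "collinear (ball (f y + Complex 0 (r/2)) (r/2))" using ball collinear_subset by blast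
    then show False using r(1) by (simp add: collinear_aff_dim aff_dim_open)
  qed
  have D: "D = f ` (U \<inter> O') \<inter> ball (f y) r"
    using r(2) \<open>f ` (U \<inter> O') \<subseteq> upper_halfplane\<close> unfolding D_def by blast
  define N where "N = {x \<in> U \<inter> O'. f x \<in> D}"
  have "openin T N"
    unfolding N_def D by (rule surface_chart_openin_preimage[OF chart']) (simp add: openin_open_Int)
  moreover have "y \<in> N" "N \<subseteq> O'"
    using chart O fy r(1) by (auto simp: N_def D_def)
  moreover have "connectedin T (N - F)"
  proof -
    have F: "f x \<in> f ` (F \<inter> (U \<inter> O')) \<longleftrightarrow> x \<in> F" if "x \<in> U \<inter> O'" for x
      using inj_on_image_mem_iff[OF c(2) that, of "F \<inter> (U \<inter> O')"] that by auto
    have "inv_into (U \<inter> O') f ` (D - f ` (F \<inter> (U \<inter> O'))) = {x \<in> U \<inter> O'. f x \<in> D - f ` (F \<inter> (U \<inter> O'))}"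
      using D by (intro inv_into_image_eq[OF c(2)]) auto
    also have "\<dots> = N - F"
      unfolding N_def using F by blast
    finally have "inv_into (U \<inter> O') f ` (D - f ` (F \<inter> (U \<inter> O'))) = N - F" .
    moreover have "connected (D - f ` (F \<inter> (U \<inter> O')))"
      using nc \<open>countable F\<close> convex_upper_halfplane unfolding D_def
      by (intro connected_convex_diff_countable) (auto intro: convex_Int countable_Int1)
    then have "connectedin T (inv_into (U \<inter> O') f ` (D - f ` (F \<inter> (U \<inter> O'))))"
      using D by (intro connectedin_continuous_map_image[OF c(4)]) (auto simp: connectedin_subtopology)
    ultimately show ?thesis by simp
  qed
  ultimately show thesis using that by blast
qed

text \<open>Guarantees that overlapping neighbourhoods in the cut surface share a point off a given
  countable fibre.\<close>

lemma surface_open_uncountable: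
  assumes chart: "surface_chart T U f" "y \<in> U" and O: "openin T O'" "y \<in> O'"
  shows "uncountable O'"
proof
  assume "countable O'"
  have chart': "surface_chart T (U \<inter> O') f"
    using surface_chart_restrict[OF chart(1)] O surface_chart_inverse(1)[OF chart(1)] by auto
  obtain r where r: "r > 0" "ball (f y) r \<inter> upper_halfplane \<subseteq> f ` (U \<inter> O')"
    using half_disc_in_chart[OF chart'] chart(2) O(2) by blast
  have "f ` (U \<inter> O') \<subseteq> upper_halfplane"
    using chart' openin_imp_subset unfolding surface_chart_def by blast
  then have fy: "f y \<in> upper_halfplane" using chart(2) O(2) by blast
  have "0 \<le> Im (f y)" using fy by (simp add: upper_halfplane_def)
  then have ball: "ball (f y + Complex 0 (r/2)) (r/2) \<subseteq> f ` (U \<inter> O')"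
    by (rule subset_trans[OF half_disc_contains_ball[OF _ r(1)] r(2)])
  moreover have "countable (f ` (U \<inter> O'))"
    using \<open>countable O'\<close> by (intro countable_image countable_Int2)
  ultimately have "countable (ball (f y + Complex 0 (r/2)) (r/2))"
    by (rule countable_subset)
  then show False using uncountable_ball[of "r/2" "f y + Complex 0 (r/2)"] r(1) by simp
qed

lemma uncountable_openin_unit_interval:
  fixes G :: "real set"
  assumes "openin (top_of_set {0..1}) G" "t \<in> G"
  shows "uncountable G"
proof -
  obtain e where e: "e > 0" "ball t e \<inter> {0..1} \<subseteq> G" and t: "t \<in> {0..1}"
    using assms unfolding openin_contains_ball by blast
  have sub: "{max 0 (t - e/2)..min 1 (t + e/2)} \<subseteq> ball t e \<inter> {0..1}"
    using e(1) by (auto simp: dist_real_def abs_less_iff min_def max_def split: if_splits)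
  have "uncountable {max 0 (t - e/2)..min 1 (t + e/2)}"
    using e(1) t by (subst uncountable_closed_interval) auto
  then show ?thesis using countable_subset[OF subset_trans[OF sub e(2)]] by (rule contrapos_nn)
qed

text \<open>\<open>seg_P\<close> and \<open>seg_seg\<close> carry the triangulation into the cut
  surface: a folded side contains its own puncture only, and different folded sides meet in marked
  points only. They are verified through \<open>folded_sides\<close>.\<close>

locale folded_marked_surface = folded_surface +
  fixes M :: "'a set"
  assumes Hausdorff_Y: "Hausdorff_space Y"
    and chart_Y: "y \<in> topspace Y \<Longrightarrow> \<exists>U f. surface_chart Y U f \<and> y \<in> U"
    and chart_X: "x \<in> topspace X \<Longrightarrow> \<exists>U f. surface_chart X U f \<and> x \<in> U"
    and seg_boundary: "p \<in> P \<Longrightarrow> seg p \<subseteq> surface_boundary Y"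
    and finite_M: "finite M"
    and M_boundary: "M \<subseteq> surface_boundary X"
    and P_interior: "P \<subseteq> surface_interior X"
    and seg_centre: "p \<in> P \<Longrightarrow> y \<in> seg p \<Longrightarrow> \<phi> p y = 1/2 \<Longrightarrow> q y = p"
    and seg_P: "p \<in> P \<Longrightarrow> y \<in> seg p \<Longrightarrow> q y \<in> P \<Longrightarrow> q y = p"
    and seg_seg: "p \<in> P \<Longrightarrow> p' \<in> P \<Longrightarrow> y \<in> seg p \<Longrightarrow> y' \<in> seg p' \<Longrightarrow> q y = q y' \<Longrightarrow> p \<noteq> p' \<Longrightarrow> q y \<in> M"
begin

lemma M_P: "M \<inter> P = {}"
  using M_boundary P_interior by (auto simp: surface_interior_def)

lemma M_sub: "M \<subseteq> topspace X"
  using M_boundary surface_boundary_subset by (rule subset_trans)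

lemma P_sub: "P \<subseteq> topspace X"
  using P_interior by (auto simp: surface_interior_def)

section \<open>Segments, fibres and signs off the marked points\<close>

lemma closedin_seg:
  assumes "p \<in> P" "closed J"
  shows "closedin Y {y \<in> seg p. \<phi> p y \<in> J}"
proof -
  have "compact ({0..1} \<inter> J)" using assms(2) by (simp add: compact_Int_closed)
  then have "compactin Y (inv_into (seg p) (\<phi> p) ` ({0..1} \<inter> J))"
    by (intro image_compactin[OF _ continuous_\<phi>_inv[OF assms(1)]]) (auto simp: compactin_subtopology)
  moreover have "inv_into (seg p) (\<phi> p) ` ({0..1} \<inter> J) = {y \<in> seg p. \<phi> p y \<in> J}"
    using bij_\<phi>[OF assms(1)] by (subst inv_into_image_eq) (auto simp: bij_betw_def)
  ultimately show ?thesis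
    using Hausdorff_Y compactin_imp_closedin by metis
qed

lemma closedin_seg_all: "p \<in> P \<Longrightarrow> closedin Y (seg p)"
  using closedin_seg[of p UNIV] by simp

text \<open>Off the marked points no second segment meets the fibre, so a chain of flips only moves
  back and forth between two points.\<close>

lemma fibre_eq_flip:
  assumes p: "p \<in> P" "y \<in> seg p" "q y \<notin> M"
  shows "pre {q y} = {y, fl p y}"
proof
  show "{y, fl p y} \<subseteq> pre {q y}"
    using p flip_in[OF p(1,2)] seg_subset[OF p(1)] q_flip[OF p(1,2)] by auto
  show "pre {q y} \<subseteq> {y, fl p y}"
  proof
    fix z assume "z \<in> pre {q y}"
    then have z: "z \<in> topspace Y" "q y = q z" by auto
    have y: "y \<in> topspace Y" using p seg_subset by blast
    from y z show "z \<in> {y, fl p y}"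
    proof (induction rule: fibre_induct)
      case (flip p' z)
      have "z \<in> seg p" using flip p flip_in by auto
      then have "p' = p" using seg_seg[of p' p z z] flip p by auto
      then show ?case using flip flip_flip[OF p(1,2)] by auto
    qed simp
  qed
qed

text \<open>The fixed point of the folding of \<open>seg p\<close>; \<open>fibre_ctr\<close> shows
  that it is the only point over the puncture.\<close>

definition ctr :: "'a \<Rightarrow> 'b" where
  "ctr p = inv_into (seg p) (\<phi> p) (1/2)"

lemma ctr: "p \<in> P \<Longrightarrow> ctr p \<in> seg p" "p \<in> P \<Longrightarrow> \<phi> p (ctr p) = 1/2" "p \<in> P \<Longrightarrow> q (ctr p) = p"
  "p \<in> P \<Longrightarrow> fl p (ctr p) = ctr p"
proof -
  assume p: "p \<in> P"
  show 1: "ctr p \<in> seg p" "\<phi> p (ctr p) = 1/2" using inv_\<phi>[OF p] by (auto simp: ctr_def)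
  then show "q (ctr p) = p" using seg_centre p by blast
  show "fl p (ctr p) = ctr p" by (simp add: flip_def 1(2)) (simp add: ctr_def)
qed

lemma fibre_ctr: "p \<in> P \<Longrightarrow> pre {p} = {ctr p}"
  using fibre_eq_flip[of p "ctr p"] ctr[of p] M_P by auto

text \<open>No segment meets the preimage of this set, so nothing has to change sign and the
  constant 1 serves.\<close>

lemma splits_off_seg: "splits (topspace X - (\<Union>p\<in>P. q ` seg p))"
proof -
  have "alternating (topspace X - (\<Union>p\<in>P. q ` seg p)) (\<lambda>_. 1)"
    by (auto simp: alternating_def)
  then show ?thesis unfolding splits_def by (intro exI[of _ "\<lambda>_. 1"]) auto
qed

text \<open>The value is 1 near \<open>y\<close> and -1 near its flip. Deleting the wrong half of
  \<open>seg p\<close> from each neighbourhood ties the sign to the side of 1/2 on which the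
  parameter lies, and the folding exchanges these sides.\<close>

lemma splits_near_seg:
  assumes p: "p \<in> P" and y: "y \<in> seg p" "\<phi> p y < 1/2" and yM: "q y \<notin> M"
  obtains W where "openin X W" "q y \<in> W" "splits W"
proof -
  let ?y' = "fl p y"
  have y': "?y' \<in> seg p" "\<phi> p ?y' > 1/2" using flip_in \<phi>_flip p y by auto
  have yY: "y \<in> topspace Y" "?y' \<in> topspace Y" using y y' p seg_subset by auto
  have "y \<noteq> ?y'" using y y' by auto
  then obtain O1 O2 where O: "openin Y O1" "openin Y O2" "y \<in> O1" "?y' \<in> O2" "O1 \<inter> O2 = {}"
    using Hausdorff_Y yY unfolding Hausdorff_space_def disjnt_def by metis
  define R where "R = (\<Union>p'\<in>P-{p}. seg p')"
  have R: "closedin Y R" unfolding R_def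
    by (rule closedin_Union) (use finite_P closedin_seg_all in auto)
  have off: "y \<notin> R" "?y' \<notin> R"
    using seg_seg[OF p _ y(1)] seg_seg[OF p _ y'(1)] yM q_flip[OF p y(1)] unfolding R_def by fastforce+
  define A where "A = O1 - R - {z \<in> seg p. \<phi> p z \<in> {1/2..}}"
  define B where "B = O2 - R - {z \<in> seg p. \<phi> p z \<in> {..1/2}}"
  have "closedin Y {z \<in> seg p. \<phi> p z \<in> {1/2..}}" "closedin Y {z \<in> seg p. \<phi> p z \<in> {..1/2}}"
    by (intro closedin_seg[OF p] closed_atLeast closed_atMost)+
  then have AB: "openin Y A" "openin Y B" unfolding A_def B_def
    using O(1,2) R by (blast intro: openin_diff)+
  have "pre {q y} \<subseteq> A \<union> B"
    unfolding fibre_eq_flip[OF p y(1) yM] A_def B_def using O off y y' by auto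
  then obtain W where W: "openin X W" "q y \<in> W" "pre W \<subseteq> A \<union> B"
    using fibre_neighbourhood[of "A \<union> B" "q y"] AB q_in[OF yY(1)] by blast
  define g :: "'b \<Rightarrow> complex" where "g z = (if z \<in> A \<inter> pre W then 1 else -1)" for z
  have "continuous_map (subtopology Y (pre W)) euclidean g"
    unfolding g_def
  proof (rule continuous_map_two_valued)
    show "openin (subtopology Y (pre W)) (A \<inter> pre W)" "openin (subtopology Y (pre W)) (B \<inter> pre W)"
      using AB by (auto simp: openin_subtopology_Int)
    show "A \<inter> pre W \<inter> (B \<inter> pre W) = {}" using O(5) by (auto simp: A_def B_def)
    show "topspace (subtopology Y (pre W)) = A \<inter> pre W \<union> B \<inter> pre W" using W(3) by auto
  qed auto
  moreover have "g (fl p' z) = - g z" if z: "p' \<in> P" "z \<in> seg p'" "q z \<in> W" for p' z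
  proof -
    have zY: "z \<in> pre W" "fl p' z \<in> pre W"
      using z flip_in[OF z(1,2)] seg_subset[OF z(1)] q_flip[OF z(1,2)] by auto
    then have "z \<notin> R" using W(3) by (auto simp: A_def B_def)
    then have pp: "p' = p" using z by (auto simp: R_def)
    have "z \<in> A \<longleftrightarrow> \<phi> p z < 1/2" if "z \<in> pre W" "z \<in> seg p" for z
      using that W(3) by (auto simp: A_def B_def)
    moreover have "\<phi> p z \<noteq> 1/2"
      using zY(1) W(3) z(2) pp by (auto simp: A_def B_def)
    ultimately show ?thesis
      using zY z flip_in[OF z(1,2)] \<phi>_flip[OF z(1,2)] unfolding pp g_def by auto
  qed
  ultimately have "splits W"
    unfolding splits_def alternating_def by (intro exI[of _ g]) (auto simp: g_def)
  with W that show thesis by blast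
qed

lemma splits_unmarked:
  assumes x: "x \<in> topspace X" "x \<notin> M" "x \<notin> P"
  shows "\<exists>W. openin X W \<and> x \<in> W \<and> splits W"
proof (cases "x \<in> (\<Union>p\<in>P. q ` seg p)")
  case False
  have "closedin X (\<Union>p\<in>P. q ` seg p)"
    using finite_P closed_q closedin_seg_all by (intro closedin_Union) (auto simp: closed_map_def)
  then show ?thesis using splits_off_seg x False
    by (intro exI[of _ "topspace X - (\<Union>p\<in>P. q ` seg p)"]) auto
next
  case True
  then obtain p y where p: "p \<in> P" "y \<in> seg p" "x = q y" by blast
  have ne: "\<phi> p y \<noteq> 1/2" using seg_centre[OF p(1,2)] p(1,3) x(3) by auto
  show ?thesis
  proof (cases "\<phi> p y < 1/2")
    case True
    then show ?thesis using splits_near_seg[of p y] p x by metis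
  next
    case False
    then have "\<phi> p (fl p y) < 1/2" using \<phi>_flip[OF p(1,2)] ne by auto
    then show ?thesis using splits_near_seg[of p "fl p y"] p x flip_in q_flip by metis
  qed
qed

text \<open>\<open>R n\<close> holds the points reached from \<open>y\<close> by n flips, a finite
  set because there are finitely many segments. The fibre lies in the union of these sets.\<close>

lemma countable_fibre:
  assumes "y \<in> topspace Y"
  shows "countable (pre {q y})"
proof -
  define R where "R = rec_nat {y} (\<lambda>_ S. \<Union>p\<in>P. fl p ` (S \<inter> seg p))"
  have R: "R 0 = {y}" "R (Suc n) = (\<Union>p\<in>P. fl p ` (R n \<inter> seg p))" for n by (auto simp: R_def)
  have "finite (R n)" for n by (induction n) (auto simp: R finite_P)
  then have "countable (\<Union>n. R n)" by (simp add: countable_finite)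
  moreover have "pre {q y} \<subseteq> (\<Union>n. R n)"
  proof
    fix z assume "z \<in> pre {q y}"
    then have z: "z \<in> topspace Y" "q y = q z" by auto
    from assms z show "z \<in> (\<Union>n. R n)"
    proof (induction rule: fibre_induct)
      case base
      show ?case by (rule UN_I[of 0]) (auto simp: R)
    next
      case (flip p z)
      then obtain n where "z \<in> R n" by blast
      then show ?case by (intro UN_I[of "Suc n"]) (use flip in \<open>auto simp: R\<close>)
    qed
  qed
  ultimately show ?thesis by (rule countable_subset[rotated])
qed

end

section \<open>Extension over the fibre of a marked point\<close>

context folded_marked_surface begin

lemma countable_param:
  assumes p: "p \<in> P" and F: "countable F"
  shows "countable {t \<in> {0..1}. inv_into (seg p) (\<phi> p) t \<in> F}"
proof (rule countable_subset)
  show "{t \<in> {0..1}. inv_into (seg p) (\<phi> p) t \<in> F} \<subseteq> \<phi> p ` F"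
    using inv_\<phi>(2)[OF p] by (force simp: image_iff)
qed (use F in simp)

text \<open>Both neighbourhood conditions are relatively open in the parameter, so they hold for
  uncountably many parameters, of which only countably many lead into \<open>F\<close>. It
  transports the sign rule to points of the fibre.\<close>

lemma seg_dense_off_countable:
  assumes p: "p \<in> P" "y \<in> seg p" and F: "countable F"
    and N: "openin Y N" "y \<in> N" and N': "openin Y N'" "fl p y \<in> N'"
  obtains z where "z \<in> seg p" "z \<in> N" "fl p z \<in> N'" "z \<notin> F"
proof -
  let ?i = "inv_into (seg p) (\<phi> p)"
  define G where "G = {t \<in> {0..1}. ?i t \<in> N} \<inter> {t \<in> {0..1}. ?i (1 - t) \<in> N'}"
  have rev: "continuous_map (top_of_set {0..1}) Y (?i \<circ> (\<lambda>t. 1 - t))"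
    by (rule continuous_map_compose[OF _ continuous_\<phi>_inv[OF p(1)]])
      (auto simp: continuous_map_in_subtopology intro!: continuous_intros)
  have "openin (top_of_set {0..1}) G"
    unfolding G_def
    using openin_continuous_map_preimage[OF rev N'(1)] openin_continuous_map_preimage[OF continuous_\<phi>_inv[OF p(1)] N(1)]
    by (intro openin_Int) (auto simp: o_def)
  moreover have "\<phi> p y \<in> G"
    using \<phi>_range[OF p] inv_\<phi>(3)[OF p] N(2) N'(2) unfolding G_def flip_def by auto
  ultimately have "uncountable G" by (rule uncountable_openin_unit_interval)
  then have "\<not> G \<subseteq> {t \<in> {0..1}. ?i t \<in> F}"
    using countable_param[OF p(1) F] countable_subset by blast
  then obtain t where t: "t \<in> G" "?i t \<notin> F" unfolding G_def by blast
  show thesis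
  proof (rule that[of "?i t"])
    show "?i t \<in> seg p" "?i t \<in> N" "?i t \<notin> F"
      using t inv_\<phi>[OF p(1)] by (auto simp: G_def)
    show "fl p (?i t) \<in> N'"
      using t inv_\<phi>(2)[OF p(1), of t] by (auto simp: G_def flip_def)
  qed
qed

text \<open>Around a point of the fibre \<open>F\<close> the sign function is constant off
  \<open>F\<close>, because a small neighbourhood minus \<open>F\<close> is connected; that constant
  becomes the value at the point. Consistency of these values and the sign rule are inherited from
  nearby points off \<open>F\<close>.\<close>

lemma splits_fill_point:
  assumes m: "m \<in> topspace X" "m \<in> W" "openin X W" and S: "splits (W - {m})"
  shows "splits W"
proof -
  obtain s where s: "alternating (W - {m}) s" "\<forall>y\<in>pre (W - {m}). (s y)\<^sup>2 = 1"
    using S unfolding splits_def by blast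
  have cs: "continuous_map (subtopology Y (pre (W - {m}))) euclidean s"
    using s(1) by (simp add: alternating_def)
  define F where "F = pre {m}"
  have F: "countable F"
  proof -
    obtain y0 where "y0 \<in> topspace Y" "q y0 = m" using q_surj m(1) by blast
    then show ?thesis using countable_fibre[of y0] by (simp add: F_def)
  qed
  have pW: "openin Y (pre W)" using openin_continuous_map_preimage[OF continuous_q m(3)] .
  \<comment> \<open>Neighbourhood and constant are packed into one pair \<open>h\<close>, so that a
    single choice over \<open>F\<close> provides both.\<close>
  have "\<exists>h. openin Y (fst h) \<and> y \<in> fst h \<and> fst h \<subseteq> pre W \<and> (snd h)\<^sup>2 = 1 \<and> (\<forall>z\<in>fst h - F. s z = snd h)"
    if y: "y \<in> F" for y
  proof -
    have yY: "y \<in> topspace Y" "y \<in> pre W" using y m by (auto simp: F_def)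
    obtain U f where "surface_chart Y U f" "y \<in> U" using chart_Y yY by blast
    then obtain N where N: "openin Y N" "y \<in> N" "N \<subseteq> pre W" "connectedin Y (N - F)"
      using surface_local_connected_diff_countable[OF _ _ pW yY(2) F] by blast
    have sub: "N - F \<subseteq> pre (W - {m})" using N(3) by (auto simp: F_def)
    have "continuous_map (subtopology Y (N - F)) euclidean s"
      using cs sub by (rule continuous_map_from_subtopology_mono)
    moreover have "(s z)\<^sup>2 = 1" if "z \<in> N - F" for z using s(2) sub that by blast
    ultimately obtain c where "c\<^sup>2 = 1" "\<And>z. z \<in> N - F \<Longrightarrow> s z = c"
      using connected_sign_constant[OF N(4)] by blast
    then show ?thesis using N by (intro exI[of _ "(N, c)"]) auto
  qed
  then have "\<exists>h. \<forall>y\<in>F. openin Y (fst (h y)) \<and> y \<in> fst (h y) \<and> fst (h y) \<subseteq> pre W \<and> (snd (h y))\<^sup>2 = 1 \<and>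
      (\<forall>z\<in>fst (h y) - F. s z = snd (h y))"
    by (intro bchoice ballI)
  then obtain h where h: "\<forall>y\<in>F. openin Y (fst (h y)) \<and> y \<in> fst (h y) \<and> fst (h y) \<subseteq> pre W \<and> (snd (h y))\<^sup>2 = 1 \<and>
      (\<forall>z\<in>fst (h y) - F. s z = snd (h y))" ..
  define N where "N y = fst (h y)" for y
  define c where "c y = snd (h y)" for y
  have N: "openin Y (N y)" "y \<in> N y" "N y \<subseteq> pre W" "(c y)\<^sup>2 = 1" if "y \<in> F" for y
    using h that by (auto simp: N_def c_def)
  have c: "(c y)\<^sup>2 = 1" "z \<in> N y \<Longrightarrow> z \<notin> F \<Longrightarrow> s z = c y" if "y \<in> F" for y z
    using h that by (auto simp: N_def c_def)
  define s' where "s' y = (if y \<in> F then c y else s y)" for y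
  have s': "s' z = c y" if y: "y \<in> F" and z: "z \<in> N y" for y z
  proof (cases "z \<in> F")
    case True
    have "z \<in> topspace Y" using True by (simp add: F_def)
    then obtain U f where "surface_chart Y U f" "z \<in> U" using chart_Y by blast
    \<comment> \<open>The overlap is uncountable, so it leaves \<open>F\<close>, and there both
      constants equal \<open>s\<close>.\<close>
    moreover have "openin Y (N z \<inter> N y)" "z \<in> N z \<inter> N y" using N True y z by auto
    ultimately have "uncountable (N z \<inter> N y)" by (rule surface_open_uncountable)
    then have "\<not> N z \<inter> N y \<subseteq> F" using F countable_subset by blast
    then obtain w where "w \<in> N z" "w \<in> N y" "w \<notin> F" by blast
    then have "c z = c y" using c(2)[OF True, of w] c(2)[OF y, of w] by simp
    then show ?thesis using True by (simp add: s'_def)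
  qed (use c(2) y z in \<open>auto simp: s'_def\<close>)
  have Fc: "closedin Y F"
    unfolding F_def using closedin_continuous_map_preimage[OF continuous_q, of "{m}"]
      closedin_Hausdorff_singleton[OF Hausdorff_X m(1)] by simp
  have "continuous_map (subtopology Y (pre W)) euclidean s'"
  proof (rule pasting_lemma[where I = "insert (pre W - F, s) ((\<lambda>y. (N y, \<lambda>_. c y)) ` F)" and T = fst and f = snd])
    fix i assume i: "i \<in> insert (pre W - F, s) ((\<lambda>y. (N y, \<lambda>_. c y)) ` F)"
    then consider "i = (pre W - F, s)" | y where "y \<in> F" "i = (N y, \<lambda>_. c y)" by blast
    then have "openin Y (fst i)" "fst i \<subseteq> pre W"
      using pW Fc N(1,3) by (cases, simp add: openin_diff, simp, cases, simp, metis fst_conv)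
    then show "openin (subtopology Y (pre W)) (fst i)"
      using openin_subset_topspace_eq openin_open_subtopology[OF pW] by simp
    show "continuous_map (subtopology (subtopology Y (pre W)) (fst i)) euclidean (snd i)"
    proof (cases "i = (pre W - F, s)")
      case True
      have "pre W \<inter> (pre W - F) = pre (W - {m})" by (auto simp: F_def)
      then show ?thesis using True cs by (simp add: subtopology_subtopology)
    next
      case False
      then show ?thesis using i by auto
    qed
  next
    fix i j y
    assume i: "i \<in> insert (pre W - F, s) ((\<lambda>y. (N y, \<lambda>_. c y)) ` F)"
      and j: "j \<in> insert (pre W - F, s) ((\<lambda>y. (N y, \<lambda>_. c y)) ` F)"
      and y: "y \<in> topspace (subtopology Y (pre W)) \<inter> fst i \<inter> fst j"
    have *: "snd i y = s' y" if "i \<in> insert (pre W - F, s) ((\<lambda>y. (N y, \<lambda>_. c y)) ` F)" "y \<in> fst i" for i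
    proof (cases "i = (pre W - F, s)")
      case True
      then show ?thesis using that by (auto simp: s'_def)
    next
      case False
      then obtain z where "z \<in> F" "i = (N z, \<lambda>_. c z)" using \<open>i \<in> _\<close> by blast
      then show ?thesis using that s'[of z y] by simp
    qed
    show "snd i y = snd j y" using *[OF i] *[OF j] y by simp
  next
    fix y assume y: "y \<in> topspace (subtopology Y (pre W))"
    show "\<exists>j. j \<in> insert (pre W - F, s) ((\<lambda>y. (N y, \<lambda>_. c y)) ` F) \<and> y \<in> fst j \<and> s' y = snd j y"
    proof (cases "y \<in> F")
      case True
      then show ?thesis using N(2) by (intro exI[of _ "(N y, \<lambda>_. c y)"]) (auto simp: s'_def)
    next
      case False
      then show ?thesis using y by (intro exI[of _ "(pre W - F, s)"]) (auto simp: s'_def)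
    qed
  qed
  moreover have "s' (fl p y) = - s' y" if p: "p \<in> P" "y \<in> seg p" and yW: "q y \<in> W" for p y
  proof -
    have Y: "y \<in> topspace Y" "fl p y \<in> topspace Y" using p flip_in seg_subset by blast+
    have alt: "s (fl p z) = - s z" if "z \<in> seg p" "q z \<in> W" "z \<notin> F" for z
      using that s(1) p(1) seg_subset[OF p(1)] unfolding alternating_def F_def by auto
    have Ff: "fl p z \<in> F \<longleftrightarrow> z \<in> F" if "z \<in> seg p" for z
      using that q_flip[OF p(1) that] flip_in[OF p(1) that] seg_subset[OF p(1)] by (auto simp: F_def)
    show ?thesis
    proof (cases "y \<in> F")
      case False
      then show ?thesis using alt[OF p(2) yW] Ff[OF p(2)] by (simp add: s'_def)
    next
      case True
      then have True': "fl p y \<in> F" using Ff p(2) by simp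
      \<comment> \<open>A nearby point of the same segment off \<open>F\<close>, where the sign rule
        is already known for \<open>s\<close>.\<close>
      obtain z where z: "z \<in> seg p" "z \<in> N y" "fl p z \<in> N (fl p y)" "z \<notin> F"
        using seg_dense_off_countable[OF p F N(1)[OF True] N(2)[OF True] N(1)[OF True'] N(2)[OF True']] by blast
      have "q z \<in> W" using N(3)[OF True] z by auto
      then have "s (fl p z) = - s z" using alt z by blast
      moreover have "s z = c y" using c(2)[OF True] z by blast
      moreover have "s (fl p z) = c (fl p y)" using c(2)[OF True' z(3)] Ff z by blast
      ultimately show ?thesis using True True' by (simp add: s'_def)
    qed
  qed
  moreover have "(s' y)\<^sup>2 = 1" if "y \<in> pre W" for y
    using that s(2) c(1) by (auto simp: s'_def F_def)
  ultimately show ?thesis unfolding splits_def alternating_def by blast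
qed

lemma splits_marked:
  assumes m: "m \<in> M"
  shows "\<exists>W. openin X W \<and> m \<in> W \<and> splits W"
proof -
  have mX: "m \<in> topspace X" using m M_sub by blast
  obtain U0 f where chart0: "surface_chart X U0 f" "m \<in> U0" "Im (f m) = 0"
    using m M_boundary unfolding surface_boundary_def by blast
  \<comment> \<open>Removing the other special points leaves, apart from \<open>m\<close>, only
    points to which \<open>splits_unmarked\<close> applies.\<close>
  define U where "U = U0 - (P \<union> M - {m})"
  have "closedin X (P \<union> M - {m})"
    using finite_P finite_M M_sub P_sub by (intro closedin_Hausdorff_finite[OF Hausdorff_X]) auto
  then have "openin X U"
    unfolding U_def using surface_chart_inverse(1)[OF chart0(1)] by (rule openin_diff[rotated])
  then have chart: "surface_chart X U f"
    by (rule surface_chart_restrict[OF chart0(1)]) (auto simp: U_def)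
  have mU: "m \<in> U" using chart0 by (simp add: U_def)
  note c = surface_chart_inverse[OF chart]
  obtain r where r: "r > 0" "ball (f m) r \<inter> upper_halfplane \<subseteq> f ` U"
    using half_disc_in_chart[OF chart mU] by blast
  define x0 where "x0 = Re (f m)"
  have fm: "f m = of_real x0" using chart0(3) by (simp add: x0_def complex_eq_iff)
  \<comment> \<open>With r/3 the half-square stays in the disc: its points are at distance at most
    \<open>2 * \<rho>\<close>, which is less than \<open>r\<close>, from \<open>f m\<close>.\<close>
  define \<rho> where "\<rho> = r/3"
  have \<rho>: "\<rho> > 0" "2 * \<rho> < r" using r(1) by (auto simp: \<rho>_def)
  have Q: "cbox (Complex (x0 - \<rho>) 0) (Complex (x0 + \<rho>) \<rho>) \<subseteq> f ` U"
  proof (rule subset_trans[OF _ r(2)], rule subsetI)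
    fix z assume z: "z \<in> cbox (Complex (x0 - \<rho>) 0) (Complex (x0 + \<rho>) \<rho>)"
    have "cmod (f m - z) \<le> \<bar>x0 - Re z\<bar> + \<bar>Im z\<bar>"
      using cmod_le[of "f m - z"] by (simp add: fm)
    also have "\<dots> \<le> 2 * \<rho>" using z by (auto simp: in_cbox_complex_iff)
    finally show "z \<in> ball (f m) r \<inter> upper_halfplane"
      using \<rho> z by (auto simp: dist_norm upper_halfplane_def in_cbox_complex_iff)
  qed
  have S: "splits {x \<in> U. f x \<in> cbox (Complex (x0 - \<rho>) 0) (Complex (x0 + \<rho>) \<rho>) - {of_real x0}}"
  proof (rule splits_punctured_half_square[OF chart \<rho>(1) Q])
    fix x assume "x \<in> U" "f x \<noteq> of_real x0"
    then have "x \<noteq> m" "x \<notin> P" "x \<notin> M" "x \<in> topspace X" using fm c(5) by (auto simp: U_def)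
    then show "\<exists>W. openin X W \<and> x \<in> W \<and> splits W" using splits_unmarked by blast
  qed
  \<comment> \<open>An open set of the plane whose trace on the half-plane lies in the half-square;
    the lower side is supplied by the half-plane itself.\<close>
  define B where "B = {z. x0 - \<rho> < Re z \<and> Re z < x0 + \<rho> \<and> Im z < \<rho>}"
  have "open B"
    unfolding B_def by (intro open_Collect_conj open_Collect_less continuous_intros)
  define W where "W = {x \<in> U. f x \<in> f ` U \<inter> B}"
  have W: "openin X W" "m \<in> W"
  proof -
    show "openin X W"
      unfolding W_def using \<open>open B\<close> by (intro surface_chart_openin_preimage[OF chart] openin_open_Int)
    show "m \<in> W" using mU \<rho>(1) unfolding W_def B_def by (auto simp: x0_def chart0(3))
  qed
  have "W - {m} \<subseteq> {x \<in> U. f x \<in> cbox (Complex (x0 - \<rho>) 0) (Complex (x0 + \<rho>) \<rho>) - {of_real x0}}"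
  proof
    fix x assume x: "x \<in> W - {m}"
    then have "f x \<noteq> f m" using c(2) mU by (auto simp: W_def inj_on_def)
    moreover have "f ` U \<subseteq> upper_halfplane"
      using chart openin_imp_subset unfolding surface_chart_def by blast
    then have "0 \<le> Im (f x)" using x by (auto simp: W_def upper_halfplane_def)
    ultimately show "x \<in> {x \<in> U. f x \<in> cbox (Complex (x0 - \<rho>) 0) (Complex (x0 + \<rho>) \<rho>) - {of_real x0}}"
      using x fm by (auto simp: W_def B_def in_cbox_complex_iff)
  qed
  then have "splits (W - {m})" by (rule splits_mono[OF S])
  then show ?thesis using splits_fill_point[OF mX W(2,1)] W by blast
qed

lemma splits_locally:
  assumes "x \<in> topspace X" "x \<notin> P"
  shows "\<exists>W. openin X W \<and> x \<in> W \<and> splits W"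
  using splits_marked splits_unmarked assms by (cases "x \<in> M") auto

end

section \<open>The cone points\<close>

text \<open>On a circle around 0 the root is compared with a multiple of \<open>cis (t/2)\<close>:
  the quotient has square 1 and is continuous in \<open>t\<close>, hence constant, yet
  \<open>cis (t/2)\<close> changes sign in one turn.\<close>

lemma no_continuous_sqrt_on_ball:
  assumes "0 < r" "continuous_on (ball 0 r) g" "\<And>z. z \<in> ball 0 r \<Longrightarrow> (g z)\<^sup>2 = (z :: complex)"
  shows False
proof -
  define a where "a = r/2"
  have a: "0 < a" "a < r" using assms(1) by (auto simp: a_def)
  define h where "h t = g (of_real a * cis t) / (of_real (sqrt a) * cis (t/2))" for t
  have in_ball: "of_real a * cis t \<in> ball 0 r" for t using a by (simp add: norm_mult)
  have "continuous_on {0..2*pi} h"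
    unfolding h_def using a in_ball
    by (intro continuous_intros continuous_on_compose2[OF assms(2)]) auto
  moreover have "(h t)\<^sup>2 = 1" for t
  proof -
    have "(h t)\<^sup>2 = of_real a * cis t / (of_real (sqrt a) * cis (t/2))\<^sup>2"
      unfolding h_def power_divide using assms(3)[OF in_ball] by simp
    also have "(of_real (sqrt a) * cis (t/2))\<^sup>2 = of_real a * cis t"
      using a(1) by (simp add: power_mult_distrib power2_eq_square[of "cis _"] cis_mult flip: of_real_power)
    finally show ?thesis using a(1) by simp
  qed
  ultimately obtain c where c: "c\<^sup>2 = 1" "\<And>t. t \<in> {0..2*pi} \<Longrightarrow> h t = c"
    using connected_sign_constant[of euclidean "{0..2*pi}" h] by auto
  have "h 0 = h (2*pi)" using c(2)[of 0] c(2)[of "2*pi"] by simp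
  moreover have "h (2*pi) = - h 0" by (simp add: h_def)
  ultimately have "c = 0" using c(2)[of 0] by simp
  then show False using c(1) by simp
qed

text \<open>A half-disc without its boundary centre is starlike with respect to \<open>a\<close>,
  halfway up, so \<open>F\<close> has a logarithm on it. On a punctured full disc this can fail,
  which is why roots are taken on the cut surface, where the puncture lies on the boundary.\<close>

lemma sqrt_on_punctured_half_disc:
  fixes F :: "complex \<Rightarrow> complex"
  assumes c: "Im c = 0" and r: "0 < r"
    and F: "continuous_on (ball c r \<inter> upper_halfplane - {c}) F"
    and nz: "\<And>z. z \<in> ball c r \<inter> upper_halfplane - {c} \<Longrightarrow> F z \<noteq> 0"
  obtains s where "continuous_on (ball c r \<inter> upper_halfplane - {c}) s"
    "\<And>z. z \<in> ball c r \<inter> upper_halfplane - {c} \<Longrightarrow> (s z)\<^sup>2 = F z"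
proof -
  let ?D = "ball c r \<inter> upper_halfplane"
  define a where "a = c + Complex 0 (r/2)"
  have aD: "a \<in> ?D - {c}"
    using c r by (auto simp: a_def dist_norm upper_halfplane_def complex_norm complex_eq_iff)
  have "starlike (?D - {c})"
    unfolding starlike_def
  proof (intro bexI[OF _ aD] ballI subsetI)
    fix x z assume x: "x \<in> ?D - {c}" and z: "z \<in> closed_segment a x"
    have "convex ?D" using convex_upper_halfplane by (auto intro: convex_Int)
    then have "z \<in> ?D" using closed_segment_subset[of a ?D x] aD x z by blast
    moreover have "z \<noteq> c"
    proof
      assume "z = c"
      then obtain u where u: "0 \<le> u" "u \<le> 1" "c = (1 - u) *\<^sub>R a + u *\<^sub>R x"
        using z by (auto simp: in_segment)
      \<comment> \<open>Both summands are non-negative and add up to 0, so a segment from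
        \<open>a\<close> can meet \<open>c\<close> only in its endpoint \<open>x\<close>.\<close>
      have "Im c = (1 - u) * Im a + u * Im x" by (subst u(3)) simp
      then have "0 = (1 - u) * (r/2) + u * Im x" using c by (simp add: a_def)
      moreover have "0 \<le> u * Im x" using u x by (simp add: upper_halfplane_def)
      moreover have "0 \<le> (1 - u) * (r/2)" using u r by simp
      ultimately have "(1 - u) * (r/2) = 0" by linarith
      then have "u = 1" using r by simp
      then show False using u(3) x by simp
    qed
    ultimately show "z \<in> ?D - {c}" by blast
  qed
  then have "contractible (?D - {c})" by (rule starlike_imp_contractible)
  then obtain l where l: "continuous_on (?D - {c}) l" "\<And>x. x \<in> ?D - {c} \<Longrightarrow> F x = exp (l x)"
    using continuous_logarithm_on_contractible[OF F _ nz] by blast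
  have "(exp (l z / 2))\<^sup>2 = F z" if "z \<in> ?D - {c}" for z
    using l(2)[OF that] by (simp add: exp_double[symmetric])
  moreover have "continuous_on (?D - {c}) (\<lambda>z. exp (l z / 2))"
    using l(1) by (intro continuous_intros) auto
  ultimately show thesis using that by blast
qed

text \<open>The modulus of \<open>s\<close> is the square root of the modulus of \<open>F\<close>,
  which tends to 0 at \<open>c\<close>.\<close>

lemma continuous_on_extend_sqrt_zero:
  fixes s F :: "complex \<Rightarrow> complex"
  assumes s: "continuous_on (D - {c}) s" and F: "continuous_on D F" "F c = 0"
    and sq: "\<And>z. z \<in> D - {c} \<Longrightarrow> (s z)\<^sup>2 = F z"
  shows "continuous_on D (\<lambda>z. if z = c then 0 else s z)"
proof -
  let ?s = "\<lambda>z. if z = c then 0 else s z"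
  have "continuous (at z within D) ?s" if z: "z \<in> D" for z
  proof (cases "z = c")
    case True
    have n: "norm (?s w) = sqrt (norm (F w))" if "w \<in> D" for w
    proof (cases "w = c")
      case False
      then have "norm (F w) = (norm (s w))\<^sup>2" using sq[of w] that by (metis DiffI norm_power singletonD)
      then show ?thesis using False by simp
    qed (simp add: F(2))
    have "continuous (at c within D) (\<lambda>w. sqrt (norm (F w)))"
      using F(1) z True by (intro continuous_intros) (simp add: continuous_on_eq_continuous_within)
    then have "((\<lambda>w. sqrt (norm (F w))) \<longlongrightarrow> 0) (at c within D)"
      by (simp add: continuous_within F(2))
    then have "((\<lambda>w. norm (?s w)) \<longlongrightarrow> 0) (at c within D)"
      by (rule Lim_transform_eventually) (unfold eventually_at_filter, intro always_eventually allI impI, subst n, simp_all)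
    then show ?thesis unfolding True continuous_within by (simp add: tendsto_norm_zero_iff)
  next
    case False
    have "continuous (at z within D - {c}) s"
      using s z False by (simp add: continuous_on_eq_continuous_within)
    then have "continuous (at z within D - {c}) ?s"
      by (rule continuous_transform_within[of _ _ _ 1]) (use z False in auto)
    moreover have "at z within D - {c} = at z within D"
      by (rule at_within_nhd[of _ "- {c}"]) (use False in auto)
    ultimately show ?thesis by simp
  qed
  then show ?thesis by (simp add: continuous_on_eq_continuous_within)
qed

lemma homeomorphic_map_rescale_ball:
  assumes "0 < (r :: real)"
  shows "homeomorphic_map (top_of_set (ball c r)) (top_of_set (ball (0 :: complex) 1)) (\<lambda>z. (z - c) / of_real r)"
proof -
  have "homeomorphic_maps (top_of_set (ball c r)) (top_of_set (ball 0 1))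
      (\<lambda>z. (z - c) / of_real r) (\<lambda>w. c + of_real r * w)"
    using assms unfolding homeomorphic_maps_def
    by (auto simp: continuous_map_in_subtopology dist_norm norm_divide norm_mult norm_minus_commute
        intro!: continuous_intros)
  then show ?thesis by (metis homeomorphic_map_maps)
qed

section \<open>The square root coordinate at a puncture\<close>

context folded_marked_surface begin

text \<open>The root \<open>k0\<close> picks up a sign \<open>e\<close> under the folding, the same
  for all parameters near 1/2. Most of the work is shrinking the neighbourhood until this one sign
  governs every flip over it.\<close>

lemma cone_chart:
  assumes p: "p \<in> P" and G: "openin X G" "p \<in> G"
  obtains W f k where "openin X W" "p \<in> W" "W \<subseteq> G"
    "homeomorphic_map (subtopology X W) (top_of_set (ball (0::complex) 1)) f" "f p = 0"
    "alternating W k" "\<And>y. y \<in> pre W \<Longrightarrow> (k y)\<^sup>2 = f (q y)"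
proof -
  obtain U2 f2 where chart2: "surface_chart X U2 f2" "p \<in> U2" using chart_X P_sub p by blast
  define U where "U = U2 \<inter> G"
  have chart: "surface_chart X U f2"
    using surface_chart_inverse(1)[OF chart2(1)] G by (intro surface_chart_restrict[OF chart2(1)]) (auto simp: U_def)
  note c = surface_chart_inverse[OF chart]
  have pU: "p \<in> U" using chart2 G by (simp add: U_def)
  have H: "f2 ` U \<subseteq> upper_halfplane"
    using chart openin_imp_subset unfolding surface_chart_def by blast
  define c0 where "c0 = f2 p"
  \<comment> \<open>A point sent to the real line by some chart is a boundary point, which punctures
    are not; so a full disc around \<open>c0\<close> fits into the half-plane.\<close>
  have "Im c0 \<noteq> 0"
    using P_interior p chart2 unfolding surface_interior_def surface_boundary_def c0_def by blast
  moreover have "0 \<le> Im c0" using H pU by (auto simp: upper_halfplane_def c0_def)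
  ultimately have c0: "0 < Im c0" by simp

  define b where "b = ctr p"
  have b: "b \<in> seg p" "\<phi> p b = 1/2" "q b = p" "fl p b = b" "b \<in> topspace Y"
    using ctr[OF p] seg_subset[OF p] by (auto simp: b_def)
  have fib: "y = b" if "y \<in> topspace Y" "q y = p" for y
    using fibre_ctr[OF p] that unfolding b_def by blast
  obtain V1 g1 where chart1: "surface_chart Y V1 g1" "b \<in> V1" "Im (g1 b) = 0"
    using seg_boundary[OF p] b(1) unfolding surface_boundary_def by blast
  define V where "V = V1 \<inter> pre U"
  have preU: "openin Y (pre U)" using openin_continuous_map_preimage[OF continuous_q c(1)] .
  then have chartV: "surface_chart Y V g1"
    using surface_chart_inverse(1)[OF chart1(1)] by (intro surface_chart_restrict[OF chart1(1)]) (auto simp: V_def)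
  have bV: "b \<in> V" using chart1 b pU by (simp add: V_def)
  note cV = surface_chart_inverse[OF chartV]
  obtain r where r: "r > 0" "ball (g1 b) r \<inter> upper_halfplane \<subseteq> g1 ` V"
    using half_disc_in_chart[OF chartV bV] by blast
  define D where "D = ball (g1 b) r \<inter> upper_halfplane"
  have HV: "g1 ` V \<subseteq> upper_halfplane"
    using chartV openin_imp_subset unfolding surface_chart_def by blast
  have DV: "D \<subseteq> g1 ` V" "D = g1 ` V \<inter> ball (g1 b) r" "g1 b \<in> D"
    using r HV bV unfolding D_def by auto
  define N where "N = {y \<in> V. g1 y \<in> D}"
  have N: "openin Y N"
    unfolding N_def DV(2) by (rule surface_chart_openin_preimage[OF chartV]) (simp add: openin_open_Int)
  have bN: "b \<in> N" and NU: "N \<subseteq> pre U" using bV DV by (auto simp: N_def V_def)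
  \<comment> \<open>The coordinate at \<open>p\<close>, pulled back to the half-disc
    \<open>D\<close>; it vanishes only at \<open>g1 b\<close>, as \<open>b\<close> is the only point
    over \<open>p\<close>.\<close>
  define F where "F z = f2 (q (inv_into V g1 z)) - c0" for z
  have "continuous_map (top_of_set D) (subtopology Y (pre U)) (inv_into V g1)"
    using continuous_map_from_subtopology_mono[OF cV(4) DV(1)] inv_into_into[of _ g1 V] DV(1)
    by (auto simp: continuous_map_in_subtopology V_def)
  moreover have "continuous_map (subtopology Y (pre U)) (subtopology X U) q"
    using quotient_imp_continuous_map[OF quotient_map_pre] .
  ultimately have "continuous_map (top_of_set D) euclidean (f2 \<circ> (q \<circ> inv_into V g1))"
    using c(3) by (intro continuous_map_compose)
  then have contF: "continuous_on D F"
    unfolding F_def by (auto simp: o_def intro!: continuous_intros)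
  have Fg: "F (g1 y) = f2 (q y) - c0" if "y \<in> N" for y
    using that cV(2) by (simp add: F_def N_def)
  have inj2: "f2 (q y) = c0 \<longleftrightarrow> y = b" if "y \<in> N" for y
    using that NU c(2) pU fib b(3) unfolding c0_def by (auto simp: inj_on_def)
  have Nz: "F z \<noteq> 0" if z: "z \<in> D - {g1 b}" for z
  proof -
    obtain y where y: "y \<in> V" "z = g1 y" using z DV(1) by blast
    then have "y \<in> N" "y \<noteq> b" using z by (auto simp: N_def)
    then show ?thesis using inj2 Fg y by simp
  qed
  have Fb: "F (g1 b) = 0" using Fg[OF bN] b(3) by (simp add: c0_def)
  have contF': "continuous_on (D - {g1 b}) F" by (rule continuous_on_subset[OF contF]) auto
  obtain s where s: "continuous_on (D - {g1 b}) s" "\<And>z. z \<in> D - {g1 b} \<Longrightarrow> (s z)\<^sup>2 = F z"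
    using sqrt_on_punctured_half_disc[OF chart1(3) r(1) contF'[unfolded D_def] Nz[unfolded D_def]]
    unfolding D_def by blast
  define s' where "s' z = (if z = g1 b then 0 else s z)" for z
  have s': "continuous_on D s'" "\<And>z. z \<in> D \<Longrightarrow> (s' z)\<^sup>2 = F z"
    unfolding s'_def using continuous_on_extend_sqrt_zero[OF s(1) contF Fb s(2)] s(2) Fb by auto
  define k0 where "k0 y = s' (g1 y)" for y
  have k0: "(k0 y)\<^sup>2 = f2 (q y) - c0" if "y \<in> N" for y
    using that s'(2) Fg unfolding k0_def N_def by auto
  have k0c: "continuous_map (subtopology Y N) euclidean k0"
  proof -
    have "continuous_map (subtopology Y N) (top_of_set D) g1"
      using continuous_map_from_subtopology_mono[OF cV(3), of N]
      by (auto simp: continuous_map_in_subtopology N_def)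
    then have "continuous_map (subtopology Y N) euclidean (s' \<circ> g1)"
      using s'(1) by (intro continuous_map_compose) auto
    then show ?thesis by (simp add: k0_def[abs_def] o_def)
  qed

  let ?i = "inv_into (seg p) (\<phi> p)"
  have "openin (top_of_set {0..1}) {t \<in> topspace (top_of_set {0..1}). ?i t \<in> N}"
    by (rule openin_continuous_map_preimage[OF continuous_\<phi>_inv[OF p] N])
  moreover have "1/2 \<in> {t \<in> topspace (top_of_set {0..1}). ?i t \<in> N}"
    using bN by (simp add: b_def ctr_def)
  ultimately obtain \<delta> where \<delta>: "\<delta> > 0" "ball (1/2) \<delta> \<inter> {0..1} \<subseteq> {t \<in> topspace (top_of_set {0..1}). ?i t \<in> N}"
    unfolding openin_contains_ball by blast
  have inN: "?i t \<in> N" if "t \<in> ball (1/2) \<delta>" "t \<in> {0..1}" for t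
    using \<delta>(2) that by blast
  define R where "R = (\<Union>p'\<in>P-{p}. seg p')"
  have R: "closedin Y R" unfolding R_def
    by (rule closedin_Union) (use finite_P closedin_seg_all in auto)
  have bR: "b \<notin> R"
  proof
    assume "b \<in> R"
    then obtain p' where "p' \<in> P" "p' \<noteq> p" "b \<in> seg p'" by (auto simp: R_def)
    then have "q b \<in> M" using seg_seg[OF p, of p' b b] b by auto
    then show False using b(3) p M_P by auto
  qed
  \<comment> \<open>Of all segments, only the part of \<open>seg p\<close> with parameter
    \<delta>-close to 1/2 can meet \<open>O'\<close>.\<close>
  define O' where "O' = N - R - {y \<in> seg p. \<phi> p y \<in> - ball (1/2) \<delta>}"
  have "closedin Y {y \<in> seg p. \<phi> p y \<in> - ball (1/2) \<delta>}"
    by (rule closedin_seg[OF p]) (simp only: open_ball closed_open double_complement)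
  then have O': "openin Y O'" unfolding O'_def using N R by (blast intro: openin_diff)
  have "\<phi> p b \<in> ball (1/2) \<delta>" unfolding b(2) using \<delta>(1) by simp
  then have "pre {p} \<subseteq> O'"
    unfolding fibre_ctr[OF p] O'_def b_def[symmetric] using bN bR by blast
  moreover have "p \<in> topspace X" using P_sub p by blast
  ultimately obtain W0 where W0: "openin X W0" "p \<in> W0" "pre W0 \<subseteq> O'"
    using fibre_neighbourhood[OF O', of p] by blast
  have "surface_chart X (U \<inter> W0) f2"
    using c(1) W0(1) by (intro surface_chart_restrict[OF chart]) auto
  then obtain r1 where r1: "r1 > 0" "ball c0 r1 \<inter> upper_halfplane \<subseteq> f2 ` (U \<inter> W0)"
    using half_disc_in_chart[of X "U \<inter> W0" f2 p] pU W0(2) unfolding c0_def by blast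
  \<comment> \<open>Bounded by \<open>Im c0\<close> to keep the disc inside the half-plane, and by
    \<open>r1\<close> to keep it in the image of \<open>U \<inter> W0\<close>.\<close>
  define \<rho> where "\<rho> = min r1 (Im c0)"
  have \<rho>: "\<rho> > 0" using r1(1) c0 by (simp add: \<rho>_def)
  have "z \<in> upper_halfplane" if "z \<in> ball c0 \<rho>" for z
  proof -
    have "Im (c0 - z) < Im c0"
      using order_trans[OF abs_ge_self abs_Im_le_cmod, of "c0 - z"] that by (simp add: \<rho>_def dist_norm)
    then show ?thesis by (simp add: upper_halfplane_def)
  qed
  moreover have "ball c0 \<rho> \<subseteq> ball c0 r1" by (simp add: \<rho>_def subset_ball)
  ultimately have ballW: "ball c0 \<rho> \<subseteq> f2 ` (U \<inter> W0)" using r1(2) by blast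
  then have ballU: "ball c0 \<rho> \<subseteq> f2 ` U" by blast
  define W where "W = {x \<in> U. f2 x \<in> ball c0 \<rho>}"
  have W: "openin X W"
    unfolding W_def using ballU
    by (intro surface_chart_openin_preimage[OF chart]) (simp add: openin_open_eq openin_subset open_subset)
  have pW: "p \<in> W" using pU \<rho> by (simp add: W_def c0_def)
  have WW0: "W \<subseteq> W0"
  proof
    fix x assume x: "x \<in> W"
    then have "x \<in> U" "f2 x \<in> f2 ` (U \<inter> W0)" using ballW by (auto simp: W_def)
    then show "x \<in> W0" using inj_on_image_mem_iff[OF c(2), of x "U \<inter> W0"] by simp
  qed
  have preW: "pre W \<subseteq> O'" using W0(3) WW0 by blast
  have WU: "W \<subseteq> U" by (auto simp: W_def)
  have chartW: "surface_chart X W f2" by (rule surface_chart_restrict[OF chart W WU])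
  have f2W: "f2 ` W = ball c0 \<rho>" using ballU unfolding W_def by blast

  \<comment> \<open>Only one side of 1/2: this set is connected and avoids the centre, where
    \<open>k0\<close> vanishes.\<close>
  define J :: "real set" where "J = ball (1/2) \<delta> \<inter> {1/2<..1}"
  have J: "connected J" unfolding J_def by (intro convex_connected convex_Int) auto
  have J1: "?i t \<in> N" "?i (1 - t) \<in> N" "?i t \<noteq> b" "?i (1 - t) \<noteq> b" "q (?i (1 - t)) = q (?i t)" if "t \<in> J" for t
  proof -
    have t: "t \<in> {0..1}" "1 - t \<in> {0..1}" "t \<in> ball (1/2) \<delta>" "1 - t \<in> ball (1/2) \<delta>" "t > 1/2"
      using that by (auto simp: J_def dist_real_def)
    show "?i t \<in> N" "?i (1 - t) \<in> N" using t inN by auto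
    show "?i t \<noteq> b" "?i (1 - t) \<noteq> b" using inv_\<phi>(2)[OF p] t b(2) by (metis atLeastAtMost_iff less_irrefl, fastforce)
    have "fl p (?i t) = ?i (1 - t)" using inv_\<phi>(2)[OF p] t by (simp add: flip_def)
    then show "q (?i (1 - t)) = q (?i t)" using q_flip[OF p inv_\<phi>(1)[OF p]] t by (metis atLeastAtMost_iff)
  qed
  \<comment> \<open>Numerator and denominator have the same square, so the quotient is a
    sign.\<close>
  define h where "h t = k0 (?i t) / k0 (?i (1 - t))" for t
  have k0nz: "k0 y \<noteq> 0" if "y \<in> N" "y \<noteq> b" for y
    using k0[OF that(1)] inj2[OF that(1)] that(2) by auto
  have hsq: "(h t)\<^sup>2 = 1" if "t \<in> J" for t
    using J1[OF that] inj2[OF J1(1)[OF that]] k0 by (simp add: h_def power_divide)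
  have "continuous_on J h"
  proof -
    have i: "continuous_map (top_of_set {0..1}) Y ?i" by (rule continuous_\<phi>_inv[OF p])
    have J01: "J \<subseteq> {0..1}" by (auto simp: J_def)
    have "continuous_map (top_of_set J) (subtopology Y N) ?i"
      using continuous_map_from_subtopology_mono[OF i J01] J1 by (auto simp: continuous_map_in_subtopology)
    from continuous_map_compose[OF this k0c]
    have 1: "continuous_on J (k0 \<circ> ?i)" by simp
    have "continuous_map (top_of_set J) (top_of_set {0..1}) (\<lambda>t. 1 - t)"
      using J01 by (auto simp: continuous_map_in_subtopology intro!: continuous_intros)
    from continuous_map_compose[OF this i]
    have "continuous_map (top_of_set J) (subtopology Y N) (?i \<circ> (\<lambda>t. 1 - t))"
      using J1(2) by (simp add: continuous_map_in_subtopology image_subset_iff)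
    from continuous_map_compose[OF this k0c]
    have 2: "continuous_on J (k0 \<circ> (?i \<circ> (\<lambda>t. 1 - t)))" by simp
    show ?thesis
      unfolding h_def using 1 2 k0nz J1 by (auto simp: o_def intro!: continuous_on_divide)
  qed
  then obtain e where e: "e\<^sup>2 = 1" "\<And>t. t \<in> J \<Longrightarrow> h t = e"
    using connected_sign_constant[of euclidean J h] J hsq by auto
  have sgn: "k0 (fl p y) = e * k0 y" if y: "y \<in> seg p" "\<phi> p y \<in> ball (1/2) \<delta>" for y
  proof -
    have r: "\<phi> p y \<in> {0..1}" using \<phi>_range[OF p y(1)] by simp
    have iy: "?i (\<phi> p y) = y" using inv_\<phi>(3)[OF p y(1)] .
    have flp: "fl p y = ?i (1 - \<phi> p y)" by (simp add: flip_def)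
    have rel: "k0 (?i t) = e * k0 (?i (1 - t))" if "t \<in> J" for t
      using e(2)[OF that] k0nz J1[OF that] by (simp add: h_def divide_eq_eq)
    \<comment> \<open>At the centre \<open>k0\<close> is 0. Above 1/2 the relation is inverted by
      means of \<open>e\<^sup>2 = 1\<close>; below 1/2 it applies directly.\<close>
    consider "\<phi> p y = 1/2" | "\<phi> p y \<in> J" | "1 - \<phi> p y \<in> J"
      using y(2) r by (fastforce simp: J_def dist_real_def)
    then show ?thesis
    proof cases
      case 1
      then have "y = b" using iy unfolding b_def ctr_def by (simp only:)
      then show ?thesis using b(4) by (simp add: k0_def s'_def)
    next
      case 2
      then have "k0 y = e * k0 (fl p y)" using rel iy flp by metis
      then have "e * k0 y = e\<^sup>2 * k0 (fl p y)" by (simp add: power2_eq_square)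
      then show ?thesis using e(1) by simp
    next
      case 3
      then show ?thesis using rel[OF 3] iy flp by simp
    qed
  qed
  have seg_cases: "p' = p \<and> \<phi> p y \<in> ball (1/2) \<delta>" if "p' \<in> P" "y \<in> seg p'" "q y \<in> W" for p' y
  proof -
    have "y \<in> O'" using that seg_subset preW by blast
    then show ?thesis using that by (auto simp: O'_def R_def)
  qed
  have k0W: "continuous_map (subtopology Y (pre W)) euclidean k0"
    by (rule continuous_map_from_subtopology_mono[OF k0c]) (use preW in \<open>auto simp: O'_def\<close>)
  have preN: "y \<in> N" if "y \<in> pre W" for y using that preW by (auto simp: O'_def)
  \<comment> \<open>otherwise \<open>k0\<close> would descend to a square root of the coordinate on a disc around \<open>p\<close>\<close>
  have "e \<noteq> 1"
  proof
    assume "e = 1"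
    then have "k0 (fl p' y) = k0 y" if "p' \<in> P" "y \<in> seg p'" "q y \<in> W" for p' y
      using sgn[of y] seg_cases[OF that] that by auto
    then obtain g where g: "continuous_map (subtopology X W) euclidean g"
      "\<And>y. y \<in> topspace Y \<Longrightarrow> q y \<in> W \<Longrightarrow> g (q y) = k0 y"
      using descend[OF k0W] by blast
    have gsq: "(g x)\<^sup>2 = f2 x - c0" if "x \<in> W" for x
    proof -
      have "x \<in> topspace X" using that WU c(5) by blast
      then obtain y where "y \<in> topspace Y" "q y = x" using q_surj by blast
      then show ?thesis using g(2)[of y] k0[OF preN, of y] that by simp
    qed
    define G' where "G' z = g (inv_into W f2 (z + c0))" for z
    have "continuous_on (ball c0 \<rho>) (g \<circ> inv_into W f2)"
      using continuous_map_compose[OF surface_chart_inverse(6)[OF chartW] g(1)] f2W by simp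
    then have "continuous_on (ball 0 \<rho>) ((g \<circ> inv_into W f2) \<circ> (\<lambda>z. z + c0))"
      by (intro continuous_on_compose continuous_intros)
        (auto elim!: continuous_on_subset simp: dist_norm)
    then have "continuous_on (ball 0 \<rho>) G'" by (simp add: G'_def[abs_def] o_def)
    moreover have "(G' z)\<^sup>2 = z" if "z \<in> ball 0 \<rho>" for z
    proof -
      have "z + c0 \<in> f2 ` W" using that unfolding f2W by (simp add: dist_norm)
      then show ?thesis using gsq[of "inv_into W f2 (z + c0)"]
        by (simp add: G'_def inv_into_into f_inv_into_f)
    qed
    ultimately show False using no_continuous_sqrt_on_ball[OF \<rho>] by blast
  qed
  then have e: "e = -1" using e(1) by (simp add: power2_eq_1_iff)

  define f where "f x = (f2 x - c0) / of_real \<rho>" for x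
  \<comment> \<open>The factor turns a root of \<open>f2 - c0\<close> into a root of
    \<open>f\<close>, which is rescaled to the unit disc.\<close>
  define k where "k y = k0 y * (1 / of_real (sqrt \<rho>))" for y
  have "homeomorphic_map (subtopology X W) (top_of_set (ball 0 1)) ((\<lambda>z. (z - c0) / of_real \<rho>) \<circ> f2)"
    using chartW homeomorphic_map_rescale_ball[OF \<rho>, of c0] homeomorphic_map_compose
    unfolding surface_chart_def f2W by blast
  then have "homeomorphic_map (subtopology X W) (top_of_set (ball 0 1)) f"
    by (simp add: f_def[abs_def] o_def)
  moreover have "f p = 0" by (simp add: f_def c0_def)
  moreover have "alternating W k"
    unfolding alternating_def
  proof (intro conjI ballI impI)
    show "continuous_map (subtopology Y (pre W)) euclidean k"
      unfolding k_def by (intro continuous_map_mult k0W) simp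
    fix p' y assume "p' \<in> P" "y \<in> seg p'" "q y \<in> W"
    then show "k (fl p' y) = - k y"
      using sgn[of y] seg_cases[of p' y] e by (simp add: k_def)
  qed
  moreover have "(k y)\<^sup>2 = f (q y)" if "y \<in> pre W" for y
    using k0[OF preN[OF that]] \<rho> by (simp add: k_def f_def power_divide flip: of_real_power)
  moreover have "W \<subseteq> G" using WU by (auto simp: U_def)
  ultimately show thesis using that W pW by blast
qed

end

section \<open>The double and its projection\<close>

lemma proper_map_eq:
  assumes "proper_map T Z f" "\<And>x. x \<in> topspace T \<Longrightarrow> f x = g x"
  shows "proper_map T Z g"
  unfolding proper_map_def closed_map_def
proof (intro conjI allI impI ballI)
  fix C assume C: "closedin T C"
  then have "g ` C = f ` C"
    using assms(2) closedin_subset[OF C] by (intro image_cong) (auto simp: subset_iff)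
  then show "closedin Z (g ` C)" using assms(1) C by (simp add: proper_map_def closed_map_def)
next
  fix z assume "z \<in> topspace Z"
  moreover have "{x \<in> topspace T. g x = z} = {x \<in> topspace T. f x = z}" using assms(2) by auto
  ultimately show "compactin T {x \<in> topspace T. g x = z}" using assms(1) by (simp add: proper_map_def)
qed

lemma topspace_two_copies: "topspace (two_copies T) = UNIV \<times> topspace T"
  by (auto simp: two_copies_def)

lemma continuous_map_two_copies:
  assumes "\<And>b. continuous_map T Z (\<lambda>y. g (b, y))"
  shows "continuous_map (two_copies T) Z g"
  unfolding continuous_map_def
proof (intro conjI allI impI)
  show "g \<in> topspace (two_copies T) \<rightarrow> topspace Z"
    using assms by (auto simp: topspace_two_copies continuous_map_def Pi_iff)
  fix V assume V: "openin Z V"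
  have "openin T {y \<in> topspace T. g (b, y) \<in> V}" for b
    using openin_continuous_map_preimage[OF assms V] .
  moreover have "{y. (b, y) \<in> {x \<in> topspace (two_copies T). g x \<in> V}} = {y \<in> topspace T. g (b, y) \<in> V}" for b
    by (auto simp: topspace_two_copies)
  ultimately show "openin (two_copies T) {x \<in> topspace (two_copies T). g x \<in> V}"
    unfolding two_copies_def openin_sum_topology by auto
qed

lemma subtopology_two_copies: "subtopology (two_copies T) (UNIV \<times> S) = two_copies (subtopology T S)"
  unfolding two_copies_def by (rule subtopology_sum_topology)

lemma compact_space_two_copies:
  assumes "compact_space T"
  shows "compact_space (two_copies T)"
proof -
  have "compactin (two_copies T) ((\<lambda>y. (b, y)) ` topspace T)" for b
    using assms image_compactin[OF _ continuous_map_component_injection[of b UNIV "\<lambda>_. T"]]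
    unfolding two_copies_def compact_space_def by simp
  then have "compactin (two_copies T) ((\<lambda>y. (True, y)) ` topspace T \<union> (\<lambda>y. (False, y)) ` topspace T)"
    by (intro compactin_Un)
  moreover have "(\<lambda>y. (True, y)) ` topspace T \<union> (\<lambda>y. (False, y)) ` topspace T = topspace (two_copies T)"
  proof -
    have "(b, y) \<in> (\<lambda>y. (True, y)) ` topspace T \<union> (\<lambda>y. (False, y)) ` topspace T" if "y \<in> topspace T" for b y
      using that by (cases b) auto
    then show ?thesis by (auto simp: topspace_two_copies)
  qed
  ultimately show ?thesis by (simp add: compact_space_def)
qed

section \<open>The double, its projection and the sheet exchange\<close>

context folded_surface begin

abbreviation D :: "(bool \<times> 'b) set topology" where
  "D \<equiv> double_surface P Y seg \<phi>"

definition dclass :: "bool \<times> 'b \<Rightarrow> (bool \<times> 'b) set" where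
  "dclass = identification_class (two_copies Y) (gluing_relation P seg \<phi>)"

definition proj :: "(bool \<times> 'b) set \<Rightarrow> 'a" where
  "proj c = the_elem ((q \<circ> snd) ` c)"

abbreviation over :: "'a set \<Rightarrow> (bool \<times> 'b) set set" where
  "over K \<equiv> {c \<in> topspace D. proj c \<in> K}"

lemma gluing_relation_iff:
  "(u, v) \<in> gluing_relation P seg \<phi> \<longleftrightarrow> (\<exists>p\<in>P. \<exists>y\<in>seg p. u = (True, y) \<and> v = (False, fl p y))"
  by (auto simp: gluing_relation_def gluing_map_def swap_copies_def)

lemma quotient_dclass: "quotient_map (two_copies Y) D dclass"
  unfolding dclass_def double_surface_def by (rule quotient_map_identification_class)

lemma dclass_in: "y \<in> topspace Y \<Longrightarrow> dclass (b, y) \<in> topspace D"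
  using quotient_imp_surjective_map[OF quotient_dclass] by (auto simp: topspace_two_copies)

lemma dclass_cases:
  assumes "c \<in> topspace D"
  obtains b y where "y \<in> topspace Y" "c = dclass (b, y)"
proof -
  have "c \<in> dclass ` topspace (two_copies Y)"
    using assms quotient_imp_surjective_map[OF quotient_dclass] by simp
  then show thesis using that by (auto simp: topspace_two_copies)
qed

lemma dclass_eq_iff:
  assumes "y \<in> topspace Y" "y' \<in> topspace Y"
  shows "dclass (b, y) = dclass (b', y') \<longleftrightarrow>
    equivclp (\<lambda>u v. (u, v) \<in> gluing_relation P seg \<phi>) (b, y) (b', y')"
  unfolding dclass_def
  by (rule identification_class_eq_iff) (use assms in \<open>auto simp: topspace_two_copies\<close>)

text \<open>Crossing a cut changes the sheet. The gluing relation starts on the plus copy only; from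
  the minus copy it is read backwards.\<close>

lemma dclass_flip:
  assumes "p \<in> P" "y \<in> seg p"
  shows "dclass (b, fl p y) = dclass (\<not> b, y)"
proof -
  have Y: "y \<in> topspace Y" "fl p y \<in> topspace Y" using assms flip_in seg_subset by blast+
  show ?thesis
  proof (cases b)
    case True
    have "((True, fl p y), (False, y)) \<in> gluing_relation P seg \<phi>"
      unfolding gluing_relation_iff using assms flip_in flip_flip by metis
    then show ?thesis using True by (subst dclass_eq_iff[OF Y(2,1)]) auto
  next
    case False
    have "((True, y), (False, fl p y)) \<in> gluing_relation P seg \<phi>"
      unfolding gluing_relation_iff using assms by blast
    then show ?thesis using False by (subst dclass_eq_iff[OF Y(2,1)]) auto
  qed
qed

lemma gluing_q: "(u, v) \<in> gluing_relation P seg \<phi> \<Longrightarrow> (q \<circ> snd) u = (q \<circ> snd) v"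
  unfolding gluing_relation_iff using q_flip by auto

lemma proj_dclass: "y \<in> topspace Y \<Longrightarrow> proj (dclass (b, y)) = q y"
  unfolding proj_def dclass_def
  by (subst the_elem_identification_class[OF gluing_q]) (auto simp: topspace_two_copies)

lemma quotient_proj: "quotient_map D X proj"
proof -
  have cont: "continuous_map (two_copies Y) X (q \<circ> snd)"
    by (rule continuous_map_two_copies) (simp add: o_def continuous_q)
  have "closed_map (two_copies Y) X (q \<circ> snd)"
    using continuous_imp_closed_map_gen[OF compact_space_two_copies[OF compact_Y] _ cont]
      Hausdorff_X Hausdorff_imp_kc_space by blast
  moreover have "(q \<circ> snd) ` topspace (two_copies Y) = topspace X"
    using quotient_imp_surjective_map[OF quotient_q]
    by (simp only: topspace_two_copies image_comp[symmetric] snd_image_times) simp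
  ultimately have "quotient_map (two_copies Y) X (q \<circ> snd)"
    using cont by (intro continuous_closed_imp_quotient_map)
  then show ?thesis
    unfolding double_surface_def proj_def[abs_def] by (rule quotient_map_quotient_space) (rule gluing_q)
qed

lemma continuous_proj: "continuous_map D X proj"
  using quotient_proj quotient_imp_continuous_map by blast

text \<open>Properness is recorded, and not just closedness, because it can be cancelled from a
  composition; this is how \<open>cone_over_disc\<close> obtains a closed coordinate.\<close>

lemma proper_proj: "proper_map D X proj"
proof (rule continuous_imp_proper_map)
  show "compact_space D"
    using compact_space_two_copies[OF compact_Y] quotient_dclass
    by (metis compact_space_def image_compactin quotient_imp_continuous_map quotient_imp_surjective_map)
  show "kc_space X" using Hausdorff_X Hausdorff_imp_kc_space by blast
qed (rule continuous_proj)

text \<open>Exchanging the tags reverses the generating relation, again because flips are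
  involutions, and the generated equivalence is symmetric.\<close>

lemma sheet_exchange_dclass:
  assumes y: "y \<in> topspace Y"
  shows "sheet_exchange (dclass (b, y)) = dclass (\<not> b, y)"
proof -
  let ?r = "\<lambda>u v. (u, v) \<in> gluing_relation P seg \<phi>"
  have step: "?r (swap_copies v) (swap_copies u)" if "?r u v" for u v
    using that unfolding gluing_relation_iff swap_copies_def
    using flip_in flip_flip by fastforce
  have sw: "equivclp ?r (swap_copies x) (swap_copies z)" if "equivclp ?r x z" for x z
    using that
  proof (induction rule: equivclp_induct)
    case (step u v)
    then show ?case using \<open>\<And>v u. ?r u v \<Longrightarrow> ?r (swap_copies v) (swap_copies u)\<close> 
      equivclp_into_equivclp[of ?r "swap_copies x" "swap_copies u" "swap_copies v"] by blast
  qed simp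
  have ss: "swap_copies (swap_copies z) = z" for z :: "bool \<times> 'b" by (simp add: swap_copies_def)
  have T: "swap_copies z \<in> topspace (two_copies Y) \<longleftrightarrow> z \<in> topspace (two_copies Y)" for z
    by (cases z) (auto simp: swap_copies_def topspace_two_copies)
  have sb: "swap_copies (b, y) = (\<not> b, y)" by (simp add: swap_copies_def)
  show ?thesis
  proof
    show "sheet_exchange (dclass (b, y)) \<subseteq> dclass (\<not> b, y)"
    proof
      fix z assume "z \<in> sheet_exchange (dclass (b, y))"
      then obtain w where w: "z = swap_copies w" "w \<in> topspace (two_copies Y)" "equivclp ?r (b, y) w"
        unfolding sheet_exchange_def dclass_def identification_class_def by blast
      show "z \<in> dclass (\<not> b, y)"
        using sw[OF w(3)] w(1,2) T unfolding sb dclass_def identification_class_def by simp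
    qed
    show "dclass (\<not> b, y) \<subseteq> sheet_exchange (dclass (b, y))"
    proof
      fix z assume "z \<in> dclass (\<not> b, y)"
      then have z: "z \<in> topspace (two_copies Y)" "equivclp ?r (\<not> b, y) z"
        unfolding dclass_def identification_class_def by blast+
      have "swap_copies (\<not> b, y) = (b, y)" by (simp add: swap_copies_def)
      then have "swap_copies z \<in> dclass (b, y)"
        using sw[OF z(2)] z(1) T unfolding dclass_def identification_class_def by simp
      then show "z \<in> sheet_exchange (dclass (b, y))"
        unfolding sheet_exchange_def by (intro image_eqI[of _ _ "swap_copies z"]) (simp_all add: ss)
    qed
  qed
qed

lemma sheet_exchange_in: "c \<in> topspace D \<Longrightarrow> sheet_exchange c \<in> topspace D"
  and sheet_exchange_twice: "c \<in> topspace D \<Longrightarrow> sheet_exchange (sheet_exchange c) = c"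
  and proj_sheet_exchange: "c \<in> topspace D \<Longrightarrow> proj (sheet_exchange c) = proj c"
  by (elim dclass_cases, simp add: sheet_exchange_dclass dclass_in proj_dclass)+

text \<open>A flip in the fibre of \<open>q\<close> changes the tag, so the induction follows both
  tags at once; it never leaves the two classes over the point.\<close>

lemma proj_eq:
  assumes "c \<in> topspace D" "c' \<in> topspace D" "proj c = proj c'"
  shows "c' = c \<or> c' = sheet_exchange c"
proof -
  obtain b y where y: "y \<in> topspace Y" "c = dclass (b, y)" using assms(1) by (rule dclass_cases)
  obtain b' y' where y': "y' \<in> topspace Y" "c' = dclass (b', y')" using assms(2) by (rule dclass_cases)
  have "q y = q y'" using assms(3) y y' by (simp add: proj_dclass)
  with y(1) y'(1) have "\<forall>b. dclass (b, y') \<in> {dclass (True, y), dclass (False, y)}"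
  proof (induction rule: fibre_induct)
    case base
    show ?case by (simp add: all_bool_eq)
  next
    case (flip p z)
    then show ?case using dclass_flip[of p z] by simp
  qed
  then show ?thesis
    unfolding y y' sheet_exchange_dclass[OF y(1)] by (cases b) auto
qed

lemma the_elem_proj_orbit:
  assumes "c \<in> topspace D"
  shows "the_elem (proj ` identification_class D (orbit_relation D {id, sheet_exchange}) c) = proj c"
proof (rule the_elem_identification_class[OF _ assms])
  show "proj u = proj v" if "(u, v) \<in> orbit_relation D {id, sheet_exchange}" for u v
    using that proj_sheet_exchange by (auto simp: orbit_relation_def)
qed

lemma homeomorphic_map_orbit_space:
  "homeomorphic_map (orbit_space D {id, sheet_exchange}) X (\<lambda>C. the_elem (proj ` C))"
  unfolding orbit_space_def
proof (rule homeomorphic_map_quotient_space[OF quotient_proj])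
  show "proj u = proj v" if "(u, v) \<in> orbit_relation D {id, sheet_exchange}" for u v
    using that proj_sheet_exchange by (auto simp: orbit_relation_def)
  show "equivclp (\<lambda>u v. (u, v) \<in> orbit_relation D {id, sheet_exchange}) c c'"
    if "c \<in> topspace D" "c' \<in> topspace D" "proj c = proj c'" for c c'
  proof -
    have "(c, c') \<in> orbit_relation D {id, sheet_exchange}"
      using proj_eq[OF that]
    proof
      assume "c' = c"
      then show ?thesis
        unfolding orbit_relation_def by (intro CollectI exI[of _ c] exI[of _ id]) (use that in simp)
    next
      assume "c' = sheet_exchange c"
      then show ?thesis
        unfolding orbit_relation_def by (intro CollectI exI[of _ c] exI[of _ sheet_exchange]) (use that in simp)
    qed
    then show ?thesis by (rule r_into_equivclp)
  qed
qed

section \<open>Sheets and root coordinates on the double\<close>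

lemma openin_over: "openin X W \<Longrightarrow> openin D (over W)"
  using openin_continuous_map_preimage[OF continuous_proj] .

text \<open>The function is \<open>g\<close> on the plus copy and its negative on the minus copy;
  that this respects the gluing is the sign rule of \<open>alternating\<close>.\<close>

lemma over_lift:
  assumes W: "openin X W" and g: "alternating W g"
  obtains h where "continuous_map (subtopology D (over W)) euclidean h"
    "\<And>b y. y \<in> pre W \<Longrightarrow> h (dclass (b, y)) = (if b then g y else - g y)"
    "\<And>c. c \<in> over W \<Longrightarrow> h (sheet_exchange c) = - h c"
proof -
  \<comment> \<open>The value 0 off \<open>W\<close> makes \<open>G\<close> respect the gluing
    relation everywhere, as \<open>the_elem_identification_class\<close> demands.\<close>
  define G where "G = (\<lambda>(b, y). if q y \<in> W then (if b then g y else - g y) else 0)"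
  define h where "h c = the_elem (G ` c)" for c
  have G: "G u = G v" if "(u, v) \<in> gluing_relation P seg \<phi>" for u v
    using that q_flip g unfolding gluing_relation_iff G_def alternating_def by auto
  have h: "h (dclass (b, y)) = (if b then g y else - g y)" if "y \<in> pre W" for b y
    unfolding h_def dclass_def
    by (subst the_elem_identification_class[OF G]) (use that in \<open>auto simp: topspace_two_copies G_def\<close>)
  have eq: "{x \<in> topspace (two_copies Y). dclass x \<in> over W} = UNIV \<times> pre W"
    by (auto simp: topspace_two_copies proj_dclass dclass_in)
  have quo: "quotient_map (two_copies (subtopology Y (pre W))) (subtopology D (over W)) dclass"
    using quotient_map_restriction[OF quotient_dclass eq] openin_over[OF W]
    by (simp add: subtopology_two_copies)
  have gc: "continuous_map (subtopology Y (pre W)) euclidean g" using g by (simp add: alternating_def)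
  then have "continuous_map (subtopology Y (pre W)) euclidean (\<lambda>y. - 1 * g y)"
    by (intro continuous_map_mult) auto
  then have "continuous_map (two_copies (subtopology Y (pre W))) euclidean (\<lambda>(b, y). if b then g y else - g y)"
    using gc by (intro continuous_map_two_copies) simp
  then have "continuous_map (two_copies (subtopology Y (pre W))) euclidean (h \<circ> dclass)"
    by (rule continuous_map_eq) (auto simp: topspace_two_copies h)
  then have "continuous_map (subtopology D (over W)) euclidean h"
    by (rule continuous_compose_quotient_map[OF quo])
  moreover have "h (sheet_exchange c) = - h c" if c: "c \<in> over W" for c
  proof -
    obtain b y where y: "y \<in> topspace Y" "c = dclass (b, y)" using c by (blast elim: dclass_cases)
    then have "y \<in> pre W" using c by (simp add: proj_dclass)
    then show ?thesis using y h by (simp add: sheet_exchange_dclass)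
  qed
  ultimately show thesis using that h by blast
qed

text \<open>The sheet is the set where the lifted sign function is 1. It is open and closed over
  \<open>W\<close>, and since the exchange negates the function, it contains exactly one point over
  each point of \<open>W\<close>.\<close>

lemma sheet_over_split:
  assumes W: "openin X W" "splits W"
  obtains V where "openin D V" "sheet_exchange ` V \<inter> V = {}"
    "homeomorphic_map (subtopology D V) (subtopology X W) proj"
proof -
  obtain g where g: "alternating W g" "\<forall>y\<in>pre W. (g y)\<^sup>2 = 1" using W(2) unfolding splits_def by blast
  obtain h where h: "continuous_map (subtopology D (over W)) euclidean h"
    "\<And>b y. y \<in> pre W \<Longrightarrow> h (dclass (b, y)) = (if b then g y else - g y)"
    "\<And>c. c \<in> over W \<Longrightarrow> h (sheet_exchange c) = - h c"
    using over_lift[OF W(1) g(1)] by blast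
  have WX: "W \<subseteq> topspace X" using W(1) openin_subset by blast
  have h1: "h c = 1 \<or> h c = -1" if c: "c \<in> over W" for c
  proof -
    obtain b y where y: "y \<in> topspace Y" "c = dclass (b, y)" using c by (blast elim: dclass_cases)
    then have "y \<in> pre W" using c by (simp add: proj_dclass)
    then have "(h c)\<^sup>2 = 1" using y h(2) g(2) by simp
    then show ?thesis by (simp add: power2_eq_1_iff)
  qed
  define V where "V = {c \<in> over W. h c = 1}"
  have V1: "V = {c \<in> topspace (subtopology D (over W)). h c \<in> {1}}"
    by (auto simp: V_def)
  \<comment> \<open>The disc of radius 1 around 1 misses -1, so the sheet is also an open
    preimage.\<close>
  have "V = {c \<in> topspace (subtopology D (over W)). h c \<in> ball 1 1}"
  proof (intro equalityI subsetI)
    fix c assume c: "c \<in> {c \<in> topspace (subtopology D (over W)). h c \<in> ball 1 1}"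
    then have "h c = 1 \<or> h c = -1" "h c \<in> ball 1 1" using h1[of c] by auto
    then show "c \<in> V" using c by (auto simp: V_def dist_norm)
  qed (auto simp: V_def)
  then have "openin (subtopology D (over W)) V"
    using openin_continuous_map_preimage[OF h(1), of "ball 1 1"] by simp
  then have open_V: "openin D V"
    using openin_over[OF W(1)] openin_trans_full by blast
  have closed_V: "closedin (subtopology D (over W)) V"
    unfolding V1 by (rule closedin_continuous_map_preimage[OF h(1)]) simp
  have "sheet_exchange ` V \<inter> V = {}"
    using h(3) by (auto simp: V_def)
  moreover have "homeomorphic_map (subtopology D V) (subtopology X W) proj"
  proof (rule bijective_closed_imp_homeomorphic_map)
    have "over W \<inter> V = V" by (auto simp: V_def)
    then have subV: "subtopology (subtopology D (over W)) V = subtopology D V"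
      by (simp add: subtopology_subtopology)
    have "closed_map (subtopology D (over W)) (subtopology X W) proj"
      using closed_map_restriction[OF proper_imp_closed_map[OF proper_proj] refl] .
    from closed_map_from_subtopology[OF this closed_V]
    show "closed_map (subtopology D V) (subtopology X W) proj" unfolding subV .
    show "continuous_map (subtopology D V) (subtopology X W) proj"
      using continuous_map_from_subtopology[OF continuous_proj, of V]
      by (auto simp: continuous_map_in_subtopology V_def)
    show "inj_on proj (topspace (subtopology D V))"
    proof (rule inj_onI)
      fix c c' assume c: "c \<in> topspace (subtopology D V)" "c' \<in> topspace (subtopology D V)" "proj c = proj c'"
      then have "c' = c \<or> c' = sheet_exchange c" using proj_eq[of c c'] by simp
      then show "c = c'" using c h(3) by (auto simp: V_def)
    qed
    show "proj ` topspace (subtopology D V) = topspace (subtopology X W)"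
    proof
      show "proj ` topspace (subtopology D V) \<subseteq> topspace (subtopology X W)"
        using WX by (auto simp: V_def)
      show "topspace (subtopology X W) \<subseteq> proj ` topspace (subtopology D V)"
      proof
        fix x assume x: "x \<in> topspace (subtopology X W)"
        then obtain y where y: "y \<in> topspace Y" "q y = x" using q_surj by auto
        then have o: "dclass (b, y) \<in> over W" for b using x by (auto simp: dclass_in proj_dclass)
        have "h (dclass (True, y)) = 1 \<or> h (dclass (False, y)) = 1"
          using h1[OF o[of True]] h(2)[of y] y x by auto
        then show "x \<in> proj ` topspace (subtopology D V)"
          using o y by (force simp: V_def proj_dclass)
      qed
    qed
  qed
  ultimately show thesis using that open_V by blast
qed

text \<open>The coordinate \<open>h\<close> is a root of \<open>f \<circ> proj\<close>. It separates
  the two points over any point off the centre, and over the centre there is only one point, by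
  \<open>fixed\<close>. Closedness comes from properness: \<open>f \<circ> proj\<close> is the
  square of \<open>h\<close>, and the first factor of a proper composition through a Hausdorff space
  is proper.\<close>

lemma cone_over_disc:
  assumes W: "openin X W" and f: "homeomorphic_map (subtopology X W) (top_of_set (ball (0::complex) 1)) f"
    and k: "alternating W k" "\<And>y. y \<in> pre W \<Longrightarrow> (k y)\<^sup>2 = f (q y)"
    and fixed: "\<And>c. c \<in> over W \<Longrightarrow> f (proj c) = 0 \<Longrightarrow> sheet_exchange c = c"
  obtains h where "homeomorphic_map (subtopology D (over W)) (top_of_set (ball (0::complex) 1)) h"
    "\<And>c. c \<in> over W \<Longrightarrow> h (sheet_exchange c) = - h c" "\<And>c. c \<in> over W \<Longrightarrow> (h c)\<^sup>2 = f (proj c)"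
proof -
  obtain h where h: "continuous_map (subtopology D (over W)) euclidean h"
    "\<And>b y. y \<in> pre W \<Longrightarrow> h (dclass (b, y)) = (if b then k y else - k y)"
    "\<And>c. c \<in> over W \<Longrightarrow> h (sheet_exchange c) = - h c"
    using over_lift[OF W k(1)] by blast
  have WX: "W \<subseteq> topspace X" using W openin_subset by blast
  have fW: "f ` W = ball 0 1" "inj_on f W"
    using f WX by (auto simp: homeomorphic_eq_everything_map Int_absorb1)
  have hsq: "(h c)\<^sup>2 = f (proj c)" if c: "c \<in> over W" for c
  proof -
    obtain b y where y: "y \<in> topspace Y" "c = dclass (b, y)" using c by (blast elim: dclass_cases)
    then have "y \<in> pre W" using c by (simp add: proj_dclass)
    then show ?thesis using y h(2) k(2) by (simp add: proj_dclass)
  qed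
  have ball: "h c \<in> ball 0 1" if c: "c \<in> over W" for c
  proof -
    have "f (proj c) \<in> ball 0 1" using c fW by blast
    then have "(norm (h c))\<^sup>2 < 1" using hsq[OF c] by (metis dist_0_norm mem_ball norm_power)
    then show ?thesis by (simp add: abs_square_less_1)
  qed
  have cont: "continuous_map (subtopology D (over W)) (top_of_set (ball 0 1)) h"
    using h(1) ball by (auto simp: continuous_map_in_subtopology)
  have "proper_map (subtopology D (over W)) (subtopology X W) proj"
    using proper_map_restriction[OF proper_proj refl] .
  then have "proper_map (subtopology D (over W)) (top_of_set (ball 0 1)) (f \<circ> proj)"
    using f homeomorphic_imp_proper_map proper_map_compose by blast
  moreover have "closed_map (subtopology D (over W)) (top_of_set (ball 0 1)) h"
    if "proper_map (subtopology D (over W)) (top_of_set (ball 0 1)) ((\<lambda>z. z\<^sup>2) \<circ> h)"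
  proof -
    have "continuous_map (top_of_set (ball (0::complex) 1)) (top_of_set (ball 0 1)) (\<lambda>z. z\<^sup>2)"
      by (auto simp: continuous_map_in_subtopology norm_power abs_square_less_1 intro!: continuous_intros)
    moreover have "Hausdorff_space (top_of_set (ball (0::complex) 1))"
      by (simp add: Hausdorff_space_subtopology)
    ultimately have "proper_map (subtopology D (over W)) (top_of_set (ball 0 1)) h"
      using proper_map_from_composition_right[OF _ that cont] by blast
    then show ?thesis by (rule proper_imp_closed_map)
  qed
  moreover have "proper_map (subtopology D (over W)) (top_of_set (ball 0 1)) ((\<lambda>z. z\<^sup>2) \<circ> h)"
    if "proper_map (subtopology D (over W)) (top_of_set (ball 0 1)) (f \<circ> proj)"
    using that by (rule proper_map_eq) (simp add: hsq)
  ultimately have closed: "closed_map (subtopology D (over W)) (top_of_set (ball 0 1)) h" by blast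
  have "homeomorphic_map (subtopology D (over W)) (top_of_set (ball 0 1)) h"
  proof (rule bijective_closed_imp_homeomorphic_map[OF cont closed])
    show "inj_on h (topspace (subtopology D (over W)))"
    proof (rule inj_onI)
      fix c c' assume c: "c \<in> topspace (subtopology D (over W))" "c' \<in> topspace (subtopology D (over W))"
        and eq: "h c = h c'"
      then have "f (proj c) = f (proj c')" using hsq[of c] hsq[of c'] by simp
      then have "proj c = proj c'" using c fW(2) by (auto simp: inj_on_def)
      then have "c' = c \<or> c' = sheet_exchange c" using proj_eq[of c c'] c by simp
      moreover have "c' = c" if c': "c' = sheet_exchange c"
      proof -
        have "h c = - h c" using c' h(3) eq c by simp
        then have "f (proj c) = 0" using hsq[of c] c(1) by simp
        then show ?thesis using fixed[of c] c(1) c' by simp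
      qed
      ultimately show "c = c'" by blast
    qed
    show "h ` topspace (subtopology D (over W)) = topspace (top_of_set (ball 0 1))"
    proof
      show "h ` topspace (subtopology D (over W)) \<subseteq> topspace (top_of_set (ball 0 1))" using ball by auto
      show "topspace (top_of_set (ball 0 1)) \<subseteq> h ` topspace (subtopology D (over W))"
      proof
        fix w :: complex assume "w \<in> topspace (top_of_set (ball 0 1))"
        then have "w\<^sup>2 \<in> ball 0 1" by (simp add: norm_power abs_square_less_1)
        then obtain x where x: "x \<in> W" "f x = w\<^sup>2" using fW(1) by (metis imageE)
        then obtain y where y: "y \<in> topspace Y" "q y = x" using q_surj WX by blast
        define c where "c = dclass (True, y)"
        have c: "c \<in> over W" using x y by (simp add: c_def dclass_in proj_dclass)
        then have c': "sheet_exchange c \<in> over W" using sheet_exchange_in proj_sheet_exchange by auto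
        have "(h c)\<^sup>2 = w\<^sup>2" using hsq[OF c] x y by (simp add: c_def proj_dclass)
        then have "w = h c \<or> w = h (sheet_exchange c)" using h(3)[OF c] by (auto simp: power2_eq_iff)
        then show "w \<in> h ` topspace (subtopology D (over W))" using c c' by auto
      qed
    qed
  qed
  then show thesis using that h(3) hsq by blast
qed

end

section \<open>Orbifold charts\<close>

lemma embedding_map_left_inverse:
  assumes j: "continuous_map T Z j"
    and r: "continuous_map (subtopology Z (j ` topspace T)) T r" "\<And>x. x \<in> topspace T \<Longrightarrow> r (j x) = x"
  shows "embedding_map T Z j"
proof -
  have "homeomorphic_maps T (subtopology Z (j ` topspace T)) j r"
    unfolding homeomorphic_maps_def using assms by (auto simp: continuous_map_in_subtopology)
  then show ?thesis unfolding embedding_map_def by (rule homeomorphic_maps_imp_map)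
qed

lemma homeomorphic_map_continuous_inv_into:
  assumes "homeomorphic_map T Z h"
  shows "continuous_map Z T (inv_into (topspace T) h)"
proof -
  obtain g where g: "homeomorphic_maps T Z h g" using assms by (auto simp: homeomorphic_map_maps)
  have inj: "inj_on h (topspace T)" using assms by (simp add: homeomorphic_eq_everything_map)
  have gT: "g z \<in> topspace T" "h (g z) = z" if "z \<in> topspace Z" for z
    using g that by (auto simp: homeomorphic_maps_def continuous_map_def)
  have "continuous_map Z T g" using g by (simp add: homeomorphic_maps_def)
  then show ?thesis
    by (rule continuous_map_eq) (simp add: inv_into_f_eq[OF inj gT])
qed

lemma one_BijGroup: "\<one>\<^bsub>BijGroup S\<^esub> = restrict id S"
  by (simp add: BijGroup_def id_def)

lemma subgroup_trivial_BijGroup: "subgroup {restrict id S} (BijGroup S)"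
  using group.triv_subgroup[OF group_BijGroup] by (simp add: one_BijGroup)

text \<open>Elements of \<open>BijGroup\<close> are extensional, which is why chart groups consist
  of restricted maps; this covers the group of a cone chart.\<close>

lemma subgroup_involution_BijGroup:
  assumes \<rho>: "\<rho> \<in> Bij S" "\<And>x. x \<in> S \<Longrightarrow> \<rho> (\<rho> x) = x"
  shows "subgroup {restrict id S, \<rho>} (BijGroup S)"
proof -
  interpret group "BijGroup S" by (rule group_BijGroup)
  have c: "\<rho> \<in> carrier (BijGroup S)" using \<rho> by (simp add: BijGroup_def)
  have "\<rho> \<otimes>\<^bsub>BijGroup S\<^esub> \<rho> = compose S \<rho> \<rho>" using \<rho>(1) by (simp add: BijGroup_def)
  also have "\<dots> = restrict id S" using \<rho>(2) by (auto simp: compose_def restrict_def)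
  finally have sq: "\<rho> \<otimes>\<^bsub>BijGroup S\<^esub> \<rho> = \<one>\<^bsub>BijGroup S\<^esub>" by (simp add: one_BijGroup)
  have "inv\<^bsub>BijGroup S\<^esub> \<rho> = \<rho>" using inv_equality[OF sq c c] .
  then have "subgroup {\<one>\<^bsub>BijGroup S\<^esub>, \<rho>} (BijGroup S)"
    using c sq by (intro subgroupI) auto
  then show ?thesis by (simp add: one_BijGroup)
qed

lemma orbifold_chart_onI:
  assumes "openin (top_of_set upper_halfplane) (chart_dom c)" "finite (chart_group c)"
    and sub: "subgroup (chart_group c) (BijGroup (chart_dom c))"
    and cont: "\<And>\<gamma>. \<gamma> \<in> chart_group c \<Longrightarrow> continuous_on (chart_dom c) \<gamma>"
    and quo: "quotient_map (top_of_set (chart_dom c)) (subtopology Z W) (chart_map c)"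
    and W: "openin Z W"
    and inv: "\<And>\<gamma> z. \<gamma> \<in> chart_group c \<Longrightarrow> z \<in> chart_dom c \<Longrightarrow> chart_map c (\<gamma> z) = chart_map c z"
    and fib: "\<And>z w. z \<in> chart_dom c \<Longrightarrow> w \<in> chart_dom c \<Longrightarrow> chart_map c z = chart_map c w \<Longrightarrow>
      \<exists>\<gamma>\<in>chart_group c. w = \<gamma> z"
  shows "orbifold_chart_on Z c" "chart_image c = W"
proof -
  have "W \<subseteq> topspace Z" using W openin_subset by blast
  then show im: "chart_image c = W"
    using quotient_imp_surjective_map[OF quo] by (simp add: chart_image_def Int_absorb1)
  have "homeomorphic_map
       (quotient_space (top_of_set (chart_dom c)) (orbit_relation (top_of_set (chart_dom c)) (chart_group c)))
       (subtopology Z W) (\<lambda>C. the_elem (chart_map c ` C))"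
  proof (rule homeomorphic_map_quotient_space[OF quo])
    show "chart_map c u = chart_map c v"
      if "(u, v) \<in> orbit_relation (top_of_set (chart_dom c)) (chart_group c)" for u v
      using that inv by (auto simp: orbit_relation_def)
    fix z w assume "z \<in> topspace (top_of_set (chart_dom c))" "w \<in> topspace (top_of_set (chart_dom c))"
      and "chart_map c z = chart_map c w"
    then have "(z, w) \<in> orbit_relation (top_of_set (chart_dom c)) (chart_group c)"
      using fib[of z w] by (auto simp: orbit_relation_def)
    then show "equivclp (\<lambda>u v. (u, v) \<in> orbit_relation (top_of_set (chart_dom c)) (chart_group c)) z w"
      by (rule r_into_equivclp)
  qed
  then show "orbifold_chart_on Z c"
    unfolding orbifold_chart_on_def im using assms by blast
qed

text \<open>When the group of \<open>c\<close> is trivial, equivariance is automatic with the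
  constant homomorphism \<open>F\<close>.\<close>

lemma orbifold_chart_inclusion_trivial:
  assumes c: "chart_group c = {restrict id (chart_dom c)}"
    and d: "subgroup (chart_group d) (BijGroup (chart_dom d))"
    and j: "embedding_map (top_of_set (chart_dom c)) (top_of_set (chart_dom d)) j"
      "\<And>z. z \<in> chart_dom c \<Longrightarrow> chart_map d (j z) = chart_map c z"
  shows "orbifold_chart_inclusion c d"
proof -
  define F :: "(complex \<Rightarrow> complex) \<Rightarrow> complex \<Rightarrow> complex" where "F = (\<lambda>_. restrict id (chart_dom d))"
  interpret d: group "BijGroup (chart_dom d)" by (rule group_BijGroup)
  have "restrict id (chart_dom d) \<in> chart_group d"
    using subgroup.one_closed[OF d] by (simp add: one_BijGroup)
  moreover have "restrict id (chart_dom d) \<otimes>\<^bsub>BijGroup (chart_dom d)\<^esub> restrict id (chart_dom d) = restrict id (chart_dom d)"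
    using d.l_one[OF d.one_closed] by (simp add: one_BijGroup)
  ultimately have "F \<in> hom (BijGroup (chart_dom c)\<lparr>carrier := chart_group c\<rparr>)
                    (BijGroup (chart_dom d)\<lparr>carrier := chart_group d\<rparr>)"
    by (auto simp: hom_def F_def)
  moreover have "inj_on F (chart_group c)" by (simp add: c)
  moreover have "j z \<in> chart_dom d" if "z \<in> chart_dom c" for z
    using j(1) that unfolding embedding_map_def
    by (auto dest!: homeomorphic_imp_continuous_map simp: continuous_map_in_subtopology)
  then have "\<forall>\<gamma>\<in>chart_group c. \<forall>z\<in>chart_dom c. j (\<gamma> z) = F \<gamma> (j z)"
    by (auto simp: c F_def)
  ultimately show ?thesis unfolding orbifold_chart_inclusion_def using j by blast
qed

lemma orbifold_chart_inclusion_refl: "orbifold_chart_inclusion c c"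
proof -
  have "id \<in> hom (BijGroup (chart_dom c)\<lparr>carrier := chart_group c\<rparr>) (BijGroup (chart_dom c)\<lparr>carrier := chart_group c\<rparr>)"
    by (simp add: hom_def)
  moreover have "embedding_map (top_of_set (chart_dom c)) (top_of_set (chart_dom c)) id"
    by (rule embedding_map_left_inverse[of _ _ _ id]) auto
  ultimately show ?thesis
    unfolding orbifold_chart_inclusion_def by (intro exI[of _ id] conjI) auto
qed

lemma Hausdorff_finite_disjoint_neighbourhoods:
  assumes T: "Hausdorff_space T" and S: "finite S" "S \<subseteq> topspace T"
  obtains G where "\<And>x. x \<in> S \<Longrightarrow> openin T (G x)" "\<And>x. x \<in> S \<Longrightarrow> x \<in> G x"
    "\<And>x y. x \<in> S \<Longrightarrow> y \<in> S \<Longrightarrow> x \<noteq> y \<Longrightarrow> G x \<inter> G y = {}"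
proof -
  have "\<exists>UV. openin T (fst UV) \<and> openin T (snd UV) \<and> x \<in> fst UV \<and> y \<in> snd UV \<and> fst UV \<inter> snd UV = {}"
    if xy: "x \<in> S" "y \<in> S" "x \<noteq> y" for x y
  proof -
    have "x \<in> topspace T" "y \<in> topspace T" using xy S by auto
    then obtain U V where "openin T U" "openin T V" "x \<in> U" "y \<in> V" "disjnt U V"
      using T xy(3) unfolding Hausdorff_space_def by blast
    then show ?thesis by (intro exI[of _ "(U, V)"]) (auto simp: disjnt_def)
  qed
  then obtain N where N: "\<And>x y. x \<in> S \<Longrightarrow> y \<in> S \<Longrightarrow> x \<noteq> y \<Longrightarrow>
      openin T (fst (N x y)) \<and> openin T (snd (N x y)) \<and> x \<in> fst (N x y) \<and> y \<in> snd (N x y) \<and>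
      fst (N x y) \<inter> snd (N x y) = {}"
    by metis
  \<comment> \<open>\<open>N x y\<close> and \<open>N y x\<close> are chosen independently, so
    \<open>G x\<close> has to respect both.\<close>
  define G where "G x = (\<Inter>y\<in>S - {x}. fst (N x y) \<inter> snd (N y x)) \<inter> topspace T" for x
  show thesis
  proof (rule that[of G])
    show "openin T (G x)" if "x \<in> S" for x
      unfolding G_def using S N that by (intro openin_INT openin_Int) auto
    show "x \<in> G x" if "x \<in> S" for x
      unfolding G_def using S N that by blast
    fix x y assume xy: "x \<in> S" "y \<in> S" "x \<noteq> y"
    have "G x \<subseteq> fst (N x y)" "G y \<subseteq> snd (N x y)" using xy by (auto simp: G_def)
    then show "G x \<inter> G y = {}" using N[OF xy] by blast
  qed
qed

section \<open>The two kinds of orbifold charts\<close>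

definition sheet_orbichart :: "'a set \<Rightarrow> ('a \<Rightarrow> complex) \<Rightarrow> 'a orbifold_chart" where
  "sheet_orbichart W f = \<lparr>chart_dom = f ` W, chart_group = {restrict id (f ` W)}, chart_map = inv_into W f\<rparr>"

text \<open>Chart domains have to lie in the half-plane, so the disc on which the rotation of
  order 2 acts is centred at \<open>2 * \<i>\<close>.\<close>

definition cone_orbichart :: "'a set \<Rightarrow> ('a \<Rightarrow> complex) \<Rightarrow> 'a orbifold_chart" where
  "cone_orbichart W f = \<lparr>chart_dom = ball (2 * \<i>) 1,
     chart_group = {restrict id (ball (2 * \<i>) 1), restrict (\<lambda>z. 4 * \<i> - z) (ball (2 * \<i>) 1)},
     chart_map = (\<lambda>z. inv_into W f ((z - 2 * \<i>)\<^sup>2))\<rparr>"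

lemma sheet_orbichart_simps [simp]:
  "chart_dom (sheet_orbichart W f) = f ` W"
  "chart_group (sheet_orbichart W f) = {restrict id (f ` W)}"
  "chart_map (sheet_orbichart W f) = inv_into W f"
  by (simp_all add: sheet_orbichart_def)

lemma cone_orbichart_simps [simp]:
  "chart_dom (cone_orbichart W f) = ball (2 * \<i>) 1"
  "chart_group (cone_orbichart W f) =
     {restrict id (ball (2 * \<i>) 1), restrict (\<lambda>z. 4 * \<i> - z) (ball (2 * \<i>) 1)}"
  "chart_map (cone_orbichart W f) = (\<lambda>z. inv_into W f ((z - 2 * \<i>)\<^sup>2))"
  by (simp_all add: cone_orbichart_def)

text \<open>The map is the rotation by pi about \<open>2 * \<i>\<close>, an isometry fixing the
  centre of the ball.\<close>

lemma reflected_ball: "4 * \<i> - z \<in> ball (2 * \<i>) 1 \<longleftrightarrow> z \<in> ball (2 * \<i>) 1"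
  by (simp add: dist_norm norm_minus_commute algebra_simps)

lemma subgroup_cone_orbichart:
  "subgroup (chart_group (cone_orbichart W f)) (BijGroup (chart_dom (cone_orbichart W f)))"
  unfolding cone_orbichart_simps
proof (rule subgroup_involution_BijGroup)
  have "bij_betw (\<lambda>z. 4 * \<i> - z) (ball (2 * \<i>) 1) (ball (2 * \<i>) 1)"
    by (rule bij_betw_byWitness[of _ "\<lambda>z. 4 * \<i> - z"]) (use reflected_ball in auto)
  then show "restrict (\<lambda>z. 4 * \<i> - z) (ball (2 * \<i>) 1) \<in> Bij (ball (2 * \<i>) 1)"
    unfolding Bij_def by (simp add: bij_betw_restrict_eq)
  show "restrict (\<lambda>z. 4 * \<i> - z) (ball (2 * \<i>) 1) (restrict (\<lambda>z. 4 * \<i> - z) (ball (2 * \<i>) 1) x) = x"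
    if "x \<in> ball (2 * \<i>) 1" for x
    using that reflected_ball[of x] by simp
qed

lemma sheet_orbichart_on:
  assumes "surface_chart Z W f"
  shows "orbifold_chart_on Z (sheet_orbichart W f)" "chart_image (sheet_orbichart W f) = W"
proof -
  note c = surface_chart_inverse[OF assms]
  have "homeomorphic_maps (subtopology Z W) (top_of_set (f ` W)) f (inv_into W f)"
    unfolding homeomorphic_maps_def using c by (auto simp: continuous_map_in_subtopology f_inv_into_f)
  then have "homeomorphic_map (top_of_set (f ` W)) (subtopology Z W) (inv_into W f)"
    using homeomorphic_maps_imp_map homeomorphic_maps_sym by blast
  then have quo: "quotient_map (top_of_set (f ` W)) (subtopology Z W) (inv_into W f)"
    by (simp add: homeomorphic_map_def)
  have inj: "z = w" if "z \<in> f ` W" "w \<in> f ` W" "inv_into W f z = inv_into W f w" for z w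
    using that by (metis f_inv_into_f)
  have 1: "openin (top_of_set upper_halfplane) (f ` W)"
    using assms by (simp add: surface_chart_def)
  show "orbifold_chart_on Z (sheet_orbichart W f)"
    by (rule orbifold_chart_onI(1)[where W = W])
      (use 1 c quo inj subgroup_trivial_BijGroup in \<open>auto intro: continuous_on_eq[OF continuous_on_id]\<close>)
  show "chart_image (sheet_orbichart W f) = W"
    using c(2) by (auto simp: chart_image_def image_comp o_def)
qed

lemma orbifold_point_cone_orbichart:
  assumes "cone_orbichart W f \<in> \<C>" "inj_on f W" "p \<in> W" "f p = 0"
  shows "orbifold_point_of_order \<C> 2 p"
proof -
  let ?B = "ball (2 * \<i>) 1"
  define k where "k z = z - 2 * \<i>" for z
  have "homeomorphic_maps (top_of_set ?B) (top_of_set (ball 0 1)) k (\<lambda>z. z + 2 * \<i>)"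
    unfolding homeomorphic_maps_def k_def
    by (auto simp: continuous_map_in_subtopology dist_norm norm_minus_commute intro!: continuous_intros)
  then have homeo: "homeomorphic_map (top_of_set ?B) (top_of_set (ball 0 1)) k"
    by (rule homeomorphic_maps_imp_map)
  have kinv: "inv_into ?B k w = w + 2 * \<i>" if "w \<in> ball 0 1" for w
    by (rule inv_into_f_eq) (use that in \<open>auto simp: k_def inj_on_def dist_norm\<close>)
  have kB: "k z \<in> ball 0 1" if "z \<in> ?B" for z using that by (simp add: k_def dist_norm norm_minus_commute)
  have two: "{..<2::nat} = {0, 1}" by auto
  have 0: "restrict (\<lambda>z. inv_into ?B k (cis (2 * pi * real 0 / real 2) * k z)) ?B = restrict id ?B"
    using kinv kB by (intro restrict_ext) (simp add: k_def)
  have 1: "restrict (\<lambda>z. inv_into ?B k (cis (2 * pi * real 1 / real 2) * k z)) ?B = restrict (\<lambda>z. 4 * \<i> - z) ?B"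
  proof (rule restrict_ext)
    fix z assume z: "z \<in> ?B"
    have "cis (2 * pi * real 1 / real 2) * k z = - k z" by simp
    moreover have "- k z \<in> ball 0 1" using kB[OF z] by simp
    ultimately show "inv_into ?B k (cis (2 * pi * real 1 / real 2) * k z) = 4 * \<i> - z"
      using kinv[of "- k z"] by (simp add: k_def)
  qed
  have "inv_into W f ((inv_into ?B k 0 - 2 * \<i>)\<^sup>2) = p"
    using kinv[of 0] assms by (simp add: inv_into_f_eq)
  \<comment> \<open>The terms \<open>real 0\<close>, \<open>real 1\<close> and \<open>real 2\<close>
    are kept unevaluated, so that the facts \<open>0\<close> and \<open>1\<close> match the two
    rotations in the definition.\<close>
  then show ?thesis
    unfolding orbifold_point_of_order_def
    by (intro bexI[OF _ assms(1)] exI[of _ k])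
      (use homeo 0 1 in \<open>simp add: two del: of_nat_0 of_nat_1 of_nat_numeral\<close>)
qed

section \<open>Charts of the quotient and their inclusions\<close>

context folded_marked_surface begin

abbreviation sheet_group :: "((bool \<times> 'b) set \<Rightarrow> (bool \<times> 'b) set) set" where
  "sheet_group \<equiv> {id, sheet_exchange}"

abbreviation orbit_proj :: "(bool \<times> 'b) set \<Rightarrow> 'a" where
  "orbit_proj c \<equiv> the_elem (proj ` identification_class D (orbit_relation D sheet_group) c)"

text \<open>A coordinate \<open>f\<close> at the puncture with a root in two places:
  \<open>h\<close> on the double, which gives the chart, and \<open>k\<close> on the cut surface,
  which is multiplied with sign functions in \<open>inclusion_sheet_cone\<close>.\<close>

definition cone_data :: "'a \<Rightarrow> 'a set \<Rightarrow> ('a \<Rightarrow> complex) \<Rightarrow> ('b \<Rightarrow> complex) \<Rightarrow> ((bool \<times> 'b) set \<Rightarrow> complex) \<Rightarrow> bool" where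
  "cone_data p W f k h \<longleftrightarrow> openin X W \<and> p \<in> W \<and>
     homeomorphic_map (subtopology X W) (top_of_set (ball 0 1)) f \<and> f p = 0 \<and>
     alternating W k \<and> (\<forall>y\<in>pre W. (k y)\<^sup>2 = f (q y)) \<and>
     homeomorphic_map (subtopology D (over W)) (top_of_set (ball 0 1)) h \<and>
     (\<forall>c\<in>over W. h (sheet_exchange c) = - h c \<and> (h c)\<^sup>2 = f (proj c))"

text \<open>Over \<open>p\<close> lies the fixed point \<open>ctr p\<close> of the folding, where
  crossing the cut changes the sheet without moving the point.\<close>

lemma sheet_exchange_fixed:
  assumes "p \<in> P" "c \<in> topspace D" "proj c = p"
  shows "sheet_exchange c = c"
proof -
  obtain b y where y: "y \<in> topspace Y" "c = dclass (b, y)" using assms(2) by (rule dclass_cases)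
  then have "q y = p" using assms(3) by (simp add: proj_dclass)
  then have "y = ctr p" using fibre_ctr[OF assms(1)] y(1) by blast
  then show ?thesis
    using y sheet_exchange_dclass[OF y(1)] dclass_flip[OF assms(1) ctr(1)[OF assms(1)], of b] ctr(4)[OF assms(1)]
    by simp
qed

lemma ex_cone_data:
  assumes p: "p \<in> P" and G: "openin X G" "p \<in> G"
  shows "\<exists>W f k h. W \<subseteq> G \<and> cone_data p W f k h"
proof -
  obtain W f k where W: "openin X W" "p \<in> W" "W \<subseteq> G"
    "homeomorphic_map (subtopology X W) (top_of_set (ball (0::complex) 1)) f" "f p = 0"
    "alternating W k" "\<And>y. y \<in> pre W \<Longrightarrow> (k y)\<^sup>2 = f (q y)"
    using cone_chart[OF p G] by blast
  have "W \<subseteq> topspace X" using W(1) openin_subset by blast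
  then have inj: "inj_on f W" using W(4) by (auto simp: homeomorphic_eq_everything_map Int_absorb1)
  have "sheet_exchange c = c" if "c \<in> over W" "f (proj c) = 0" for c
    using that sheet_exchange_fixed[OF p, of c] inj W(2,5) by (auto simp: inj_on_def)
  then obtain h where "homeomorphic_map (subtopology D (over W)) (top_of_set (ball (0::complex) 1)) h"
    "\<And>c. c \<in> over W \<Longrightarrow> h (sheet_exchange c) = - h c" "\<And>c. c \<in> over W \<Longrightarrow> (h c)\<^sup>2 = f (proj c)"
    using cone_over_disc[OF W(1,4,6,7)] by blast
  then show ?thesis
    using W unfolding cone_data_def by blast
qed

text \<open>The chart domain is carried onto one sheet over \<open>W\<close>. The exchange moves
  that sheet off itself, so the stabiliser acts trivially.\<close>

lemma quotient_orbifold_chart_sheet: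
  assumes f: "surface_chart X W f" and s: "splits W"
  shows "quotient_orbifold_chart D sheet_group orbit_proj (sheet_orbichart W f)"
proof -
  note c = surface_chart_inverse[OF f]
  obtain V where V: "openin D V" "sheet_exchange ` V \<inter> V = {}"
    "homeomorphic_map (subtopology D V) (subtopology X W) proj"
    using sheet_over_split[OF c(1) s] by blast
  have VD: "V \<subseteq> topspace D" using V(1) openin_subset by blast
  have "homeomorphic_map (subtopology D V) (top_of_set (f ` W)) (f \<circ> proj)"
    using V(3) f homeomorphic_map_compose unfolding surface_chart_def by blast
  then obtain \<psi> where \<psi>: "homeomorphic_maps (subtopology D V) (top_of_set (f ` W)) (f \<circ> proj) \<psi>"
    by (auto simp: homeomorphic_map_maps)
  then have \<psi>h: "homeomorphic_map (top_of_set (f ` W)) (subtopology D V) \<psi>"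
    using homeomorphic_maps_imp_map homeomorphic_maps_sym by blast
  have \<psi>V: "\<psi> z \<in> V" "f (proj (\<psi> z)) = z" if "z \<in> f ` W" for z
    using \<psi> that by (auto simp: homeomorphic_maps_def continuous_map_in_subtopology)
  have \<psi>inj: "inj_on \<psi> (f ` W)" by (rule inj_on_inverseI[where g = "f \<circ> proj"]) (simp add: \<psi>V(2))
  \<comment> \<open>An empty \<open>W\<close> is allowed; then the exchange does preserve the sheet,
    but all maps restricted to the empty domain coincide.\<close>
  have Vne: "f ` W = {}" if "sheet_exchange ` V = V"
    using V(2) that \<psi>V by blast
  have "restrict (\<lambda>z. inv_into (f ` W) \<psi> (g (\<psi> z))) (f ` W) = restrict id (f ` W)"
    if "g \<in> sheet_group" "g ` V = V" for g
  proof (rule restrict_ext)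
    fix z assume z: "z \<in> f ` W"
    then have "g = id" using that Vne by auto
    then show "inv_into (f ` W) \<psi> (g (\<psi> z)) = id z" using \<psi>inj z by simp
  qed
  then have grp: "(\<lambda>g. restrict (\<lambda>z. inv_into (f ` W) \<psi> (g (\<psi> z))) (f ` W)) ` {g \<in> sheet_group. g ` V = V} = {restrict id (f ` W)}"
    by (intro equalityI subsetI) (auto intro!: image_eqI[of _ _ id])
  have map: "inv_into W f z = orbit_proj (\<psi> z)" if "z \<in> f ` W" for z
  proof -
    have "\<psi> z \<in> V" "f (proj (\<psi> z)) = z" using \<psi>V that by auto
    moreover have "proj (\<psi> z) \<in> W"
      using V(3) calculation(1) VD by (auto simp: homeomorphic_eq_everything_map continuous_map_in_subtopology)
    ultimately have "inv_into W f z = proj (\<psi> z)"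
      using c(2) by (intro inv_into_f_eq)
    then show ?thesis
      using the_elem_proj_orbit[of "\<psi> z"] VD \<open>\<psi> z \<in> V\<close> by auto
  qed
  have "\<forall>g\<in>sheet_group. g ` V = V \<or> g ` V \<inter> V = {}" using V(2) by auto
  then show ?thesis
    unfolding quotient_orbifold_chart_def sheet_orbichart_simps
    using V(1) \<psi>h grp map by (intro exI[of _ V] exI[of _ \<psi>]) auto
qed

text \<open>In the coordinate \<open>h\<close> the exchange is negation; shifting the disc to
  \<open>2 * \<i>\<close> turns it into \<open>4 * \<i> - z\<close>. Since
  \<open>(h c)\<^sup>2 = f (proj c)\<close>, the orbits are the fibres of the squaring map.\<close>

lemma cone_orbichart_properties:
  assumes d: "cone_data p W f k h"
  shows "quotient_orbifold_chart D sheet_group orbit_proj (cone_orbichart W f)"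
    "orbifold_chart_on X (cone_orbichart W f)" "chart_image (cone_orbichart W f) = W"
proof -
  let ?B = "ball (2 * \<i>) 1"
  have W: "openin X W" and f: "homeomorphic_map (subtopology X W) (top_of_set (ball 0 1)) f"
    and h: "homeomorphic_map (subtopology D (over W)) (top_of_set (ball 0 1)) h"
      "\<And>c. c \<in> over W \<Longrightarrow> h (sheet_exchange c) = - h c" "\<And>c. c \<in> over W \<Longrightarrow> (h c)\<^sup>2 = f (proj c)"
    using d by (auto simp: cone_data_def)
  have WX: "W \<subseteq> topspace X" using W openin_subset by blast
  have fW: "inj_on f W" using f WX by (auto simp: homeomorphic_eq_everything_map Int_absorb1)
  define h' where "h' c = h c + 2 * \<i>" for c
  have "homeomorphic_maps (top_of_set (ball 0 1)) (top_of_set ?B) (\<lambda>z. z + 2 * \<i>) (\<lambda>z. z - 2 * \<i>)"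
    unfolding homeomorphic_maps_def
    by (auto simp: continuous_map_in_subtopology dist_norm norm_minus_commute intro!: continuous_intros)
  then have "homeomorphic_map (top_of_set (ball 0 1)) (top_of_set ?B) (\<lambda>z. z + 2 * \<i>)"
    by (rule homeomorphic_maps_imp_map)
  then have "homeomorphic_map (subtopology D (over W)) (top_of_set ?B) ((\<lambda>z. z + 2 * \<i>) \<circ> h)"
    using h(1) homeomorphic_map_compose by blast
  then obtain \<psi> where "homeomorphic_maps (subtopology D (over W)) (top_of_set ?B) ((\<lambda>z. z + 2 * \<i>) \<circ> h) \<psi>"
    by (auto simp: homeomorphic_map_maps)
  then have \<psi>: "homeomorphic_maps (subtopology D (over W)) (top_of_set ?B) h' \<psi>"
    by (simp add: o_def h'_def[abs_def])
  then have \<psi>h: "homeomorphic_map (top_of_set ?B) (subtopology D (over W)) \<psi>"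
    using homeomorphic_maps_imp_map homeomorphic_maps_sym by blast
  have \<psi>V: "\<psi> z \<in> over W" "h' (\<psi> z) = z" if "z \<in> ?B" for z
    using \<psi> that by (auto simp: homeomorphic_maps_def continuous_map_in_subtopology)
  have h\<psi>: "h (\<psi> z) = z - 2 * \<i>" if "z \<in> ?B" for z
    using \<psi>V(2)[OF that] by (simp add: h'_def eq_diff_eq)
  have \<psi>inj: "inj_on \<psi> ?B" by (rule inj_on_inverseI[where g = h']) (rule \<psi>V(2))
  have \<psi>h': "\<psi> (h' c) = c" "h' c \<in> ?B" if "c \<in> over W" for c
    using \<psi> that by (auto simp: homeomorphic_maps_def continuous_map_in_subtopology)
  have ex: "sheet_exchange ` over W = over W"
  proof
    show 1: "sheet_exchange ` over W \<subseteq> over W" using sheet_exchange_in proj_sheet_exchange by auto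
    show "over W \<subseteq> sheet_exchange ` over W"
    proof
      fix c assume c: "c \<in> over W"
      then have "sheet_exchange c \<in> over W" using 1 by blast
      then show "c \<in> sheet_exchange ` over W"
        using sheet_exchange_twice[of c] c by (intro image_eqI[of _ _ "sheet_exchange c"]) auto
    qed
  qed
  have map: "inv_into W f ((z - 2 * \<i>)\<^sup>2) = proj (\<psi> z)" if "z \<in> ?B" for z
  proof -
    have "(z - 2 * \<i>)\<^sup>2 = f (proj (\<psi> z))"
      using h(3)[OF \<psi>V(1)[OF that]] h\<psi>[OF that] by simp
    then show ?thesis using \<psi>V(1)[OF that] fW by (intro inv_into_f_eq) auto
  qed
  have id: "restrict (\<lambda>z. inv_into ?B \<psi> (id (\<psi> z))) ?B = restrict id ?B"
    using \<psi>inj by (intro restrict_ext) simp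
  have swap: "restrict (\<lambda>z. inv_into ?B \<psi> (sheet_exchange (\<psi> z))) ?B = restrict (\<lambda>z. 4 * \<i> - z) ?B"
  proof (rule restrict_ext)
    fix z assume z: "z \<in> ?B"
    have c: "sheet_exchange (\<psi> z) \<in> over W" using \<psi>V(1)[OF z] ex by blast
    have "h' (sheet_exchange (\<psi> z)) = 4 * \<i> - z"
      using h(2)[OF \<psi>V(1)[OF z]] h\<psi>[OF z] by (simp add: h'_def algebra_simps)
    then show "inv_into ?B \<psi> (sheet_exchange (\<psi> z)) = 4 * \<i> - z"
      using \<psi>h'[OF c] \<psi>inj by (intro inv_into_f_eq) auto
  qed
  have "{g \<in> sheet_group. g ` over W = over W} = sheet_group" using ex by auto
  then have grp: "(\<lambda>g. restrict (\<lambda>z. inv_into ?B \<psi> (g (\<psi> z))) ?B) ` {g \<in> sheet_group. g ` over W = over W} =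
      {restrict id ?B, restrict (\<lambda>z. 4 * \<i> - z) ?B}"
    using id swap by simp
  have "\<forall>g\<in>sheet_group. g ` over W = over W \<or> g ` over W \<inter> over W = {}" using ex by auto
  moreover have "inv_into W f ((z - 2 * \<i>)\<^sup>2) = orbit_proj (\<psi> z)" if "z \<in> ?B" for z
    using map[OF that] the_elem_proj_orbit[of "\<psi> z"] \<psi>V(1)[OF that] by simp
  ultimately show "quotient_orbifold_chart D sheet_group orbit_proj (cone_orbichart W f)"
    unfolding quotient_orbifold_chart_def cone_orbichart_simps
    using openin_over[OF W] \<psi>h grp by (intro exI[of _ "over W"] exI[of _ \<psi>]) auto
  have "quotient_map (subtopology D (over W)) (subtopology X W) proj"
    using quotient_map_restriction[OF quotient_proj refl] W by blast
  moreover have "quotient_map (top_of_set ?B) (subtopology D (over W)) \<psi>"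
    using \<psi>h by (simp add: homeomorphic_map_def)
  ultimately have "quotient_map (top_of_set ?B) (subtopology X W) (proj \<circ> \<psi>)"
    using quotient_map_compose by blast
  then have quo: "quotient_map (top_of_set ?B) (subtopology X W) (\<lambda>z. inv_into W f ((z - 2 * \<i>)\<^sup>2))"
    by (rule quotient_map_eq) (simp add: map)
  have "?B \<subseteq> upper_halfplane"
  proof
    fix z assume z: "z \<in> ?B"
    then have "Im (2 * \<i> - z) < 1"
      using order_trans[OF abs_ge_self abs_Im_le_cmod, of "2 * \<i> - z"] by (simp add: dist_norm)
    then show "z \<in> upper_halfplane" by (simp add: upper_halfplane_def)
  qed
  then have op: "openin (top_of_set upper_halfplane) ?B" by (simp add: open_subset)
  have fib: "w = z \<or> w = 4 * \<i> - z" if "z \<in> ?B" "w \<in> ?B"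
    and eq: "inv_into W f ((z - 2 * \<i>)\<^sup>2) = inv_into W f ((w - 2 * \<i>)\<^sup>2)" for z w
  proof -
    have "(z - 2 * \<i>)\<^sup>2 = f (proj (\<psi> z))" "(w - 2 * \<i>)\<^sup>2 = f (proj (\<psi> w))"
      using h(3)[OF \<psi>V(1)[OF that(1)]] h\<psi>[OF that(1)] h(3)[OF \<psi>V(1)[OF that(2)]] h\<psi>[OF that(2)]
      by simp_all
    then have "(z - 2 * \<i>)\<^sup>2 = (w - 2 * \<i>)\<^sup>2" using eq map[OF that(1)] map[OF that(2)] by simp
    then have "w - 2 * \<i> = z - 2 * \<i> \<or> w - 2 * \<i> = - (z - 2 * \<i>)" by (metis power2_eq_iff)
    then show ?thesis
    proof
      assume "w - 2 * \<i> = - (z - 2 * \<i>)"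
      then have "w = - (z - 2 * \<i>) + 2 * \<i>" by (metis diff_add_cancel)
      then show ?thesis by simp
    qed simp
  qed
  let ?c = "cone_orbichart W f"
  have cont: "continuous_on (chart_dom ?c) \<gamma>" if \<gamma>: "\<gamma> \<in> chart_group ?c" for \<gamma>
  proof -
    have cr: "continuous_on ?B (restrict g ?B)" if "continuous_on ?B g" for g :: "complex \<Rightarrow> complex"
      using that by (rule continuous_on_eq) simp
    have "continuous_on ?B (\<lambda>z. 4 * \<i> - z)" by (intro continuous_intros)
    then show ?thesis
      using \<gamma> cr[of id] cr[of "\<lambda>z. 4 * \<i> - z"] continuous_on_id'[of ?B] by auto
  qed
  have invariant: "chart_map ?c (\<gamma> z) = chart_map ?c z" if "\<gamma> \<in> chart_group ?c" "z \<in> chart_dom ?c" for \<gamma> z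
    using that by (auto simp: power2_commute[of "2 * \<i>" z])
  have orbit: "\<exists>\<gamma>\<in>chart_group ?c. w = \<gamma> z"
    if "z \<in> chart_dom ?c" "w \<in> chart_dom ?c" "chart_map ?c z = chart_map ?c w" for z w
    using that fib[of z w] by auto
  have *: "openin (top_of_set upper_halfplane) (chart_dom ?c)" "finite (chart_group ?c)"
    "quotient_map (top_of_set (chart_dom ?c)) (subtopology X W) (chart_map ?c)"
    using op quo by simp_all
  show "orbifold_chart_on X ?c" "chart_image ?c = W"
    by (rule orbifold_chart_onI[OF *(1,2) subgroup_cone_orbichart[of W f] _ *(3) W];
        (erule cont | erule (1) invariant | erule (2) orbit))+
qed

lemma inclusion_sheet_sheet:
  assumes f: "surface_chart X W f" and g: "surface_chart X W' g" and sub: "W \<subseteq> W'"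
  shows "orbifold_chart_inclusion (sheet_orbichart W f) (sheet_orbichart W' g)"
proof (rule orbifold_chart_inclusion_trivial[where j = "g \<circ> inv_into W f"])
  note c = surface_chart_inverse[OF f] and d = surface_chart_inverse[OF g]
  note e = surface_chart_inverse[OF surface_chart_restrict[OF g c(1) sub]]
  show "embedding_map (top_of_set (chart_dom (sheet_orbichart W f))) (top_of_set (chart_dom (sheet_orbichart W' g)))
      (g \<circ> inv_into W f)"
  proof (rule embedding_map_left_inverse[where r = "f \<circ> inv_into W g"])
    have im: "(g \<circ> inv_into W f) ` f ` W = g ` W"
      using c(2) by (auto simp: image_comp o_def)
    have "continuous_map (top_of_set (f ` W)) (top_of_set (g ` W')) (g \<circ> inv_into W f)"
      using continuous_map_compose[OF c(6) e(3)] sub inv_into_f_f[OF c(2)]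
      by (auto simp: continuous_map_in_subtopology)
    then show "continuous_map (top_of_set (chart_dom (sheet_orbichart W f)))
        (top_of_set (chart_dom (sheet_orbichart W' g))) (g \<circ> inv_into W f)" by simp
    have "continuous_map (top_of_set (g ` W)) (top_of_set (f ` W)) (f \<circ> inv_into W g)"
      using continuous_map_compose[OF e(6) c(3)] unfolding continuous_map_in_subtopology
      by (auto simp: inv_into_into)
    moreover have "subtopology (top_of_set (g ` W')) (g ` W) = top_of_set (g ` W)"
      using sub by (simp add: subtopology_subtopology Int_absorb1 image_mono)
    ultimately show "continuous_map (subtopology (top_of_set (chart_dom (sheet_orbichart W' g)))
          ((g \<circ> inv_into W f) ` topspace (top_of_set (chart_dom (sheet_orbichart W f)))))
        (top_of_set (chart_dom (sheet_orbichart W f))) (f \<circ> inv_into W g)"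
      by (simp only: sheet_orbichart_simps topspace_euclidean_subtopology im)
    show "(f \<circ> inv_into W g) ((g \<circ> inv_into W f) z) = z"
      if "z \<in> topspace (top_of_set (chart_dom (sheet_orbichart W f)))" for z
      using that e(2) c(2) by (auto simp: inv_into_into)
  qed
  show "chart_map (sheet_orbichart W' g) ((g \<circ> inv_into W f) z) = chart_map (sheet_orbichart W f) z"
    if "z \<in> chart_dom (sheet_orbichart W f)" for z
    using that c(2) d(2) sub by auto
qed (use subgroup_trivial_BijGroup in simp_all)

text \<open>Over \<open>W\<close> the covering is trivial, so the product of its sign function
  \<open>s\<close> with the root \<open>k\<close> is a root \<open>u\<close> of the coordinate
  \<open>g\<close> on \<open>W\<close> itself; shifted by \<open>2 * \<i>\<close> it maps into the
  cone chart. The inverse squares and then passes through the two charts of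
  \<open>X\<close>.\<close>

lemma inclusion_sheet_cone:
  assumes f: "surface_chart X W f" and s: "splits W" and d: "cone_data p W' g k h" and sub: "W \<subseteq> W'"
  shows "orbifold_chart_inclusion (sheet_orbichart W f) (cone_orbichart W' g)"
proof -
  let ?B = "ball (2 * \<i>) 1"
  note c = surface_chart_inverse[OF f]
  have W': "openin X W'" and g: "homeomorphic_map (subtopology X W') (top_of_set (ball 0 1)) g"
    and k: "alternating W' k" "\<forall>y\<in>pre W'. (k y)\<^sup>2 = g (q y)"
    using d by (auto simp: cone_data_def)
  have WX: "W' \<subseteq> topspace X" using W' openin_subset by blast
  have gW: "inj_on g W'" "g ` W' = ball 0 1"
    using g WX by (auto simp: homeomorphic_eq_everything_map Int_absorb1)
  obtain s where s: "alternating W s" "\<forall>y\<in>pre W. (s y)\<^sup>2 = 1"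
    using s unfolding splits_def by blast
  obtain u where u: "continuous_map (subtopology X W) euclidean u"
      "\<And>y. y \<in> topspace Y \<Longrightarrow> q y \<in> W \<Longrightarrow> u (q y) = s y * k y"
    using alternating_mult_descend[OF s(1) alternating_mono[OF k(1) sub]] by blast
  have usq: "(u x)\<^sup>2 = g x" if x: "x \<in> W" for x
  proof -
    have "x \<in> topspace X" using x sub WX by blast
    then obtain y where "y \<in> topspace Y" "q y = x" using q_surj by blast
    then show ?thesis using u(2)[of y] s(2) k(2) x sub by (auto simp: power_mult_distrib)
  qed
  have uB: "u x \<in> ball 0 1" if "x \<in> W" for x
  proof -
    have "g x \<in> ball 0 1" using that sub gW by blast
    then have "(norm (u x))\<^sup>2 < 1" using usq[OF that] by (metis dist_0_norm mem_ball norm_power)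
    then show ?thesis by (simp add: abs_square_less_1)
  qed
  define j where "j z = u (inv_into W f z) + 2 * \<i>" for z
  have gj: "inv_into W' g ((j z - 2 * \<i>)\<^sup>2) = inv_into W f z" if "z \<in> f ` W" for z
  proof -
    have w: "inv_into W f z \<in> W" using that by (rule inv_into_into)
    then have "(j z - 2 * \<i>)\<^sup>2 = g (inv_into W f z)" using usq by (simp add: j_def)
    then show ?thesis using w sub gW(1) by (simp add: subset_iff)
  qed
  show ?thesis
  proof (rule orbifold_chart_inclusion_trivial[where j = j])
    show "chart_map (cone_orbichart W' g) (j z) = chart_map (sheet_orbichart W f) z"
      if "z \<in> chart_dom (sheet_orbichart W f)" for z
      using that gj by simp
    have "embedding_map (top_of_set (f ` W)) (top_of_set ?B) j"
    proof (rule embedding_map_left_inverse[where r = "\<lambda>w. f (inv_into W' g ((w - 2 * \<i>)\<^sup>2))"])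
      have "continuous_on (f ` W) (u \<circ> inv_into W f)"
        using continuous_map_compose[OF c(6) u(1)] by simp
      then have "continuous_on (f ` W) j"
        unfolding j_def o_def by (intro continuous_intros)
      moreover have "j z \<in> ?B" if "z \<in> f ` W" for z
        using uB[OF inv_into_into[OF that]] by (simp add: j_def dist_norm)
      ultimately show jc: "continuous_map (top_of_set (f ` W)) (top_of_set ?B) j"
        by (auto simp: continuous_map_in_subtopology)
      let ?T = "top_of_set (j ` f ` W)"
      have Wi: "inv_into W' g ((w - 2 * \<i>)\<^sup>2) \<in> W" if w: "w \<in> j ` f ` W" for w
      proof -
        obtain z where z: "z \<in> f ` W" "w = j z" using w by blast
        then show ?thesis using gj[OF z(1)] inv_into_into[OF z(1)] by simp
      qed
      have "continuous_map (top_of_set (ball 0 1)) (subtopology X W') (inv_into W' g)"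
        using homeomorphic_map_continuous_inv_into[OF g] WX by (simp add: Int_absorb1)
      moreover have "continuous_map ?T (top_of_set (ball 0 1)) (\<lambda>w. (w - 2 * \<i>)\<^sup>2)"
      proof -
        have "(w - 2 * \<i>)\<^sup>2 \<in> ball 0 1" if w: "w \<in> j ` f ` W" for w
        proof -
          obtain z where z: "z \<in> f ` W" "w = j z" using w by blast
          have "inv_into W f z \<in> W'" using inv_into_into[OF z(1)] sub by blast
          then show ?thesis
            using usq[OF inv_into_into[OF z(1)]] gW(2) z by (auto simp: j_def)
        qed
        then show ?thesis by (auto simp: continuous_map_in_subtopology intro!: continuous_intros)
      qed
      ultimately have "continuous_map ?T (subtopology X W') (inv_into W' g \<circ> (\<lambda>w. (w - 2 * \<i>)\<^sup>2))"
        by (rule continuous_map_compose[rotated])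
      then have "continuous_map ?T (subtopology X W) (inv_into W' g \<circ> (\<lambda>w. (w - 2 * \<i>)\<^sup>2))"
        using Wi by (auto simp: continuous_map_in_subtopology)
      from continuous_map_compose[OF this c(3)]
      have "continuous_map ?T euclidean (\<lambda>w. f (inv_into W' g ((w - 2 * \<i>)\<^sup>2)))"
        by (simp add: o_def)
      then have "continuous_map ?T (top_of_set (f ` W)) (\<lambda>w. f (inv_into W' g ((w - 2 * \<i>)\<^sup>2)))"
        using Wi unfolding continuous_map_in_subtopology by auto
      moreover have "subtopology (top_of_set ?B) (j ` topspace (top_of_set (f ` W))) = ?T"
        using jc by (auto simp: subtopology_subtopology continuous_map_in_subtopology intro!: arg_cong[of _ _ top_of_set])
      ultimately show "continuous_map (subtopology (top_of_set ?B) (j ` topspace (top_of_set (f ` W)))) (top_of_set (f ` W))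
          (\<lambda>w. f (inv_into W' g ((w - 2 * \<i>)\<^sup>2)))" by simp
      show "f (inv_into W' g ((j z - 2 * \<i>)\<^sup>2)) = z" if "z \<in> topspace (top_of_set (f ` W))" for z
        using that gj by (simp add: f_inv_into_f)
    qed
    then show "embedding_map (top_of_set (chart_dom (sheet_orbichart W f))) (top_of_set (chart_dom (cone_orbichart W' g))) j"
      by simp
  qed (use subgroup_cone_orbichart in simp_all)
qed

end

section \<open>The orbifold atlas\<close>

context folded_marked_surface begin

text \<open>The atlas has one cone chart per puncture, with pairwise disjoint images, and all sheet
  charts avoiding the punctures. Taking all of them keeps the atlas closed under intersections of a
  sheet chart with any chart; disjointness settles two different cone charts.\<close>

theorem double_surface_orbifold:
  "\<exists>\<C>. induced_orbifold_structure D sheet_group (\<lambda>C. the_elem (proj ` C)) X \<C> \<and>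
     (\<forall>p\<in>P. orbifold_point_of_order \<C> 2 p)"
proof -
  obtain G where G: "\<And>p. p \<in> P \<Longrightarrow> openin X (G p)" "\<And>p. p \<in> P \<Longrightarrow> p \<in> G p"
    "\<And>p p'. p \<in> P \<Longrightarrow> p' \<in> P \<Longrightarrow> p \<noteq> p' \<Longrightarrow> G p \<inter> G p' = {}"
    using Hausdorff_finite_disjoint_neighbourhoods[OF Hausdorff_X finite_P P_sub] by blast
  have "\<exists>d. fst d \<subseteq> G p \<and> cone_data p (fst d) (fst (snd d)) (fst (snd (snd d))) (snd (snd (snd d)))"
    if p: "p \<in> P" for p
  proof -
    obtain W f k h where "W \<subseteq> G p" "cone_data p W f k h"
      using ex_cone_data[OF p G(1,2)[OF p]] by blast
    then show ?thesis by (intro exI[of _ "(W, f, k, h)"]) simp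
  qed
  then have "\<exists>d. \<forall>p\<in>P. fst (d p) \<subseteq> G p \<and>
      cone_data p (fst (d p)) (fst (snd (d p))) (fst (snd (snd (d p)))) (snd (snd (snd (d p))))"
    by (intro bchoice ballI)
  then obtain d where d: "\<forall>p\<in>P. fst (d p) \<subseteq> G p \<and>
      cone_data p (fst (d p)) (fst (snd (d p))) (fst (snd (snd (d p)))) (snd (snd (snd (d p))))" ..
  define W where "W p = fst (d p)" for p
  define f where "f p = fst (snd (d p))" for p
  have WG: "W p \<subseteq> G p" and data: "cone_data p (W p) (f p) (fst (snd (snd (d p)))) (snd (snd (snd (d p))))"
    if "p \<in> P" for p
    using d that by (auto simp: W_def f_def)
  have W: "openin X (W p)" "p \<in> W p" "inj_on (f p) (W p)" "f p p = 0" if "p \<in> P" for p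
  proof -
    show o: "openin X (W p)" and "p \<in> W p" "f p p = 0" using data[OF that] by (auto simp: cone_data_def)
    have "homeomorphic_map (subtopology X (W p)) (top_of_set (ball 0 1)) (f p)"
      using data[OF that] by (simp add: cone_data_def)
    then show "inj_on (f p) (W p)"
      using openin_subset[OF o] by (auto simp: homeomorphic_eq_everything_map Int_absorb1)
  qed
  have disj: "W p \<inter> W p' = {}" if "p \<in> P" "p' \<in> P" "p \<noteq> p'" for p p'
    using G(3)[OF that] WG that by blast
  define \<A> where "\<A> = {sheet_orbichart V g |V g. surface_chart X V g \<and> V \<inter> P = {} \<and> splits V}"
  define \<B> where "\<B> = (\<lambda>p. cone_orbichart (W p) (f p)) ` P"
  have sheet_in: "sheet_orbichart V' g \<in> \<A>"
    if "surface_chart X V g" "V' \<subseteq> V" "openin X V'" "V' \<inter> P = {}" "splits V'" for V V' g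
    unfolding \<A>_def using surface_chart_restrict[OF that(1,3,2)] that by blast
  note cone = cone_orbichart_properties[OF data]
  have on: "orbifold_chart_on X c" if "c \<in> \<A> \<union> \<B>" for c
    using that sheet_orbichart_on cone(2) by (auto simp: \<A>_def \<B>_def)
  have "quotient_orbifold_chart D sheet_group orbit_proj c" if "c \<in> \<A> \<union> \<B>" for c
    using that quotient_orbifold_chart_sheet cone(1) by (auto simp: \<A>_def \<B>_def)
  moreover have "orbifold_structure X (\<A> \<union> \<B>)"
    unfolding orbifold_structure_def
  proof (intro conjI ballI impI Hausdorff_X on)
    have "chart_image c \<subseteq> topspace X" if "c \<in> \<A> \<union> \<B>" for c
      using on[OF that] openin_subset by (auto simp: orbifold_chart_on_def)
    moreover have "\<exists>c\<in>\<A> \<union> \<B>. x \<in> chart_image c" if x: "x \<in> topspace X" for x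
    proof (cases "x \<in> P")
      case True
      then have "cone_orbichart (W x) (f x) \<in> \<B>" "x \<in> chart_image (cone_orbichart (W x) (f x))"
        using cone(3) W(2) by (auto simp: \<B>_def)
      then show ?thesis by blast
    next
      case False
      obtain V where V: "openin X V" "x \<in> V" "splits V" using splits_locally[OF x False] by blast
      obtain U g where U: "surface_chart X U g" "x \<in> U" using chart_X[OF x] by blast
      define V' where "V' = U \<inter> V - P"
      have "closedin X P" using closedin_Hausdorff_finite[OF Hausdorff_X P_sub finite_P] .
      then have V': "openin X V'" "x \<in> V'" "V' \<subseteq> U" "V' \<inter> P = {}"
        using surface_chart_inverse(1)[OF U(1)] U V False by (auto simp: V'_def openin_diff)
      have "splits V'" by (rule splits_mono[OF V(3)]) (auto simp: V'_def)
      then have "sheet_orbichart V' g \<in> \<A>" using sheet_in[OF U(1)] V' by blast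
      moreover have "chart_image (sheet_orbichart V' g) = V'"
        using sheet_orbichart_on(2)[OF surface_chart_restrict[OF U(1) V'(1,3)]] .
      ultimately show ?thesis using V'(2) by blast
    qed
    ultimately show "(\<Union>c\<in>\<A> \<union> \<B>. chart_image c) = topspace X" by blast
  next
    have sheet_Int: "\<exists>b\<in>\<A> \<union> \<B>. chart_image b = chart_image c \<inter> chart_image c'"
      if c: "c \<in> \<A>" "c' \<in> \<A> \<union> \<B>" for c c'
    proof -
      obtain V g where V: "c = sheet_orbichart V g" "surface_chart X V g" "V \<inter> P = {}" "splits V"
        using c(1) by (auto simp: \<A>_def)
      define V' where "V' = V \<inter> chart_image c'"
      have "openin X (chart_image c')" using on[OF c(2)] by (simp add: orbifold_chart_on_def)
      then have V': "openin X V'" "V' \<subseteq> V" "splits V'" "V' \<inter> P = {}"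
        using surface_chart_inverse(1)[OF V(2)] V(3) splits_mono[OF V(4), of V'] by (auto simp: V'_def)
      have "chart_image c = V" using sheet_orbichart_on(2)[OF V(2)] V(1) by simp
      moreover have "chart_image (sheet_orbichart V' g) = V'"
        using sheet_orbichart_on(2)[OF surface_chart_restrict[OF V(2) V'(1,2)]] .
      ultimately have "chart_image (sheet_orbichart V' g) = chart_image c \<inter> chart_image c'"
        by (simp add: V'_def)
      moreover have "sheet_orbichart V' g \<in> \<A>" using sheet_in[OF V(2)] V' by blast
      ultimately show ?thesis by blast
    qed
    fix c c' assume c: "c \<in> \<A> \<union> \<B>" "c' \<in> \<A> \<union> \<B>"
    show "\<exists>b\<in>\<A> \<union> \<B>. chart_image b = chart_image c \<inter> chart_image c'"
    proof (cases "c \<in> \<A> \<or> c' \<in> \<A>")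
      case True
      then show ?thesis using sheet_Int[of c c'] sheet_Int[of c' c] c by (auto simp: Int_commute)
    next
      case False
      then obtain p p' where p: "p \<in> P" "p' \<in> P" "c = cone_orbichart (W p) (f p)" "c' = cone_orbichart (W p') (f p')"
        using c by (auto simp: \<B>_def)
      show ?thesis
      proof (cases "p = p'")
        case True
        then have "chart_image c = chart_image c \<inter> chart_image c'" using p by simp
        then show ?thesis using c(1) by blast
      next
        case False
        \<comment> \<open>The empty sheet chart represents the intersection of two different cone
          charts.\<close>
        obtain U g where U: "surface_chart X U g" using chart_X P_sub p(1) by blast
        have "splits {}" using splits_mono[OF splits_off_seg] by blast
        then have "sheet_orbichart {} g \<in> \<A>" using sheet_in[OF U, of "{}"] by simp
        moreover have "chart_image (sheet_orbichart {} g) = {}"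
          using sheet_orbichart_on(2)[OF surface_chart_restrict[OF U, of "{}"]] by simp
        moreover have "chart_image c \<inter> chart_image c' = {}"
          using disj[OF p(1,2) False] cone(3) p by simp
        ultimately show ?thesis by blast
      qed
    qed
    assume sub: "chart_image c \<subseteq> chart_image c'"
    consider (sheet) V g where "c = sheet_orbichart V g" "surface_chart X V g" "splits V"
      | (cone) p where "p \<in> P" "c = cone_orbichart (W p) (f p)"
      using c(1) by (auto simp: \<A>_def \<B>_def)
    then show "orbifold_chart_inclusion c c'"
    proof cases
      case sheet
      note img = sheet_orbichart_on(2)[OF sheet(2)]
      consider (sheet') V' g' where "c' = sheet_orbichart V' g'" "surface_chart X V' g'"
        | (cone') p where "p \<in> P" "c' = cone_orbichart (W p) (f p)"
        using c(2) by (auto simp: \<A>_def \<B>_def)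
      then show ?thesis
      proof cases
        case sheet'
        then show ?thesis
          using inclusion_sheet_sheet[OF sheet(2) sheet'(2)] sheet_orbichart_on(2)[OF sheet'(2)] sheet(1) img sub by simp
      next
        case cone'
        then show ?thesis
          using inclusion_sheet_cone[OF sheet(2,3) data[OF cone'(1)]] cone(3)[OF cone'(1)] sheet(1) img sub by simp
      qed
    next
      case (cone p)
      then have pc: "p \<in> chart_image c'" using sub cone_orbichart_properties(3)[OF data[OF cone(1)]] W(2)[OF cone(1)] by blast
      \<comment> \<open>Sheet charts avoid \<open>P\<close>, so an image containing the puncture
        belongs to a cone chart, by disjointness the same one.\<close>
      have "c' \<notin> \<A>"
      proof
        assume "c' \<in> \<A>"
        then obtain V g where "c' = sheet_orbichart V g" "surface_chart X V g" "V \<inter> P = {}"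
          by (auto simp: \<A>_def)
        then show False using sheet_orbichart_on(2)[of X V g] pc cone(1) by auto
      qed
      then obtain p' where p': "p' \<in> P" "c' = cone_orbichart (W p') (f p')" using c(2) by (auto simp: \<B>_def)
      then have "p \<in> W p'" using pc cone_orbichart_properties(3)[OF data[OF p'(1)]] by simp
      then have "p = p'" using disj[OF cone(1) p'(1)] W(2)[OF cone(1)] by blast
      then show ?thesis using cone p' orbifold_chart_inclusion_refl by simp
    qed
  qed
  ultimately have "induced_orbifold_structure D sheet_group (\<lambda>C. the_elem (proj ` C)) X (\<A> \<union> \<B>)"
    unfolding induced_orbifold_structure_def using homeomorphic_map_orbit_space by blast
  moreover have "orbifold_point_of_order (\<A> \<union> \<B>) 2 p" if "p \<in> P" for p
    using orbifold_point_cone_orbichart[of "W p" "f p" "\<A> \<union> \<B>" p] W[OF that] that by (auto simp: \<B>_def)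
  ultimately show ?thesis by blast
qed

end

section \<open>Folded sides\<close>

text \<open>\<open>disc_in\<close> only asks for a continuous injection. Read in a chart, invariance
  of domain makes the image of an open piece of the disc open in the plane, hence a neighbourhood in
  the surface.\<close>

lemma disc_in_neighbourhood:
  assumes T: "surface T" and u: "disc_in T u" and x: "x \<in> u ` ball 0 1"
  obtains N where "openin T N" "x \<in> N" "N \<subseteq> u ` ball 0 1"
proof -
  have cont: "continuous_map (top_of_set (ball 0 1)) T u"
    using u unfolding disc_in_def by (auto elim: continuous_map_from_subtopology_mono)
  have inj: "inj_on u (ball 0 1)" using u unfolding disc_in_def by (auto elim: inj_on_subset)
  obtain w where w: "w \<in> ball 0 1" "x = u w" using x by blast
  then have "x \<in> topspace T" using cont by (auto simp: continuous_map_def)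
  then obtain U f where chart: "surface_chart T U f" "x \<in> U" using T by (auto simp: surface_def)
  note c = surface_chart_inverse[OF chart(1)]
  define S where "S = {z \<in> ball 0 1. u z \<in> U}"
  have "openin (top_of_set (ball 0 1)) {z \<in> topspace (top_of_set (ball 0 1)). u z \<in> U}"
    by (rule openin_continuous_map_preimage[OF cont c(1)])
  then have "openin (top_of_set (ball 0 1)) S"
    unfolding topspace_euclidean_subtopology S_def .
  then have S: "open S" using openin_open_eq[OF open_ball] by blast
  have "continuous_map (top_of_set S) (subtopology T U) u"
  proof -
    have "S \<subseteq> ball 0 1" "\<And>z. z \<in> S \<Longrightarrow> u z \<in> U" by (auto simp: S_def)
    then show ?thesis
      using continuous_map_from_subtopology_mono[OF cont, of S] by (auto simp: continuous_map_in_subtopology)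
  qed
  from continuous_map_compose[OF this c(3)]
  have "continuous_on S (f \<circ> u)" by simp
  moreover have "inj_on (f \<circ> u) S"
    using inj c(2) by (auto simp: S_def inj_on_def)
  ultimately have "open ((f \<circ> u) ` S)" using invariance_of_domain[OF _ S] by blast
  then have N: "openin T {y \<in> U. f y \<in> f ` U \<inter> (f \<circ> u) ` S}"
    by (intro surface_chart_openin_preimage[OF chart(1)] openin_open_Int)
  show thesis
  proof (rule that[OF N])
    show "x \<in> {y \<in> U. f y \<in> f ` U \<inter> (f \<circ> u) ` S}" using chart w by (auto simp: S_def)
    show "{y \<in> U. f y \<in> f ` U \<inter> (f \<circ> u) ` S} \<subseteq> u ` ball 0 1"
    proof
      fix y assume "y \<in> {y \<in> U. f y \<in> f ` U \<inter> (f \<circ> u) ` S}"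
      then obtain z where z: "y \<in> U" "z \<in> S" "f y = f (u z)" by auto
      then have "y = u z" using c(2) by (auto simp: S_def inj_on_def)
      then show "y \<in> u ` ball 0 1" using z(2) unfolding S_def by blast
    qed
  qed
qed

lemma ideal_arc_inner:
  assumes "ideal_arc X M P \<gamma>" "t \<in> {0<..<1}"
  shows "\<gamma> t \<notin> M \<union> P"
proof -
  have "\<gamma> ` {0<..<1} \<inter> (M \<union> P \<union> surface_boundary X) = {}"
    using assms(1) by (simp add: ideal_arc_def)
  then show ?thesis using assms(2) by blast
qed

text \<open>The base point of the loop lies on the image of the circle and the puncture inside;
  hence the folded side has two different endpoints, which tells it apart from a loop.\<close>

lemma self_folded_triangleD:
  assumes "self_folded_triangle X M P \<tau> T l p e"
  obtains u where "disc_in X u" "u ` sphere 0 1 = l ` {0..1}" "p \<in> u ` ball 0 1"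
    "T = u ` ball 0 1 - e ` {0..1}" "T \<in> triangles X \<tau>" "l \<in> \<tau>" "e \<in> \<tau>" "p \<in> P" "l 0 = l 1"
    "{e 0, e 1} = {l 0, p}" "l 0 \<noteq> p" "e 0 \<noteq> e 1"
proof -
  obtain u where u: "disc_in X u" "u ` sphere 0 1 = l ` {0..1}" "p \<in> u ` ball 0 1"
    "T = u ` ball 0 1 - e ` {0..1}"
    using assms unfolding self_folded_triangle_def by blast
  have ends: "{e 0, e 1} = {l 0, p}" using assms unfolding self_folded_triangle_def by blast
  have "l 0 \<in> u ` sphere 0 1" unfolding u(2) by auto
  moreover have "u ` sphere 0 1 \<inter> u ` ball 0 1 = {}"
  proof -
    have "inj_on u (cball 0 1)" using u(1) by (simp add: disc_in_def)
    then have "u ` sphere 0 1 \<inter> u ` ball 0 1 = u ` (sphere 0 1 \<inter> ball 0 1)"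
      by (intro inj_on_image_Int[symmetric]) auto
    moreover have "sphere 0 1 \<inter> ball (0::complex) 1 = {}" by auto
    ultimately show ?thesis by simp
  qed
  ultimately have "l 0 \<noteq> p" using u(3) by blast
  moreover from this have "e 0 \<noteq> e 1" using ends by auto
  ultimately show thesis using that u ends assms unfolding self_folded_triangle_def by blast
qed

text \<open>Were the base point of the loop a puncture, the loop would start inside another self-folded
  triangle, which only contains the folded side as an arc.\<close>

lemma loop_base_marked:
  assumes X: "surface X" and \<tau>: "ideal_triangulation X M P \<tau>"
    and folded: "\<forall>p\<in>P. \<exists>T l. self_folded_triangle X M P \<tau> T l p (e p)"
    and T: "self_folded_triangle X M P \<tau> T l p (e p)"
  shows "l 0 \<in> M"
proof (rule ccontr)
  assume "l 0 \<notin> M"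
  have l: "l \<in> \<tau>" "l 0 = l 1" using self_folded_triangleD[OF T] by blast+
  have arc: "ideal_arc X M P \<gamma>" if "\<gamma> \<in> \<tau>" for \<gamma> using \<tau> that by (simp add: ideal_triangulation_def)
  have "l 0 \<in> P" using arc[OF l(1)] \<open>l 0 \<notin> M\<close> by (auto simp: ideal_arc_def)
  define p' where "p' = l 0"
  obtain T' l' where T': "self_folded_triangle X M P \<tau> T' l' p' (e p')"
    using folded \<open>l 0 \<in> P\<close> unfolding p'_def by blast
  obtain u where u: "disc_in X u" "p' \<in> u ` ball 0 1" "T' = u ` ball 0 1 - e p' ` {0..1}"
    "T' \<in> triangles X \<tau>" "e p' \<in> \<tau>" "e p' 0 \<noteq> e p' 1"
    using T' by (elim self_folded_triangleD) blast
  obtain N where N: "openin X N" "p' \<in> N" "N \<subseteq> u ` ball 0 1"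
    using disc_in_neighbourhood[OF X u(1,2)] by blast
  have "continuous_map (top_of_set {0..1}) X l"
    using arc[OF l(1)] by (simp add: ideal_arc_def pathin_def)
  then have "openin (top_of_set {0..1}) {t \<in> topspace (top_of_set {0..1}). l t \<in> N}"
    using N(1) by (rule openin_continuous_map_preimage)
  moreover have "0 \<in> {t \<in> topspace (top_of_set {0..1}). l t \<in> N}" using N(2) by (simp add: p'_def)
  ultimately obtain r where r: "r > 0" "ball 0 r \<inter> {0..1} \<subseteq> {t \<in> topspace (top_of_set {0..1}). l t \<in> N}"
    unfolding openin_contains_ball by blast
  \<comment> \<open>The parameter of an inner point of the loop, close enough to 0 for that point to
    lie in the disc of the other triangle.\<close>
  define t where "t = min (r/2) (1/2)"
  have t: "0 < t" "t < 1" "t \<in> ball 0 r \<inter> {0..1}" using r(1) by (auto simp: t_def)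
  then have "l t \<in> u ` ball 0 1" using r(2) N(3) by blast
  moreover have "l t \<notin> T'"
  proof -
    have "T' \<subseteq> topspace X - (\<Union>\<gamma>\<in>\<tau>. \<gamma> ` {0..1})"
      using connected_components_of_subset[OF u(4)[unfolded triangles_def]] by auto
    moreover have "l t \<in> (\<Union>\<gamma>\<in>\<tau>. \<gamma> ` {0..1})"
      using t by (intro UN_I[OF l(1)] imageI) simp
    ultimately show ?thesis by blast
  qed
  ultimately obtain s where s: "s \<in> {0..1}" "l t = e p' s" using u(3) by blast
  have "l t \<notin> M \<union> P" using ideal_arc_inner[OF arc[OF l(1)]] t by simp
  moreover have "e p' 0 \<in> M \<union> P" "e p' 1 \<in> M \<union> P" using arc[OF u(5)] by (simp_all add: ideal_arc_def)
  ultimately have "s \<noteq> 0" "s \<noteq> 1" using s(2) by auto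
  then have "s \<in> {0<..<1}" using s(1) by simp
  then have "l t \<in> e p' ` {0<..<1}" unfolding s(2) by (rule imageI)
  moreover have "l t \<in> l ` {0<..<1}" using t by (intro imageI) simp
  ultimately have "l ` {0<..<1} \<inter> e p' ` {0<..<1} \<noteq> {}" by blast
  \<comment> \<open>Arcs of the triangulation with a common inner point coincide, but
    \<open>l\<close> is a loop and \<open>e p'\<close> is not.\<close>
  moreover have "l \<noteq> e p' \<Longrightarrow> l ` {0<..<1} \<inter> e p' ` {0<..<1} = {}"
    using \<tau> l(1) u(5) by (simp add: ideal_triangulation_def)
  ultimately have "l = e p'" by blast
  then show False using l(2) u(6) by simp
qed

text \<open>Inner points of a folded side avoid \<open>M\<close>, \<open>P\<close> and the interiors
  of all other arcs, and its endpoints are the puncture and, by \<open>loop_base_marked\<close>, a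
  marked point. So different sides meet in endpoints only, and their punctures differ.\<close>

lemma folded_sides:
  assumes X: "surface X" and \<tau>: "ideal_triangulation X M P \<tau>" and MP: "M \<inter> P = {}"
    and folded: "\<forall>p\<in>P. \<exists>T l. self_folded_triangle X M P \<tau> T l p (e p)"
  shows "p \<in> P \<Longrightarrow> e p ` {0..1} \<inter> P \<subseteq> {p}"
    and "p \<in> P \<Longrightarrow> p' \<in> P \<Longrightarrow> p \<noteq> p' \<Longrightarrow> e p ` {0..1} \<inter> e p' ` {0..1} \<subseteq> M"
proof -
  have e\<tau>: "e p \<in> \<tau>" and ends: "e p t \<in> insert p M" and hit: "e p 0 = p \<or> e p 1 = p"
    if p: "p \<in> P" and t: "t = 0 \<or> t = 1" for p t
  proof -
    obtain T l where T: "self_folded_triangle X M P \<tau> T l p (e p)" using folded p by blast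
    have "l 0 \<in> M" by (rule loop_base_marked[OF X \<tau> folded T])
    moreover have "{e p 0, e p 1} = {l 0, p}" "e p \<in> \<tau>" using self_folded_triangleD[OF T] by blast+
    ultimately show "e p \<in> \<tau>" "e p t \<in> insert p M" "e p 0 = p \<or> e p 1 = p"
      using t by (auto simp: doubleton_eq_iff)
  qed
  have inner: "e p t \<notin> M \<union> P" if "p \<in> P" "t \<in> {0<..<1}" for p t
    using e\<tau>[OF that(1), of 0] \<tau> that(2) by (intro ideal_arc_inner[of X]) (simp_all add: ideal_triangulation_def)
  have split: "t = 0 \<or> t = 1 \<or> t \<in> {0<..<1}" if "t \<in> {0..1}" for t :: real using that by auto
  show "e p ` {0..1} \<inter> P \<subseteq> {p}" if p: "p \<in> P"
  proof
    fix x assume "x \<in> e p ` {0..1} \<inter> P"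
    then obtain t where t: "t \<in> {0..1}" "x = e p t" "x \<in> P" by blast
    then show "x \<in> {p}" using split[OF t(1)] inner[OF p, of t] ends[OF p, of t] MP by auto
  qed
  show "e p ` {0..1} \<inter> e p' ` {0..1} \<subseteq> M" if p: "p \<in> P" "p' \<in> P" "p \<noteq> p'"
  proof
    fix x assume "x \<in> e p ` {0..1} \<inter> e p' ` {0..1}"
    then obtain t s where t: "t \<in> {0..1}" "x = e p t" and s: "s \<in> {0..1}" "x = e p' s" by blast
    have ne: "e p \<noteq> e p'"
    proof
      assume eq: "e p = e p'"
      have "p \<in> insert p' M"
        using hit[OF p(1), of 0] ends[OF p(2), of 0] ends[OF p(2), of 1] eq by auto
      then show False using p MP by auto
    qed
    have "\<not> (t \<in> {0<..<1} \<and> s \<in> {0<..<1})"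
    proof
      assume ts: "t \<in> {0<..<1} \<and> s \<in> {0<..<1}"
      have "e p ` {0<..<1} \<inter> e p' ` {0<..<1} = {}"
        using \<tau> e\<tau>[OF p(1), of 0] e\<tau>[OF p(2), of 0] ne by (simp add: ideal_triangulation_def)
      then show False using ts t s by blast
    qed
    then have "t = 0 \<or> t = 1 \<or> s = 0 \<or> s = 1" using split t(1) s(1) by blast
    then have "x \<in> M \<union> P"
      using ends[OF p(1), of t] ends[OF p(2), of s] t s p by auto
    then have "t = 0 \<or> t = 1" "s = 0 \<or> s = 1"
      using inner[OF p(1), of t] inner[OF p(2), of s] split[OF t(1)] split[OF s(1)] t(2) s(2) by auto
    then have "x \<in> insert p M" "x \<in> insert p' M"
      using ends[OF p(1), of t] ends[OF p(2), of s] t(2) s(2) by simp_all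
    then show "x \<in> M" using p(3) by auto
  qed
qed

theorem corollary3p10:
  fixes X :: "'a topology" and A :: "('a set \<times> ('a \<Rightarrow> complex)) set"
    and M P :: "'a set" and \<tau> :: "(real \<Rightarrow> 'a) set" and e :: "'a \<Rightarrow> real \<Rightarrow> 'a"
    and Y :: "'b topology" and B :: "('b set \<times> ('b \<Rightarrow> complex)) set"
    and q :: "'b \<Rightarrow> 'a" and seg :: "'a \<Rightarrow> 'b set" and \<phi> :: "'a \<Rightarrow> 'b \<Rightarrow> real"
  assumes "marked_surface X A M P"
    and "P \<noteq> {}"
    and "\<not> once_punctured_monogon X M P"
    and "ideal_triangulation X M P \<tau>"
    and "\<forall>p\<in>P. \<exists>T l. self_folded_triangle X M P \<tau> T l p (e p)"
    and "\<not> (\<exists>T\<in>triangles X \<tau>. \<exists>T1 T2. T1 \<noteq> T2 \<and>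
            is_self_folded X M P \<tau> T1 \<and> is_self_folded X M P \<tau> T2 \<and>
            share_side X \<tau> T T1 \<and> share_side X \<tau> T T2)"
    and "cut_surface X A P e Y B q seg \<phi>"
  shows "\<exists>h. homeomorphic_map (orbit_space (double_surface P Y seg \<phi>) {id, sheet_exchange}) X h \<and>
           (\<exists>\<C>. induced_orbifold_structure (double_surface P Y seg \<phi>) {id, sheet_exchange} h X \<C> \<and>
                (\<forall>p\<in>P. orbifold_point_of_order \<C> 2 p))"
proof -
  have X: "surface X" and MP: "finite M" "M \<subseteq> surface_boundary X" "finite P" "P \<subseteq> surface_interior X"
    using assms(1) by (auto simp: marked_surface_def oriented_surface_def)
  have Y: "surface Y" "compact_space Y" "quotient_map Y X q"
    and fib: "\<And>x y. x \<in> topspace Y \<Longrightarrow> y \<in> topspace Y \<Longrightarrow>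
      q x = q y \<longleftrightarrow> equivclp (\<lambda>u v. (u, v) \<in> fold_relation P seg \<phi>) x y"
    using assms(7) by (auto simp: cut_surface_def oriented_surface_def)
  have seg: "seg p \<subseteq> surface_boundary Y" "homeomorphic_map (subtopology Y (seg p)) (top_of_set {0..1}) (\<phi> p)"
    "q ` seg p = e p ` {0..1}" "\<And>x. x \<in> seg p \<Longrightarrow> \<phi> p x = 1/2 \<Longrightarrow> q x = p" if "p \<in> P" for p
    using assms(7) that unfolding cut_surface_def by blast+
  have disj: "M \<inter> P = {}" using MP(2,4) by (auto simp: surface_interior_def)
  \<comment> \<open>As \<open>q\<close> maps \<open>seg p\<close> onto the side \<open>e p\<close>,
    statements on folded sides become statements on the points of the segments.\<close>
  note sides = folded_sides[OF X assms(4) disj assms(5)]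
  interpret folded_marked_surface X P Y q seg \<phi> M
  proof
    show "Hausdorff_space X" "Hausdorff_space Y" using X Y(1) by (simp_all add: surface_def)
    show "seg p \<subseteq> topspace Y" if "p \<in> P" for p
      by (rule subset_trans[OF seg(1)[OF that] surface_boundary_subset])
    show "q y = p" if "p \<in> P" "y \<in> seg p" "q y \<in> P" for p y
    proof -
      have "q y \<in> e p ` {0..1}" using seg(3)[OF that(1)] that(2) by blast
      then show ?thesis using sides(1)[OF that(1)] that(3) by blast
    qed
    show "q y \<in> M" if "p \<in> P" "p' \<in> P" "y \<in> seg p" "y' \<in> seg p'" "q y = q y'" "p \<noteq> p'" for p p' y y'
    proof -
      have "q y \<in> e p ` {0..1}" "q y \<in> e p' ` {0..1}"
        using seg(3)[OF that(1)] seg(3)[OF that(2)] that(3,4,5) by blast+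
      then show ?thesis using sides(2)[OF that(1,2,6)] by blast
    qed
    show "\<exists>U f. surface_chart Y U f \<and> y \<in> U" if "y \<in> topspace Y" for y
      using Y(1) that by (simp add: surface_def)
    show "\<exists>U f. surface_chart X U f \<and> x \<in> U" if "x \<in> topspace X" for x
      using X that by (simp add: surface_def)
  qed (fact Y(2,3) MP fib seg | (rule seg; assumption) | (rule fib; assumption))+
  \<comment> \<open>Both claims are met by the homeomorphism that \<open>proj\<close> induces on the
    orbits.\<close>
  show ?thesis
    using homeomorphic_map_orbit_space double_surface_orbifold by blast
qed

end
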